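(* Let $m\in\mathbb{Z}$ and let $\mathbf{c},\mathbf{d}\in\mathbb{C}$ be not both zero; put $\alpha=\mathbf{d}\,c+\mathbf{c}\,d$. The $\widehat{H}_4$-module $V=V_{\widehat{H}_4}(1,(m,1),\mathbf{1}_\alpha)$ is irreducible if and only if $\mathbf{c}\notin\mathbb{Z}$. Furthermore: (i) If $\mathbf{c}=m$, then $u=b(m)\mathbf{1}_\alpha$ is a singular vector, and $V/U(\widehat{H}_4)u$ is irreducible and isomorphic to $V_{\widehat{H}_4}(1,\mathbf{c},\mathbf{1}_\alpha)$. (ii) If $\mathbf{c}+n=m$ for some integer $n\ge1$, then all the linearly independent singular vectors are (that is, a basis of the span of the homogeneous singular vectors is given by) the vectors $$u^k=\Big[\sum_{\lambda\in P(n)}\Big(a_\lambda\, c(-\lambda)\,b(m)+\sum_{i=1}^{k_\lambda}b_{\lambda\setminus\lambda_i,\lambda_i}\,c(-\lambda\setminus\lambda_i)\,b(-\lambda_i+m)\Big)\Big]^k\mathbf{1}_\alpha,\qquad k\in\mathbb{Z},\ k\ge0,$$ where the complex coefficients $a_\lambda$, $b_{\rho,p}$ (not all zero) satisfy, for all $\lambda\in P(n)$ and $i=1,\dots,k_\lambda$, $$a_\lambda q_i\lambda_i-b_{\lambda\setminus\lambda_i,\lambda_i}=0,\qquad b_{\lambda\setminus\lambda_i,\lambda_i}(-n+\lambda_i)+\sum_{j=1}^{k_\lambda}b_{\lambda\setminus\lambda_i\setminus\lambda_j,\ \lambda_i+\lambda_j}=0.$$ (iii) If $\mathbf{c}=m+n$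 for some integer $n\ge1$, then all the linearly independent singular vectors are (in the same sense) the vectors $$u^k=\Big[\sum_{\lambda\in P(n)}\sum_{i=1}^{k_\lambda}c_{\lambda\setminus\lambda_i,\lambda_i}\,c(-\lambda\setminus\lambda_i)\,a(-\lambda_i-m)\Big]^k\mathbf{1}_\alpha,\qquad k\in\mathbb{Z},\ k\ge0,$$ where the complex coefficients $c_{\rho,p}$ (not all zero) satisfy, for all $\lambda\in P(n)$, $$q_i\lambda_i\,c_{\lambda\setminus\lambda_j,\lambda_j}+c_{\lambda\setminus\lambda_i\setminus\lambda_j,\ \lambda_i+\lambda_j}=0\quad(i,j=1,\dots,k_\lambda,\ i\ne j),$$ $$c_{\lambda\setminus\lambda_i,\lambda_i}(-n+\lambda_i)-\sum_{j=1}^{k_\lambda}c_{\lambda\setminus\lambda_i\setminus\lambda_j,\ \lambda_i+\lambda_j}=0\quad(i=1,\dots,k_\lambda).$$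
   Context: $H_4$ is the complex Lie algebra with basis $a,b,c,d$ and brackets $[a,b]=c$, $[d,a]=a$, $[d,b]=-b$, $[c,d]=[c,a]=[c,b]=0$, with the symmetric bilinear form $(a,b)=1$, $(c,d)=1$, all other pairings of basis vectors $0$. The affine Nappi-Witten algebra is $\widehat{H}_4=H_4\otimes\mathbb{C}[t,t^{-1}]\oplus\mathbb{C}\mathbf{k}$ with $\mathbf k$ central and $[x\otimes t^p,y\otimes t^q]=[x,y]\otimes t^{p+q}+p\,(x,y)\,\delta_{p+q,0}\,\mathbf{k}$. Write $x(n)$ for the action of $x\otimes t^n$. $\mathfrak{h}=\mathbb{C}c\oplus\mathbb{C}d$ is identified with $\mathfrak h^*$ via the form, so $\alpha=\mathbf{d}c+\mathbf{c}d$ has $\alpha(c)=\mathbf{c}$, $\alpha(d)=\mathbf{d}$ ($\mathbf c,\mathbf d$ are complex numbers, $c,d\in H_4$). For $m\in\mathbb{Z}$, $\epsilon\in\{0,1\}$ let $$\widehat{H}_4(m,\epsilon)=\bigoplus_{n\ge -m}\mathbb{C}\,a\otimes t^n\oplus\bigoplus_{n\ge m+\epsilon}\mathbb{C}\,b\otimes t^n\oplus(\mathbb{C}c\oplus\mathbb{C}d)\otimes\mathbb{C}[t]\oplus\mathbb{C}\mathbf{k}.$$ Let $\mathbb{C}_\alpha=\mathbb{C}\mathbf{1}_\alpha$ be the one-dimensional $\widehat{H}_4(m,\epsilon)$-module on which $a\otimes t^s$ ($s\ge -m$), $b\otimes t^r$ ($r\ge m+\epsilon$), $c\otimes t^l,d\otimes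 t^l$ ($l\ge1$) act as $0$ and $c\otimes t^0,d\otimes t^0,\mathbf{k}$ act as $\mathbf{c},\mathbf{d},1$ (for $\epsilon=0$ this is only used when $m=\mathbf{c}$). Put $V_{\widehat{H}_4}(1,(m,\epsilon),\mathbf{1}_\alpha)=U(\widehat{H}_4)\otimes_{U(\widehat{H}_4(m,\epsilon))}\mathbb{C}_\alpha$, and write $V_{\widehat{H}_4}(1,\mathbf{c},\mathbf{1}_\alpha)$ for it when $\epsilon=0$ and $m=\mathbf{c}\in\mathbb{Z}$. Grading: $U(\widehat{H}_4)$ is $\mathbb{Z}$-graded by $\deg a(-n-m)=n-1$, $\deg b(-n+m)=n+1$, $\deg c(-n)=\deg d(-n)=n$ ($n\in\mathbb{Z}$), $\deg\mathbf{k}=0$, and $V_{\widehat{H}_4}(1,(m,1),\mathbf{1}_\alpha)$ is graded by $\mathbb{Z}_{\ge0}$ with $\deg\mathbf{1}_\alpha=0$. A homogeneous element $u$ is a (homogeneous) singular vector if $x\cdot u=0$ for all $x$ in $$\widehat{H}_4((m,1),+)=\bigoplus_{n\ge -m}\mathbb{C}\,a\otimes t^n\oplus\bigoplus_{n\ge m+1}\mathbb{C}\,b\otimes t^n\oplus(\mathbb{C}c\oplus\mathbb{C}d)\otimes t\,\mathbb{C}[t].$$ Partitions: $P(n)$ is the set of partitions of $n$. Each $\lambda\in P(n)$ is written $\lambda=(\lambda_1^{(q_1)},\dots,\lambda_{k_\lambda}^{(q_{k_\lambda})})$, with distinct parts $\lambda_1,\dots,\lambda_{k_\lambda}$ of multiplicities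 $q_i\ge1$, $\sum_i q_i\lambda_i=n$; $\lambda\setminus\lambda_i$ is $\lambda$ with one copy of $\lambda_i$ removed. For a partition $\rho=(\rho_1,\dots,\rho_r)$, $c(-\rho)=c(-\rho_1)\cdots c(-\rho_r)$, with $c(-\emptyset)=1$. The coefficients $a_\lambda$ are indexed by $\lambda\in P(n)$; $b_{\rho,p}$ and $c_{\rho,p}$ are indexed by pairs of a partition $\rho$ and an integer $p\ge1$ with $|\rho|+p=n$. A coefficient whose index $\lambda\setminus\lambda_i\setminus\lambda_j$ is undefined (i.e. $j=i$ and $q_i=1$) is taken to be $0$. *)

theory Defs
  imports Complex_Main "HOL-Library.Multiset" "HOL-Library.Poly_Mapping" "HOL-Algebra.Algebra"
begin

section \<open>Lie algebras with a distinguished basis and their enveloping algebras\<close>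

text \<open>
  A complex vector space with basis \<open>'i\<close> is the type \<open>'i \<Rightarrow>\<^sub>0 complex\<close>; a bracket (or any
  bilinear operation) is given by its values on basis vectors and extended bilinearly.
\<close>

definition scaleV :: "complex \<Rightarrow> ('i \<Rightarrow>\<^sub>0 complex) \<Rightarrow> ('i \<Rightarrow>\<^sub>0 complex)" where
  "scaleV z v = Poly_Mapping.map ((*) z) v"

definition bilinear_extension ::
    "('i \<Rightarrow> 'i \<Rightarrow> ('j \<Rightarrow>\<^sub>0 complex)) \<Rightarrow> ('i \<Rightarrow>\<^sub>0 complex) \<Rightarrow> ('i \<Rightarrow>\<^sub>0 complex) \<Rightarrow> ('j \<Rightarrow>\<^sub>0 complex)" where
  "bilinear_extension br x y =
     (\<Sum>i\<in>Poly_Mapping.keys x. \<Sum>j\<in>Poly_Mapping.keys y.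
        scaleV (Poly_Mapping.lookup x i * Poly_Mapping.lookup y j) (br i j))"

text \<open>Words form the free monoid under concatenation, so \<open>'i word \<Rightarrow>\<^sub>0 complex\<close>, with its
  convolution product, is the tensor algebra of \<open>'i \<Rightarrow>\<^sub>0 complex\<close>.\<close>

datatype 'i word = Word (letters: "'i list")

instantiation word :: (type) monoid_add
begin

definition zero_word :: "'a word" where "0 = Word []"

definition plus_word :: "'a word \<Rightarrow> 'a word \<Rightarrow> 'a word" where
  "v + w = Word (letters v @ letters w)"

instance
  by standard (simp_all add: zero_word_def plus_word_def)

end

text \<open>The tensor algebra of the subspace spanned by the basis vectors in \<open>S\<close>.\<close>

definition tensor_alg :: "'i set \<Rightarrow> ('i word \<Rightarrow>\<^sub>0 complex) ring" where
  "tensor_alg S =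
     \<lparr>carrier = {t. \<forall>w\<in>Poly_Mapping.keys t. set (letters w) \<subseteq> S},
      monoid.mult = (*), one = 1, ring.zero = 0, add = (+)\<rparr>"

definition tensor_incl :: "('i \<Rightarrow>\<^sub>0 complex) \<Rightarrow> ('i word \<Rightarrow>\<^sub>0 complex)" where
  "tensor_incl x =
     (\<Sum>i\<in>Poly_Mapping.keys x. Poly_Mapping.single (Word [i]) (Poly_Mapping.lookup x i))"

text \<open>
  \<open>uea br S\<close> is the universal enveloping algebra of the Lie subalgebra spanned by the basis
  vectors in \<open>S\<close> (this span is assumed closed under the bracket), that is, the tensor algebra
  modulo the two-sided ideal generated by the elements \<open>x \<otimes> y - y \<otimes> x - [x, y]\<close>.
\<close>

definition uea_ideal :: "('i \<Rightarrow> 'i \<Rightarrow> ('i \<Rightarrow>\<^sub>0 complex)) \<Rightarrow> 'i set \<Rightarrow> ('i word \<Rightarrow>\<^sub>0 complex) set" where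
  "uea_ideal br S =
     Idl\<^bsub>tensor_alg S\<^esub>
       {tensor_incl x * tensor_incl y - tensor_incl y * tensor_incl x
          - tensor_incl (bilinear_extension br x y) | x y.
        Poly_Mapping.keys x \<subseteq> S \<and> Poly_Mapping.keys y \<subseteq> S}"

definition uea :: "('i \<Rightarrow> 'i \<Rightarrow> ('i \<Rightarrow>\<^sub>0 complex)) \<Rightarrow> 'i set \<Rightarrow> ('i word \<Rightarrow>\<^sub>0 complex) set ring" where
  "uea br S = tensor_alg S Quot uea_ideal br S"


section \<open>Left modules over a noncommutative ring\<close>

text \<open>
  The library locale \<open>module\<close> requires a commutative ring of scalars, so only its record type and
  the locale \<open>submodule\<close> (which makes no such assumption) are used.  The fields \<open>mult\<close> and \<open>one\<close>
  of the record have no meaning for a module.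
\<close>

definition irreducible_module :: "'r ring \<Rightarrow> ('r, 'v) module \<Rightarrow> bool" where
  "irreducible_module R M \<longleftrightarrow>
     carrier M \<noteq> {\<zero>\<^bsub>M\<^esub>} \<and>
     (\<forall>H. submodule H R M \<longrightarrow> H = {\<zero>\<^bsub>M\<^esub>} \<or> H = carrier M)"

definition module_isomorphic :: "'r ring \<Rightarrow> ('r, 'v) module \<Rightarrow> ('r, 'w) module \<Rightarrow> bool" where
  "module_isomorphic R M N \<longleftrightarrow>
     (\<exists>f. bij_betw f (carrier M) (carrier N) \<and>
          (\<forall>x\<in>carrier M. \<forall>y\<in>carrier M. f (x \<oplus>\<^bsub>M\<^esub> y) = f x \<oplus>\<^bsub>N\<^esub> f y) \<and>
          (\<forall>r\<in>carrier R. \<forall>x\<in>carrier M. f (r \<odot>\<^bsub>M\<^esub> x) = r \<odot>\<^bsub>N\<^esub> f x))"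

definition cyclic_submodule :: "'r ring \<Rightarrow> ('r, 'v) module \<Rightarrow> 'v \<Rightarrow> 'v set" where
  "cyclic_submodule R M v = (\<lambda>r. r \<odot>\<^bsub>M\<^esub> v) ` carrier R"

definition quotient_module :: "('r, 'v) module \<Rightarrow> 'v set \<Rightarrow> ('r, 'v set) module" where
  "quotient_module M H =
     \<lparr>carrier = a_rcosets\<^bsub>M\<^esub> H, monoid.mult = undefined, one = undefined,
      ring.zero = H, add = set_add M,
      smult = (\<lambda>r B. \<Union>x\<in>B. H +>\<^bsub>M\<^esub> (r \<odot>\<^bsub>M\<^esub> x))\<rparr>"

text \<open>
  The tensor product \<open>R \<otimes>\<^sub>P N\<close> of a ring \<open>R\<close>, viewed as a right \<open>P\<close>-module through a ring
  homomorphism \<open>\<phi>\<close> from \<open>P\<close> to \<open>R\<close>, and a left \<open>P\<close>-module \<open>N\<close>: the free abelian group on pairs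
  \<open>(u, z)\<close> modulo biadditivity and \<open>P\<close>-balancedness, with \<open>R\<close> acting on the left factor.
\<close>

definition tensor_kernel ::
    "'p ring \<Rightarrow> ('p \<Rightarrow> 'r) \<Rightarrow> 'r ring \<Rightarrow> ('p, 'n) module \<Rightarrow> ('r \<times> 'n \<Rightarrow>\<^sub>0 int) set" where
  "tensor_kernel P \<phi> R N =
     generate (free_Abelian_group (carrier R \<times> carrier N))
       ({frag_of (u \<oplus>\<^bsub>R\<^esub> u', z) - frag_of (u, z) - frag_of (u', z) | u u' z.
           u \<in> carrier R \<and> u' \<in> carrier R \<and> z \<in> carrier N} \<union>
        {frag_of (u, z \<oplus>\<^bsub>N\<^esub> z') - frag_of (u, z) - frag_of (u, z') | u z z'.
           u \<in> carrier R \<and> z \<in> carrier N \<and> z' \<in> carrier N} \<union>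
        {frag_of (u \<otimes>\<^bsub>R\<^esub> \<phi> p, z) - frag_of (u, p \<odot>\<^bsub>N\<^esub> z) | u p z.
           u \<in> carrier R \<and> p \<in> carrier P \<and> z \<in> carrier N})"

definition pure_tensor ::
    "'p ring \<Rightarrow> ('p \<Rightarrow> 'r) \<Rightarrow> 'r ring \<Rightarrow> ('p, 'n) module \<Rightarrow> 'r \<Rightarrow> 'n \<Rightarrow> ('r \<times> 'n \<Rightarrow>\<^sub>0 int) set" where
  "pure_tensor P \<phi> R N u z =
     tensor_kernel P \<phi> R N #>\<^bsub>free_Abelian_group (carrier R \<times> carrier N)\<^esub> frag_of (u, z)"

definition extend_scalars ::
    "'p ring \<Rightarrow> ('p \<Rightarrow> 'r) \<Rightarrow> 'r ring \<Rightarrow> ('p, 'n) module \<Rightarrow> ('r, ('r \<times> 'n \<Rightarrow>\<^sub>0 int) set) module" where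
  "extend_scalars P \<phi> R N =
     (let F = free_Abelian_group (carrier R \<times> carrier N);
          K = tensor_kernel P \<phi> R N;
          Q = F Mod K
      in \<lparr>carrier = carrier Q, monoid.mult = undefined, one = undefined,
          ring.zero = one Q, add = monoid.mult Q,
          smult = (\<lambda>r B. \<Union>f\<in>B. K #>\<^bsub>F\<^esub> frag_extend (\<lambda>(u, z). frag_of (r \<otimes>\<^bsub>R\<^esub> u, z)) f)\<rparr>)"


section \<open>The affine Nappi-Witten algebra\<close>

datatype h4 = Ha | Hb | Hc | Hd

fun h4_br :: "h4 \<Rightarrow> h4 \<Rightarrow> (h4 \<Rightarrow>\<^sub>0 complex)" where
  "h4_br Ha Hb = Poly_Mapping.single Hc 1"
| "h4_br Hb Ha = Poly_Mapping.single Hc (- 1)"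
| "h4_br Hd Ha = Poly_Mapping.single Ha 1"
| "h4_br Ha Hd = Poly_Mapping.single Ha (- 1)"
| "h4_br Hd Hb = Poly_Mapping.single Hb (- 1)"
| "h4_br Hb Hd = Poly_Mapping.single Hb 1"
| "h4_br _ _ = 0"

fun h4_form :: "h4 \<Rightarrow> h4 \<Rightarrow> complex" where
  "h4_form Ha Hb = 1"
| "h4_form Hb Ha = 1"
| "h4_form Hc Hd = 1"
| "h4_form Hd Hc = 1"
| "h4_form _ _ = 0"

text \<open>The basis of the affinization: \<open>At x n\<close> is \<open>x \<otimes> t\<^sup>n\<close> and \<open>KK\<close> is the central element.\<close>

datatype nw = At h4 int | KK

fun nw_br :: "nw \<Rightarrow> nw \<Rightarrow> (nw \<Rightarrow>\<^sub>0 complex)" where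
  "nw_br (At x p) (At y q) =
     (\<Sum>z\<in>Poly_Mapping.keys (h4_br x y).
        Poly_Mapping.single (At z (p + q)) (Poly_Mapping.lookup (h4_br x y) z))
     + Poly_Mapping.single KK (if p + q = 0 then of_int p * h4_form x y else 0)"
| "nw_br _ KK = 0"
| "nw_br KK _ = 0"

abbreviation NWU :: "(nw word \<Rightarrow>\<^sub>0 complex) set ring" where
  "NWU \<equiv> uea nw_br UNIV"

definition nwu_class :: "(nw word \<Rightarrow>\<^sub>0 complex) \<Rightarrow> (nw word \<Rightarrow>\<^sub>0 complex) set" where
  "nwu_class t = uea_ideal nw_br UNIV +>\<^bsub>tensor_alg UNIV\<^esub> t"

definition nwu_lie :: "(nw \<Rightarrow>\<^sub>0 complex) \<Rightarrow> (nw word \<Rightarrow>\<^sub>0 complex) set" where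
  "nwu_lie x = nwu_class (tensor_incl x)"

definition nwu_mode :: "h4 \<Rightarrow> int \<Rightarrow> (nw word \<Rightarrow>\<^sub>0 complex) set" where
  "nwu_mode x n = nwu_lie (Poly_Mapping.single (At x n) 1)"

definition nwu_scalar :: "complex \<Rightarrow> (nw word \<Rightarrow>\<^sub>0 complex) set" where
  "nwu_scalar z = nwu_class (Poly_Mapping.single 0 z)"


section \<open>Induced modules of level one\<close>

text \<open>The basis of the subalgebra \<open>H\<^sub>4(m, \<epsilon>)\<close>, \<open>\<epsilon> \<in> {0, 1}\<close>.\<close>

definition nw_sub :: "int \<Rightarrow> int \<Rightarrow> nw set" where
  "nw_sub m \<epsilon> =
     {At Ha n | n. n \<ge> - m} \<union> {At Hb n | n. n \<ge> m + \<epsilon>} \<union>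
     {At Hc n | n. n \<ge> 0} \<union> {At Hd n | n. n \<ge> 0} \<union> {KK}"

text \<open>The homomorphism \<open>U(H\<^sub>4(m, \<epsilon>)) \<rightarrow> U(H\<^sub>4)\<close> induced by the inclusion: it sends the class of a
  tensor modulo the smaller ideal to its class modulo the larger one.\<close>

definition nwu_incl :: "(nw word \<Rightarrow>\<^sub>0 complex) set \<Rightarrow> (nw word \<Rightarrow>\<^sub>0 complex) set" where
  "nwu_incl B = uea_ideal nw_br UNIV <+>\<^bsub>tensor_alg UNIV\<^esub> B"

fun nw_char :: "complex \<Rightarrow> complex \<Rightarrow> nw \<Rightarrow> complex" where
  "nw_char cc dd KK = 1"
| "nw_char cc dd (At Hc n) = (if n = 0 then cc else 0)"
| "nw_char cc dd (At Hd n) = (if n = 0 then dd else 0)"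
| "nw_char cc dd (At _ _) = 0"

definition nw_char_tensor :: "complex \<Rightarrow> complex \<Rightarrow> (nw word \<Rightarrow>\<^sub>0 complex) \<Rightarrow> complex" where
  "nw_char_tensor cc dd t =
     (\<Sum>w\<in>Poly_Mapping.keys t.
        Poly_Mapping.lookup t w * prod_list (map (nw_char cc dd) (letters w)))"

text \<open>
  The one-dimensional \<open>U(H\<^sub>4(m, \<epsilon>))\<close>-module, with generator \<open>1\<close>.  The extension of the character to
  the tensor algebra is constant on each class modulo the defining ideal of \<open>U(H\<^sub>4(m, \<epsilon>))\<close>
  (for \<open>\<epsilon> = 0\<close> this needs \<open>cc = m\<close>), and the class acts by that constant.
\<close>

definition nw_line :: "complex \<Rightarrow> complex \<Rightarrow> ((nw word \<Rightarrow>\<^sub>0 complex) set, complex) module" where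
  "nw_line cc dd =
     \<lparr>carrier = UNIV, monoid.mult = undefined, one = undefined, ring.zero = 0, add = (+),
      smult = (\<lambda>B z. the_elem (nw_char_tensor cc dd ` B) * z)\<rparr>"

type_synonym nwv = "((nw word \<Rightarrow>\<^sub>0 complex) set \<times> complex \<Rightarrow>\<^sub>0 int) set"
type_synonym nw_module = "((nw word \<Rightarrow>\<^sub>0 complex) set, nwv) module"

definition nw_verma :: "complex \<Rightarrow> complex \<Rightarrow> int \<Rightarrow> int \<Rightarrow> nw_module" where
  "nw_verma cc dd m \<epsilon> = extend_scalars (uea nw_br (nw_sub m \<epsilon>)) nwu_incl NWU (nw_line cc dd)"

definition nw_vac :: "complex \<Rightarrow> complex \<Rightarrow> int \<Rightarrow> int \<Rightarrow> nwv" where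
  "nw_vac cc dd m \<epsilon> =
     pure_tensor (uea nw_br (nw_sub m \<epsilon>)) nwu_incl NWU (nw_line cc dd) \<one>\<^bsub>NWU\<^esub> 1"


section \<open>Grading and singular vectors\<close>

text \<open>The conventions \<open>deg a(-n-m) = n-1\<close> and \<open>deg b(-n+m) = n+1\<close>, solved for the mode index.\<close>

fun nw_deg :: "int \<Rightarrow> nw \<Rightarrow> int" where
  "nw_deg m (At Ha j) = - j - m - 1"
| "nw_deg m (At Hb j) = - j + m + 1"
| "nw_deg m (At Hc j) = - j"
| "nw_deg m (At Hd j) = - j"
| "nw_deg m KK = 0"

definition nwu_homogeneous :: "int \<Rightarrow> int \<Rightarrow> (nw word \<Rightarrow>\<^sub>0 complex) set set" where
  "nwu_homogeneous m d =
     nwu_class ` {t. \<forall>w\<in>Poly_Mapping.keys t. sum_list (map (nw_deg m) (letters w)) = d}"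

definition nw_homogeneous :: "complex \<Rightarrow> complex \<Rightarrow> int \<Rightarrow> nat \<Rightarrow> nwv set" where
  "nw_homogeneous cc dd m d =
     (\<lambda>x. x \<odot>\<^bsub>nw_verma cc dd m 1\<^esub> nw_vac cc dd m 1) ` nwu_homogeneous m (int d)"

text \<open>The basis of \<open>H\<^sub>4((m, 1), +)\<close>.\<close>

definition nw_plus :: "int \<Rightarrow> nw set" where
  "nw_plus m =
     {At Ha n | n. n \<ge> - m} \<union> {At Hb n | n. n \<ge> m + 1} \<union>
     {At Hc n | n. n \<ge> 1} \<union> {At Hd n | n. n \<ge> 1}"

definition nw_singular :: "complex \<Rightarrow> complex \<Rightarrow> int \<Rightarrow> nwv \<Rightarrow> bool" where
  "nw_singular cc dd m v \<longleftrightarrow>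
     (\<exists>d. v \<in> nw_homogeneous cc dd m d) \<and>
     (\<forall>x. Poly_Mapping.keys x \<subseteq> nw_plus m \<longrightarrow>
        nwu_lie x \<odot>\<^bsub>nw_verma cc dd m 1\<^esub> v = \<zero>\<^bsub>nw_verma cc dd m 1\<^esub>)"

definition nw_span :: "nw_module \<Rightarrow> nwv set \<Rightarrow> nwv set" where
  "nw_span M S =
     {(\<Oplus>\<^bsub>M\<^esub>v\<in>A. nwu_scalar (f v) \<odot>\<^bsub>M\<^esub> v) | A f. finite A \<and> A \<subseteq> S}"

definition nw_independent :: "nw_module \<Rightarrow> (nat \<Rightarrow> nwv) \<Rightarrow> bool" where
  "nw_independent M e \<longleftrightarrow>
     (\<forall>A f. finite A \<longrightarrow> (\<Oplus>\<^bsub>M\<^esub>k\<in>A. nwu_scalar (f k) \<odot>\<^bsub>M\<^esub> e k) = \<zero>\<^bsub>M\<^esub> \<longrightarrow> (\<forall>k\<in>A. f k = 0))"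

definition nw_singular_basis :: "complex \<Rightarrow> complex \<Rightarrow> int \<Rightarrow> (nat \<Rightarrow> nwv) \<Rightarrow> bool" where
  "nw_singular_basis cc dd m e \<longleftrightarrow>
     (\<forall>k. nw_singular cc dd m (e k)) \<and>
     nw_independent (nw_verma cc dd m 1) e \<and>
     nw_span (nw_verma cc dd m 1) (range e) =
       nw_span (nw_verma cc dd m 1) {v. nw_singular cc dd m v}"


section \<open>Partitions and the candidate singular vectors\<close>

definition Part :: "nat \<Rightarrow> nat multiset set" where
  "Part n = {\<mu>. 0 \<notin># \<mu> \<and> sum_mset \<mu> = n}"

text \<open>\<open>c(-\<rho>)\<close>; the \<open>c\<close>-modes commute, so the order of the factors is immaterial.\<close>

definition cprod :: "nat multiset \<Rightarrow> (nw word \<Rightarrow>\<^sub>0 complex) set" where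
  "cprod \<rho> = foldr (\<lambda>p x. nwu_mode Hc (- int p) \<otimes>\<^bsub>NWU\<^esub> x) (sorted_list_of_multiset \<rho>) \<one>\<^bsub>NWU\<^esub>"

text \<open>
  For parts \<open>p\<close>, \<open>q\<close> of \<open>\<mu>\<close>, the coefficient with index \<open>(\<mu> - {p, q}, p + q)\<close>, read as \<open>0\<close> when
  this is undefined, that is, when \<open>p = q\<close> has multiplicity one.
\<close>

definition merged :: "(nat multiset \<Rightarrow> nat \<Rightarrow> complex) \<Rightarrow> nat multiset \<Rightarrow> nat \<Rightarrow> nat \<Rightarrow> complex" where
  "merged b \<mu> p q = (if {#p, q#} \<subseteq># \<mu> then b (\<mu> - {#p, q#}) (p + q) else 0)"

text \<open>The distinct parts of \<open>\<mu>\<close> are \<open>set_mset \<mu>\<close>, and \<open>count \<mu> p\<close> is the multiplicity of \<open>p\<close>.  Only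
  the values of \<open>a\<close>, \<open>b\<close>, \<open>c\<close> at indices occurring in the sums matter.\<close>

definition b_coefficients ::
    "nat \<Rightarrow> (nat multiset \<Rightarrow> complex) \<Rightarrow> (nat multiset \<Rightarrow> nat \<Rightarrow> complex) \<Rightarrow> bool" where
  "b_coefficients n a b \<longleftrightarrow>
     ((\<exists>\<mu>\<in>Part n. a \<mu> \<noteq> 0) \<or> (\<exists>p\<in>{1..n}. \<exists>\<rho>\<in>Part (n - p). b \<rho> p \<noteq> 0)) \<and>
     (\<forall>\<mu>\<in>Part n. \<forall>p\<in>set_mset \<mu>.
        a \<mu> * of_nat (count \<mu> p) * of_nat p - b (\<mu> - {#p#}) p = 0 \<and>
        b (\<mu> - {#p#}) p * (- of_nat n + of_nat p) + (\<Sum>q\<in>set_mset \<mu>. merged b \<mu> p q) = 0)"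

definition b_operator ::
    "int \<Rightarrow> nat \<Rightarrow> (nat multiset \<Rightarrow> complex) \<Rightarrow> (nat multiset \<Rightarrow> nat \<Rightarrow> complex) \<Rightarrow>
     (nw word \<Rightarrow>\<^sub>0 complex) set" where
  "b_operator m n a b =
     (\<Oplus>\<^bsub>NWU\<^esub>\<mu>\<in>Part n.
        (nwu_scalar (a \<mu>) \<otimes>\<^bsub>NWU\<^esub> cprod \<mu> \<otimes>\<^bsub>NWU\<^esub> nwu_mode Hb m) \<oplus>\<^bsub>NWU\<^esub>
        (\<Oplus>\<^bsub>NWU\<^esub>p\<in>set_mset \<mu>.
           nwu_scalar (b (\<mu> - {#p#}) p) \<otimes>\<^bsub>NWU\<^esub> cprod (\<mu> - {#p#}) \<otimes>\<^bsub>NWU\<^esub> nwu_mode Hb (- int p + m)))"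

definition a_coefficients :: "nat \<Rightarrow> (nat multiset \<Rightarrow> nat \<Rightarrow> complex) \<Rightarrow> bool" where
  "a_coefficients n c \<longleftrightarrow>
     (\<exists>p\<in>{1..n}. \<exists>\<rho>\<in>Part (n - p). c \<rho> p \<noteq> 0) \<and>
     (\<forall>\<mu>\<in>Part n. \<forall>p\<in>set_mset \<mu>.
        (\<forall>q\<in>set_mset \<mu>. p \<noteq> q \<longrightarrow>
           of_nat (count \<mu> p) * of_nat p * c (\<mu> - {#q#}) q + merged c \<mu> p q = 0) \<and>
        c (\<mu> - {#p#}) p * (- of_nat n + of_nat p) - (\<Sum>q\<in>set_mset \<mu>. merged c \<mu> p q) = 0)"

definition a_operator ::
    "int \<Rightarrow> nat \<Rightarrow> (nat multiset \<Rightarrow> nat \<Rightarrow> complex) \<Rightarrow> (nw word \<Rightarrow>\<^sub>0 complex) set" where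
  "a_operator m n c =
     (\<Oplus>\<^bsub>NWU\<^esub>\<mu>\<in>Part n. \<Oplus>\<^bsub>NWU\<^esub>p\<in>set_mset \<mu>.
        nwu_scalar (c (\<mu> - {#p#}) p) \<otimes>\<^bsub>NWU\<^esub> cprod (\<mu> - {#p#}) \<otimes>\<^bsub>NWU\<^esub> nwu_mode Ha (- int p - m))"

end

theory Submission
  imports Defs
begin

text \<open>
  Multiplying \<open>a(z)\<close> and \<open>b(z)\<close> by \<open>exp (\<mp> \<Sum>\<^sub>k c(-k) z\<^sup>k / k)\<close>, the sum being over \<open>k \<ge> 1\<close>, makes them
  commute with the positive modes of \<open>d\<close>. On vectors killed by the positive modes of \<open>c\<close> the
  resulting modes satisfy \<open>[a\<^sub>p, b\<^sub>-\<^sub>q] = \<delta>\<^sub>p\<^sub>q (\<gamma> - m + p)\<close>, so that the module becomes a Fock space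
  whose annihilation operators pair nondegenerately with the creation operators except for the
  one pair with \<open>\<gamma> - m + p = 0\<close>, which exists exactly for integral \<open>\<gamma> = \<alpha>(c)\<close>. An Euler operator
  argument shows that the vectors killed by all annihilation operators are the polynomials in
  the degenerate creation operator applied to the highest weight vector, and that every nonzero
  submodule contains such a vector. That these polynomials are linearly independent, and that
  the degenerate creation operator generates a proper submodule, is seen on an explicit free
  field module. Expanding the exponential over partitions, with coefficients \<open>\<plusminus>1 / z\<^sub>\<rho>\<close>, gives the
  operators of the statement, since the coefficient systems are Newton's recursion for \<open>1 / z\<^sub>\<rho>\<close>.
\<close>

section \<open>Linear algebra\<close>

text \<open>No PBW basis enters. An induced module is handled as the tensor algebra modulo a left
  ideal \<open>L\<close> that is known by its generators only. The relations alone give upper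
  bounds: every vector is built from modes applied to the highest weight vector, possibly in several
  ways, which is why the Fock space argument works with a filtration by degree and not with a
  grading. Lower bounds (\<open>1\<close> is not in \<open>L\<close>, powers are independent, a
  proper submodule exists) need a module in which something is visibly nonzero, hence the free field
  module. There a pair of modes with commutator \<open>0\<close> leaves a choice: its creation
  operator may be a free variable or zero. Both choices satisfy the relations, and the two
  annihilators of the vacuum differ, which exhibits a proper left ideal strictly above
  \<open>L\<close>. To let one theory of operators serve both modules, the quotient by
  \<open>L\<close> is realized by a linear projection of the tensor algebra. Its image is not a type
  of its own, so the operators act on all tensors and an idempotent \<open>K\<close> replaces the
  identity.\<close>

lemma lookup_scaleV [simp]: "Poly_Mapping.lookup (scaleV z v) i = z * Poly_Mapping.lookup v i"
  by (simp add: scaleV_def Poly_Mapping.map.rep_eq when_def)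

lemma scaleV_add_right: "scaleV z (u + v) = scaleV z u + scaleV z v"
  by (rule poly_mapping_eqI) (simp add: lookup_add algebra_simps)

lemma scaleV_add_left: "scaleV (y + z) v = scaleV y v + scaleV z v"
  by (rule poly_mapping_eqI) (simp add: lookup_add algebra_simps)

lemma scaleV_diff_left: "scaleV (y - z) v = scaleV y v - scaleV z v"
  by (rule poly_mapping_eqI) (simp add: lookup_minus algebra_simps)

lemma scaleV_diff_right: "scaleV z (u - v) = scaleV z u - scaleV z v"
  by (rule poly_mapping_eqI) (simp add: lookup_minus algebra_simps)

lemma scaleV_scaleV [simp]: "scaleV y (scaleV z v) = scaleV (y * z) v"
  by (rule poly_mapping_eqI) simp

lemma scaleV_one [simp]: "scaleV 1 v = v"
  by (rule poly_mapping_eqI) simp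

lemma scaleV_zero [simp]: "scaleV 0 v = 0"
  by (rule poly_mapping_eqI) simp

lemma scaleV_zero_right [simp]: "scaleV z 0 = 0"
  by (rule poly_mapping_eqI) simp

lemma scaleV_minus_left: "scaleV (- z) v = - scaleV z v"
  by (rule poly_mapping_eqI) simp

lemma scaleV_sum_right: "scaleV z (sum f A) = (\<Sum>i\<in>A. scaleV z (f i))"
  by (rule poly_mapping_eqI) (simp add: lookup_sum sum_distrib_left)

lemma scaleV_sum_left: "scaleV (sum f A) v = (\<Sum>i\<in>A. scaleV (f i) v)"
  by (rule poly_mapping_eqI) (simp add: lookup_sum sum_distrib_right)

lemma scaleV_eq_0_iff: "scaleV z v = 0 \<longleftrightarrow> z = 0 \<or> v = 0"
  by (auto simp: poly_mapping_eq_iff fun_eq_iff)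

lemma scaleV_single [simp]: "scaleV z (Poly_Mapping.single i y) = Poly_Mapping.single i (z * y)"
  by (rule poly_mapping_eqI) (simp add: lookup_single when_def)

lemma poly_mapping_expansion:
  "v = (\<Sum>i\<in>Poly_Mapping.keys v. scaleV (Poly_Mapping.lookup v i) (Poly_Mapping.single i 1))"
  by (rule poly_mapping_eqI) (auto simp: lookup_sum lookup_single when_def in_keys_iff sum.If_cases)

definition linear_op :: "(('i \<Rightarrow>\<^sub>0 complex) \<Rightarrow> ('j \<Rightarrow>\<^sub>0 complex)) \<Rightarrow> bool" where
  "linear_op f \<longleftrightarrow> (\<forall>u v. f (u + v) = f u + f v) \<and> (\<forall>z v. f (scaleV z v) = scaleV z (f v))"

lemma linear_opI:
  "(\<And>u v. f (u + v) = f u + f v) \<Longrightarrow> (\<And>z v. f (scaleV z v) = scaleV z (f v)) \<Longrightarrow> linear_op f"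
  by (simp add: linear_op_def)

lemma lin_add: "linear_op f \<Longrightarrow> f (u + v) = f u + f v"
  by (simp add: linear_op_def)

lemma lin_scale: "linear_op f \<Longrightarrow> f (scaleV z v) = scaleV z (f v)"
  by (simp add: linear_op_def)

lemma lin_zero: "linear_op f \<Longrightarrow> f 0 = 0"
  using lin_scale[of f 0 0] by simp

lemma lin_minus: "linear_op f \<Longrightarrow> f (- v) = - f v"
  using lin_scale[of f "-1" v] by (simp add: scaleV_minus_left)

lemma lin_diff: "linear_op f \<Longrightarrow> f (u - v) = f u - f v"
  using lin_add[of f u "- v"] by (simp add: lin_minus)

lemma lin_sum: "linear_op f \<Longrightarrow> f (sum h A) = (\<Sum>i\<in>A. f (h i))"
  by (induction A rule: infinite_finite_induct) (simp_all add: lin_zero lin_add)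

lemma linear_op_compose: "linear_op f \<Longrightarrow> linear_op h \<Longrightarrow> linear_op (\<lambda>v. f (h v))"
  by (simp add: linear_op_def)

lemma linear_op_scale: "linear_op f \<Longrightarrow> linear_op (\<lambda>v. scaleV z (f v))"
  by (auto simp: linear_op_def scaleV_add_right mult.commute)

lemma linear_op_plus: "linear_op f \<Longrightarrow> linear_op h \<Longrightarrow> linear_op (\<lambda>v. f v + h v)"
  by (auto simp: linear_op_def scaleV_add_right)

lemma linear_op_minus: "linear_op f \<Longrightarrow> linear_op h \<Longrightarrow> linear_op (\<lambda>v. f v - h v)"
  by (auto simp: linear_op_def scaleV_diff_right)

lemma linear_op_sum: "(\<And>i. i \<in> A \<Longrightarrow> linear_op (f i)) \<Longrightarrow> linear_op (\<lambda>v. \<Sum>i\<in>A. f i v)"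
  by (auto simp: linear_op_def scaleV_sum_right sum.distrib)

lemma linear_op_zero: "linear_op (\<lambda>v. 0)"
  by (auto simp: linear_op_def)

lemma linear_op_ident: "linear_op (\<lambda>v. v)"
  by (auto simp: linear_op_def)

definition subspaceV :: "('i \<Rightarrow>\<^sub>0 complex) set \<Rightarrow> bool" where
  "subspaceV S \<longleftrightarrow> 0 \<in> S \<and> (\<forall>u\<in>S. \<forall>v\<in>S. u + v \<in> S) \<and> (\<forall>z. \<forall>v\<in>S. scaleV z v \<in> S)"

lemma subspaceV_zero: "subspaceV S \<Longrightarrow> 0 \<in> S"
  and subspaceV_add: "subspaceV S \<Longrightarrow> u \<in> S \<Longrightarrow> v \<in> S \<Longrightarrow> u + v \<in> S"
  and subspaceV_scale: "subspaceV S \<Longrightarrow> v \<in> S \<Longrightarrow> scaleV z v \<in> S"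
  by (auto simp: subspaceV_def)

lemma subspaceV_minus: "subspaceV S \<Longrightarrow> v \<in> S \<Longrightarrow> - v \<in> S"
  using subspaceV_scale[of S v "-1"] by (simp add: scaleV_minus_left)

lemma subspaceV_diff: "subspaceV S \<Longrightarrow> u \<in> S \<Longrightarrow> v \<in> S \<Longrightarrow> u - v \<in> S"
  using subspaceV_add[of S u "- v"] by (simp add: subspaceV_minus)

lemma subspaceV_sum: "subspaceV S \<Longrightarrow> (\<And>i. i \<in> A \<Longrightarrow> f i \<in> S) \<Longrightarrow> sum f A \<in> S"
  by (induction A rule: infinite_finite_induct) (auto simp: subspaceV_zero subspaceV_add)

section \<open>Exponentials of commuting families\<close>

text \<open>The coefficients of \<open>exp (\<tau> \<Sum>\<^sub>k g\<^sub>k z\<^sup>k / k)\<close>, computed by Newton's recursion;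
  \<open>K\<close> plays the role of the identity.\<close>

fun newton :: "(nat \<Rightarrow> ('i \<Rightarrow>\<^sub>0 complex) \<Rightarrow> ('i \<Rightarrow>\<^sub>0 complex)) \<Rightarrow>
    (('i \<Rightarrow>\<^sub>0 complex) \<Rightarrow> ('i \<Rightarrow>\<^sub>0 complex)) \<Rightarrow> complex \<Rightarrow> nat \<Rightarrow> ('i \<Rightarrow>\<^sub>0 complex) \<Rightarrow> ('i \<Rightarrow>\<^sub>0 complex)" where
  "newton g K \<tau> 0 v = K v"
| "newton g K \<tau> (Suc r) v =
     scaleV (\<tau> / of_nat (Suc r)) (\<Sum>k<Suc r. g (Suc k) (newton g K \<tau> (r - k) v))"

declare newton.simps(2) [simp del]

text \<open>The substitution \<open>i = Suc k + j\<close>; this is the double sum that arises when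
  Newton's recursion is applied to the first factor of a product of two series.\<close>

lemma sum_triangle_shift:
  "(\<Sum>i\<le>N. \<Sum>k<i. F (Suc k) (i - Suc k) (N - i)) =
   (\<Sum>k<N. \<Sum>j\<le>N - Suc k. F (Suc k) j (N - Suc k - j))"
  for F :: "nat \<Rightarrow> nat \<Rightarrow> nat \<Rightarrow> 'a::comm_monoid_add"
proof -
  have "(\<Sum>i\<le>N. \<Sum>k<i. F (Suc k) (i - Suc k) (N - i)) =
        (\<Sum>(i, k)\<in>(SIGMA i:{..N}. {..<i}). F (Suc k) (i - Suc k) (N - i))"
    by (rule sum.Sigma) auto
  also have "\<dots> = (\<Sum>(k, j)\<in>(SIGMA k:{..<N}. {..N - Suc k}). F (Suc k) j (N - Suc k - j))"
    by (rule sum.reindex_bij_witness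
        [where i = "\<lambda>(k, j). (Suc k + j, k)" and j = "\<lambda>(i, k). (k, i - Suc k)"])
       (auto simp: diff_diff_add)
  also have "\<dots> = (\<Sum>k<N. \<Sum>j\<le>N - Suc k. F (Suc k) j (N - Suc k - j))"
    by (rule sum.Sigma[symmetric]) auto
  finally show ?thesis .
qed

text \<open>In the induced modules the operators act on a whole tensor algebra and factor through
  the projection \<open>K\<close> onto a complement of a left ideal; \<open>K\<close> is the
  identity only on their images.\<close>

locale commuting_family =
  fixes g :: "nat \<Rightarrow> ('i \<Rightarrow>\<^sub>0 complex) \<Rightarrow> ('i \<Rightarrow>\<^sub>0 complex)"
    and K :: "('i \<Rightarrow>\<^sub>0 complex) \<Rightarrow> ('i \<Rightarrow>\<^sub>0 complex)"
  assumes g_lin: "linear_op (g k)" and K_lin: "linear_op K"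
    and g_comm: "g k (g l v) = g l (g k v)"
    and K_g: "K (g k v) = g k v" and g_K: "g k (K v) = g k v" and K_K: "K (K v) = K v"
begin

abbreviation "e \<equiv> newton g K"

lemma newton_lin: "linear_op (e \<tau> r)"
proof (induction r rule: less_induct)
  case (less r)
  show ?case
  proof (cases r)
    case 0
    then show ?thesis using K_lin by (simp add: linear_op_def)
  next
    case (Suc s)
    have "linear_op (\<lambda>v. scaleV (\<tau> / of_nat (Suc s)) (\<Sum>k<Suc s. g (Suc k) (e \<tau> (s - k) v)))"
      by (intro linear_op_scale linear_op_sum linear_op_compose[OF g_lin] less) (simp add: Suc)
    then show ?thesis by (simp add: Suc newton.simps(2)[abs_def] cong: sum.cong)
  qed
qed

lemma newton_commute:
  assumes Y: "linear_op Y" and Yg: "\<And>k v. Y (g (Suc k) v) = g (Suc k) (Y v)" and YK: "\<And>v. Y (K v) = K (Y v)"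
  shows "Y (e \<tau> r v) = e \<tau> r (Y v)"
proof (induction r arbitrary: v rule: less_induct)
  case (less r)
  show ?case
  proof (cases r)
    case 0
    then show ?thesis by (simp add: YK)
  next
    case (Suc s)
    then show ?thesis
      by (simp add: newton.simps(2) lin_scale[OF Y] lin_sum[OF Y] Yg less del: sum.lessThan_Suc)
  qed
qed

lemma newton_g: "g k (e \<tau> r v) = e \<tau> r (g k v)"
  by (rule newton_commute[OF g_lin]) (simp_all add: g_comm K_g g_K)

lemma newton_K: "e \<tau> r (K v) = e \<tau> r v" "K (e \<tau> r v) = e \<tau> r v"
proof -
  show *: "K (e \<tau> r v) = e \<tau> r v"
    by (cases r) (simp_all add: K_K newton.simps(2) lin_scale[OF K_lin] lin_sum[OF K_lin] K_g
        del: sum.lessThan_Suc)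
  have "K (e \<tau> r v) = e \<tau> r (K v)"
    by (rule newton_commute[OF K_lin]) (simp_all add: K_g g_K)
  then show "e \<tau> r (K v) = e \<tau> r v" by (simp add: *)
qed

lemma newton_newton: "e \<tau> r (e \<sigma> s v) = e \<sigma> s (e \<tau> r v)"
  by (rule newton_commute[OF newton_lin]) (simp_all add: newton_g newton_K)

lemma newton_rec:
  "scaleV (of_nat r) (e \<tau> r v) = scaleV \<tau> (\<Sum>k<r. g (Suc k) (e \<tau> (r - Suc k) v))"
proof (cases r)
  case (Suc s)
  have "of_nat (Suc s) \<noteq> (0::complex)" by (rule of_nat_neq_0)
  then show ?thesis by (simp add: Suc newton.simps(2) del: sum.lessThan_Suc of_nat_Suc)
qed simp

text \<open>Coefficient of \<open>z\<^sup>N\<close> in \<open>z E' F\<close> for the exponentials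
  \<open>E\<close>, \<open>F\<close> with parameters \<open>\<tau>\<close>, \<open>\<sigma>\<close>,
  using \<open>z E' = \<tau> (\<Sum>\<^sub>k g\<^sub>k z\<^sup>k) E\<close>.\<close>

lemma newton_weighted_conv:
  "(\<Sum>i\<le>N. scaleV (of_nat i) (e \<tau> i (e \<sigma> (N - i) v))) =
   scaleV \<tau> (\<Sum>k<N. g (Suc k) (\<Sum>j\<le>N - Suc k. e \<tau> j (e \<sigma> (N - Suc k - j) v)))"
proof -
  have "(\<Sum>i\<le>N. scaleV (of_nat i) (e \<tau> i (e \<sigma> (N - i) v))) =
        scaleV \<tau> (\<Sum>i\<le>N. \<Sum>k<i. g (Suc k) (e \<tau> (i - Suc k) (e \<sigma> (N - i) v)))"
    by (simp add: newton_rec scaleV_sum_right)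
  also have "\<dots> = scaleV \<tau> (\<Sum>k<N. \<Sum>j\<le>N - Suc k. g (Suc k) (e \<tau> j (e \<sigma> (N - Suc k - j) v)))"
    by (subst sum_triangle_shift[of "\<lambda>k i j. g k (e \<tau> i (e \<sigma> j v))"]) simp
  finally show ?thesis by (simp add: lin_sum[OF g_lin])
qed

text \<open>Exponentials with opposite parameters are inverse to each other: \<open>z d/dz\<close>
  of their product vanishes, so only the constant term \<open>K\<close> survives.\<close>

lemma newton_conv:
  "(\<Sum>i\<le>N. e \<tau> i (e (- \<tau>) (N - i) v)) = (if N = 0 then K v else 0)"
proof (cases "N = 0")
  case False
  define h where "h = (\<lambda>N. \<Sum>i\<le>N. e \<tau> i (e (- \<tau>) (N - i) v))"
  have h1: "(\<Sum>j\<le>M. e \<tau> j (e (- \<tau>) (M - j) v)) = h M" for M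
    by (simp add: h_def)
  have h2: "(\<Sum>j\<le>M. e (- \<tau>) j (e \<tau> (M - j) v)) = h M" for M
    unfolding h_def
    by (rule sum.reindex_bij_witness[where i = "\<lambda>i. M - i" and j = "\<lambda>i. M - i"])
       (auto simp: newton_newton)
  \<comment> \<open>Splitting \<open>N = i + (N - i)\<close> is the Leibniz rule. The two halves are
    weighted convolutions with factors \<open>\<tau>\<close> and \<open>- \<tau>\<close>, so they
    cancel.\<close>
  have "scaleV (of_nat N) (h N) =
      (\<Sum>i\<le>N. scaleV (of_nat i) (e \<tau> i (e (- \<tau>) (N - i) v)) +
         scaleV (of_nat (N - i)) (e \<tau> i (e (- \<tau>) (N - i) v)))"
    by (simp add: h_def scaleV_sum_right flip: scaleV_add_left of_nat_add)
  also have "\<dots> = (\<Sum>i\<le>N. scaleV (of_nat i) (e \<tau> i (e (- \<tau>) (N - i) v))) +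
      (\<Sum>i\<le>N. scaleV (of_nat (N - i)) (e \<tau> i (e (- \<tau>) (N - i) v)))"
    by (rule sum.distrib)
  also have "(\<Sum>i\<le>N. scaleV (of_nat (N - i)) (e \<tau> i (e (- \<tau>) (N - i) v))) =
      (\<Sum>i\<le>N. scaleV (of_nat i) (e (- \<tau>) i (e \<tau> (N - i) v)))"
    by (rule sum.reindex_bij_witness[where i = "\<lambda>i. N - i" and j = "\<lambda>i. N - i"])
       (auto simp: newton_newton)
  finally have "scaleV (of_nat N) (h N) = 0"
    by (simp add: newton_weighted_conv h1 h2 scaleV_minus_left del: diff_diff_left)
  then show ?thesis using False by (simp add: scaleV_eq_0_iff h_def)
qed (simp add: K_K)

text \<open>The logarithmic derivative of the exponential. It is the source of the modes of
  \<open>c\<close> that appear when dressed fields are commuted.\<close>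

lemma newton_conv_deriv:
  "(\<Sum>i\<le>N. scaleV (of_nat i) (e \<tau> i (e (- \<tau>) (N - i) v))) =
     (if N = 0 then 0 else scaleV \<tau> (g N v))"
proof (cases N)
  case (Suc M)
  have "(\<Sum>k<N. g (Suc k) (if N - Suc k = 0 then K v else 0)) = (\<Sum>k\<in>{M}. g (Suc k) (K v))"
    unfolding Suc by (rule sum.mono_neutral_cong_right) (auto simp: lin_zero[OF g_lin])
  then show ?thesis by (simp add: newton_weighted_conv newton_conv Suc g_K del: diff_diff_left sum.lessThan_Suc)
qed simp

text \<open>The factor \<open>n\<close> in \<open>[D, g\<^sub>n] = n \<eta>\<close> cancels the
  \<open>1 / n\<close> in the exponent, so bracketing with \<open>D\<close> multiplies the
  exponential by \<open>\<tau> \<eta> z\<^sup>n\<close>.\<close>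

lemma newton_derivation:
  assumes D: "linear_op D" and DK: "\<And>v. D (K v) = D v" "\<And>v. K (D v) = D v"
    and Dg: "\<And>k v. D (g (Suc k) v) =
      g (Suc k) (D v) + (if Suc k = n then scaleV (of_nat n * \<eta>) (K v) else 0)"
    and n: "n \<ge> 1"
  shows "D (e \<tau> r v) = e \<tau> r (D v) + (if n \<le> r then scaleV (\<tau> * \<eta>) (e \<tau> (r - n) v) else 0)"
proof (induction r arbitrary: v rule: less_induct)
  case (less r)
  show ?case
  proof (cases "r = 0")
    case True
    then show ?thesis using n by (simp add: DK)
  next
    case False
    let ?E = "\<lambda>r v. if n \<le> r then scaleV (\<tau> * \<eta>) (e \<tau> (r - n) v) else 0"
    have "scaleV (of_nat r) (D (e \<tau> r v)) =
        scaleV \<tau> (\<Sum>k<r. D (g (Suc k) (e \<tau> (r - Suc k) v)))"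
      by (simp only: newton_rec lin_sum[OF D] lin_scale[OF D] lin_scale[OF D, symmetric, of _ "e \<tau> r v"])
    also have "(\<Sum>k<r. D (g (Suc k) (e \<tau> (r - Suc k) v))) =
        (\<Sum>k<r. g (Suc k) (e \<tau> (r - Suc k) (D v))) +
        (\<Sum>k<r. g (Suc k) (?E (r - Suc k) v)) +
        (\<Sum>k<r. if Suc k = n then scaleV (of_nat n * \<eta>) (e \<tau> (r - Suc k) v) else 0)"
      by (simp add: Dg newton_K less lin_add[OF g_lin] cong: if_cong flip: sum.distrib)
    also have "(\<Sum>k<r. if Suc k = n then scaleV (of_nat n * \<eta>) (e \<tau> (r - Suc k) v) else 0) =
        (if n \<le> r then scaleV (of_nat n * \<eta>) (e \<tau> (r - n) v) else 0)"
    proof (cases "n \<le> r")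
      case True
      have "(\<Sum>k<r. if Suc k = n then scaleV (of_nat n * \<eta>) (e \<tau> (r - Suc k) v) else 0) =
         (\<Sum>k\<in>{n - 1}. scaleV (of_nat n * \<eta>) (e \<tau> (r - Suc k) v))"
        by (rule sum.mono_neutral_cong_right) (use True n in auto)
      then show ?thesis using True n by simp
    qed (auto intro!: sum.neutral)
    \<comment> \<open>The induction hypothesis supplies the weight \<open>r - n\<close>, the
      commutator the weight \<open>n\<close>; their sum \<open>r\<close> is divided out at the
      end.\<close>
    also have "(\<Sum>k<r. g (Suc k) (?E (r - Suc k) v)) =
        (if n \<le> r then scaleV (\<eta> * of_nat (r - n)) (e \<tau> (r - n) v) else 0)"
    proof (cases "n \<le> r")
      case True
      have "(\<Sum>k<r. g (Suc k) (?E (r - Suc k) v)) =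
          (\<Sum>k<r - n. g (Suc k) (scaleV (\<tau> * \<eta>) (e \<tau> (r - n - Suc k) v)))"
        by (rule sum.mono_neutral_cong_right)
           (auto simp: lin_zero[OF g_lin] diff_diff_add add.commute)
      also have "\<dots> = scaleV \<eta> (scaleV \<tau> (\<Sum>k<r - n. g (Suc k) (e \<tau> (r - n - Suc k) v)))"
        by (simp add: lin_scale[OF g_lin] scaleV_sum_right mult.commute)
      also have "\<dots> = scaleV (\<eta> * of_nat (r - n)) (e \<tau> (r - n) v)"
        by (simp only: newton_rec[symmetric] scaleV_scaleV)
      finally show ?thesis using True by simp
    qed (auto intro!: sum.neutral simp: lin_zero[OF g_lin])
    finally have *: "scaleV (of_nat r) (D (e \<tau> r v)) =
        scaleV (of_nat r) (e \<tau> r (D v)) +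
        (if n \<le> r then scaleV (\<tau> * \<eta> * of_nat r) (e \<tau> (r - n) v) else 0)"
      by (auto simp: newton_rec scaleV_add_right algebra_simps of_nat_diff
          simp flip: scaleV_add_left)
    have "scaleV (of_nat r) (D (e \<tau> r v)) =
        scaleV (of_nat r) (e \<tau> r (D v) + ?E r v)"
      unfolding * by (simp add: scaleV_add_right mult_ac)
    then have "scaleV (of_nat r) (D (e \<tau> r v) - (e \<tau> r (D v) + ?E r v)) = 0"
      by (simp add: scaleV_diff_right)
    then show ?thesis using False unfolding scaleV_eq_0_iff by simp
  qed
qed

end

section \<open>Dressing\<close>

text \<open>\<open>dress f \<epsilon> A\<close> is the mode expansion of the product of \<open>\<Sum>\<^sub>r f\<^sub>r z\<^sup>\<epsilon>\<^sup>r\<close> and \<open>\<Sum>\<^sub>p A\<^sub>p z\<^sup>-\<^sup>p\<close>;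
  it is junk unless the sum over \<open>r\<close> is finite at \<open>v\<close>.\<close>

definition dress :: "(nat \<Rightarrow> ('i \<Rightarrow>\<^sub>0 complex) \<Rightarrow> ('i \<Rightarrow>\<^sub>0 complex)) \<Rightarrow> int \<Rightarrow>
    (int \<Rightarrow> ('i \<Rightarrow>\<^sub>0 complex) \<Rightarrow> ('i \<Rightarrow>\<^sub>0 complex)) \<Rightarrow> int \<Rightarrow> ('i \<Rightarrow>\<^sub>0 complex) \<Rightarrow> ('i \<Rightarrow>\<^sub>0 complex)" where
  "dress f \<epsilon> A p v = Sum_any (\<lambda>r. f r (A (p + \<epsilon> * int r) v))"

definition dressable :: "(nat \<Rightarrow> ('i \<Rightarrow>\<^sub>0 complex) \<Rightarrow> ('i \<Rightarrow>\<^sub>0 complex)) \<Rightarrow> int \<Rightarrow>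
    (int \<Rightarrow> ('i \<Rightarrow>\<^sub>0 complex) \<Rightarrow> ('i \<Rightarrow>\<^sub>0 complex)) \<Rightarrow> bool" where
  "dressable f \<epsilon> A \<longleftrightarrow> (\<forall>p v. \<exists>N. \<forall>r\<ge>N. f r (A (p + \<epsilon> * int r) v) = 0)"

lemma dress_eq_sum:
  assumes "\<And>r. r \<ge> N \<Longrightarrow> f r (A (p + \<epsilon> * int r) v) = 0"
  shows "dress f \<epsilon> A p v = (\<Sum>r<N. f r (A (p + \<epsilon> * int r) v))"
  unfolding dress_def by (rule Sum_any.expand_superset) (use assms linorder_not_less in auto)

lemma dressableD:
  assumes "dressable f \<epsilon> A"
  shows "\<exists>N. (\<forall>r\<ge>N. f r (A (p + \<epsilon> * int r) v) = 0) \<and>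
    (\<forall>M\<ge>N. dress f \<epsilon> A p v = (\<Sum>r<M. f r (A (p + \<epsilon> * int r) v)))"
proof -
  obtain N where N: "\<And>r. r \<ge> N \<Longrightarrow> f r (A (p + \<epsilon> * int r) v) = 0"
    using assms unfolding dressable_def by blast
  have "dress f \<epsilon> A p v = (\<Sum>r<M. f r (A (p + \<epsilon> * int r) v))" if "M \<ge> N" for M
    by (rule dress_eq_sum) (use N that le_trans in blast)
  then show ?thesis using N by blast
qed

lemma dress_lin:
  assumes f: "\<And>r. linear_op (f r)" and A: "\<And>p. linear_op (A p)" and fin: "dressable f \<epsilon> A"
  shows "linear_op (dress f \<epsilon> A p)"
proof (rule linear_opI)
  fix u v
  obtain N1 where N1: "\<And>M. M \<ge> N1 \<Longrightarrow> dress f \<epsilon> A p u = (\<Sum>r<M. f r (A (p + \<epsilon> * int r) u))"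
    using dressableD[OF fin] by blast
  obtain N2 where N2: "\<And>M. M \<ge> N2 \<Longrightarrow> dress f \<epsilon> A p v = (\<Sum>r<M. f r (A (p + \<epsilon> * int r) v))"
    using dressableD[OF fin] by blast
  obtain N3 where N3: "\<And>M. M \<ge> N3 \<Longrightarrow> dress f \<epsilon> A p (u + v) = (\<Sum>r<M. f r (A (p + \<epsilon> * int r) (u + v)))"
    using dressableD[OF fin] by blast
  show "dress f \<epsilon> A p (u + v) = dress f \<epsilon> A p u + dress f \<epsilon> A p v"
    using N1[of "max N1 (max N2 N3)"] N2[of "max N1 (max N2 N3)"] N3[of "max N1 (max N2 N3)"]
    by (simp add: lin_add[OF A] lin_add[OF f] sum.distrib)
next
  fix z v
  obtain N2 where N2: "\<And>M. M \<ge> N2 \<Longrightarrow> dress f \<epsilon> A p v = (\<Sum>r<M. f r (A (p + \<epsilon> * int r) v))"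
    using dressableD[OF fin] by blast
  obtain N3 where N3: "\<And>M. M \<ge> N3 \<Longrightarrow> dress f \<epsilon> A p (scaleV z v) = (\<Sum>r<M. f r (A (p + \<epsilon> * int r) (scaleV z v)))"
    using dressableD[OF fin] by blast
  show "dress f \<epsilon> A p (scaleV z v) = scaleV z (dress f \<epsilon> A p v)"
    using N2[of "max N2 N3"] N3[of "max N2 N3"]
    by (simp add: lin_scale[OF A] lin_scale[OF f] scaleV_sum_right)
qed

lemma dress_commute:
  assumes Y: "linear_op Y" and Yf: "\<And>r v. Y (f r v) = f r (Y v)" and YA: "\<And>p v. Y (A p v) = A p (Y v)"
    and fin: "dressable f \<epsilon> A"
  shows "Y (dress f \<epsilon> A p v) = dress f \<epsilon> A p (Y v)"
proof -
  obtain N2 where N2: "\<And>M. M \<ge> N2 \<Longrightarrow> dress f \<epsilon> A p v = (\<Sum>r<M. f r (A (p + \<epsilon> * int r) v))"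
    using dressableD[OF fin] by blast
  obtain N3 where N3: "\<And>M. M \<ge> N3 \<Longrightarrow> dress f \<epsilon> A p (Y v) = (\<Sum>r<M. f r (A (p + \<epsilon> * int r) (Y v)))"
    using dressableD[OF fin] by blast
  show ?thesis using N2[of "max N2 N3"] N3[of "max N2 N3"] by (simp add: lin_sum[OF Y] Yf YA)
qed

text \<open>The cutoff of the outer sum depends on the inner index \<open>s\<close>, but only
  finitely many \<open>s\<close> contribute, so there is a common one. A finite square of terms with
  zeros outside is what permits rearrangement.\<close>

lemma dress_dress:
  assumes f: "\<And>r. linear_op (f r)" and h: "\<And>r. linear_op (h r)"
    and A: "\<And>p. linear_op (A p)" and B: "\<And>p. linear_op (B p)"
    and finA: "dressable f \<epsilon> A" and finB: "dressable h \<epsilon> B"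
    and Ah: "\<And>p s v. A p (h s v) = h s (A p v)"
  shows "\<exists>N. \<forall>M\<ge>N.
    dress f \<epsilon> A p (dress h \<epsilon> B q v) = (\<Sum>r<M. \<Sum>s<M. f r (h s (A (p + \<epsilon> * int r) (B (q + \<epsilon> * int s) v)))) \<and>
    (\<forall>r s. r \<ge> M \<or> s \<ge> M \<longrightarrow> f r (h s (A (p + \<epsilon> * int r) (B (q + \<epsilon> * int s) v))) = 0)"
proof -
  let ?w = "\<lambda>s. h s (B (q + \<epsilon> * int s) v)"
  obtain S where S: "\<And>s. s \<ge> S \<Longrightarrow> ?w s = 0"
    "\<And>M. M \<ge> S \<Longrightarrow> dress h \<epsilon> B q v = (\<Sum>s<M. ?w s)"
    using dressableD[OF finB] by blast
  have "\<forall>s. \<exists>N. \<forall>r\<ge>N. f r (A (p + \<epsilon> * int r) (?w s)) = 0"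
    using finA unfolding dressable_def by blast
  then obtain R where R: "\<And>s r. r \<ge> R s \<Longrightarrow> f r (A (p + \<epsilon> * int r) (?w s)) = 0"
    by metis
  define N where "N = max S (Max (insert 0 (R ` {..<S})))"
  have N: "N \<ge> S" "\<And>s. s < S \<Longrightarrow> N \<ge> R s"
    unfolding N_def by (auto intro!: max.coboundedI2 Max_ge)
  have z: "f r (A (p + \<epsilon> * int r) (?w s)) = 0" if "r \<ge> N \<or> s \<ge> N" for r s
  proof (cases "s < S")
    case True
    then have "r \<ge> R s" using that N by (metis le_trans linorder_not_less)
    then show ?thesis by (rule R)
  next
    case False
    then show ?thesis by (simp add: S lin_zero[OF A] lin_zero[OF f])
  qed
  have "dress f \<epsilon> A p (dress h \<epsilon> B q v) = (\<Sum>r<M. \<Sum>s<M. f r (A (p + \<epsilon> * int r) (?w s)))" if M: "M \<ge> N" for M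
  proof -
    have d: "dress h \<epsilon> B q v = (\<Sum>s<M. ?w s)" by (rule S(2)) (use M N(1) in linarith)
    have "dress f \<epsilon> A p (\<Sum>s<M. ?w s) = (\<Sum>r<M. f r (A (p + \<epsilon> * int r) (\<Sum>s<M. ?w s)))"
      by (rule dress_eq_sum) (use z M in \<open>simp add: lin_sum[OF A] lin_sum[OF f]\<close>)
    then show ?thesis unfolding d by (simp add: lin_sum[OF A] lin_sum[OF f])
  qed
  moreover have "f r (A (p + \<epsilon> * int r) (?w s)) = 0" if "M \<ge> N" "r \<ge> M \<or> s \<ge> M" for M r s
    using that by (intro z) auto
  ultimately show ?thesis unfolding Ah by (intro exI[of _ N]) simp
qed

lemma dress_dress_commute:
  assumes f: "\<And>r. linear_op (f r)" and h: "\<And>r. linear_op (h r)"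
    and A: "\<And>p. linear_op (A p)" and B: "\<And>p. linear_op (B p)"
    and finA: "dressable f \<epsilon> A" and finB: "dressable h \<epsilon> B"
    and Ah: "\<And>p s v. A p (h s v) = h s (A p v)" and Bf: "\<And>p s v. B p (f s v) = f s (B p v)"
    and fh: "\<And>r s v. f r (h s v) = h s (f r v)"
    and AB: "\<And>p q v. A p (B q v) = B q (A p v)"
  shows "dress f \<epsilon> A p (dress h \<epsilon> B q v) = dress h \<epsilon> B q (dress f \<epsilon> A p v)"
proof -
  obtain N1 where N1: "\<And>M. M \<ge> N1 \<Longrightarrow> dress f \<epsilon> A p (dress h \<epsilon> B q v) =
      (\<Sum>r<M. \<Sum>s<M. f r (h s (A (p + \<epsilon> * int r) (B (q + \<epsilon> * int s) v))))"
    using dress_dress[OF f h A B finA finB Ah] by blast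
  obtain N2 where N2: "\<And>M. M \<ge> N2 \<Longrightarrow> dress h \<epsilon> B q (dress f \<epsilon> A p v) =
      (\<Sum>s<M. \<Sum>r<M. h s (f r (B (q + \<epsilon> * int s) (A (p + \<epsilon> * int r) v))))"
    using dress_dress[OF h f B A finB finA Bf] by blast
  show ?thesis
    unfolding N1[OF max.cobounded1[of N1 N2]] N2[OF max.cobounded2[of N2 N1]] AB fh
    by (rule sum.swap)
qed

lemma sum_square_antidiagonal:
  fixes F :: "nat \<Rightarrow> nat \<Rightarrow> 'a::comm_monoid_add"
  assumes "\<And>r s. r \<ge> N \<or> s \<ge> N \<Longrightarrow> F r s = 0"
  shows "(\<Sum>r<N. \<Sum>s<N. F r s) = (\<Sum>k<2 * N. \<Sum>r\<le>k. F r (k - r))"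
proof -
  have "(\<Sum>r<N. \<Sum>s<N. F r s) = (\<Sum>(r, s)\<in>{..<N} \<times> {..<N}. F r s)"
    by (rule sum.cartesian_product)
  also have "\<dots> = (\<Sum>(k, r)\<in>{(k, r). r \<le> k \<and> r < N \<and> k - r < N}. F r (k - r))"
    by (rule sum.reindex_bij_witness[where j = "\<lambda>(r, s). (r + s, r)" and i = "\<lambda>(k, r). (r, k - r)"]) auto
  also have "\<dots> = (\<Sum>(k, r)\<in>(SIGMA k:{..<2 * N}. {..k}). F r (k - r))"
  proof (rule sum.mono_neutral_left)
    show "\<forall>x\<in>(SIGMA k:{..<2 * N}. {..k}) - {(k, r). r \<le> k \<and> r < N \<and> k - r < N}.
        (case x of (k, r) \<Rightarrow> F r (k - r)) = 0"
    proof
      fix x assume x: "x \<in> (SIGMA k:{..<2 * N}. {..k}) - {(k, r). r \<le> k \<and> r < N \<and> k - r < N}"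
      obtain k r where [simp]: "x = (k, r)" by force
      from x have "r \<ge> N \<or> k - r \<ge> N" by auto
      then show "(case x of (k, r) \<Rightarrow> F r (k - r)) = 0" by (simp add: assms)
    qed
  qed auto
  also have "\<dots> = (\<Sum>k<2 * N. \<Sum>r\<le>k. F r (k - r))"
    by (rule sum.Sigma[symmetric]) auto
  finally show ?thesis .
qed

context commuting_family
begin

text \<open>Opposite exponentials cancel along antidiagonals, so of \<open>Z\<close> only the
  undisplaced mode remains. The central term carries the displaced index
  \<open>p + \<epsilon> r\<close>; its part weighted by \<open>r\<close> sums to the logarithmic
  derivative and leaves \<open>\<epsilon> \<tau> g\<close>. Depending on the sign this removes or
  creates half of the modes of \<open>c\<close>.\<close>

lemma dress_commutator:
  fixes Z :: "int \<Rightarrow> ('i \<Rightarrow>\<^sub>0 complex) \<Rightarrow> ('i \<Rightarrow>\<^sub>0 complex)"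
  assumes A: "\<And>p. linear_op (A p)" and B: "\<And>p. linear_op (B p)"
    and gA: "\<And>k p v. g k (A p v) = A p (g k v)" and gB: "\<And>k p v. g k (B p v) = B p (g k v)"
    and KA: "\<And>p v. K (A p v) = A p v" "\<And>p v. A p (K v) = A p v"
    and KB: "\<And>p v. K (B p v) = B p v" "\<And>p v. B p (K v) = B p v"
    and KZ: "\<And>p v. K (Z p v) = Z p v"
    and finA: "dressable (e \<tau>) \<epsilon> A" and finB: "dressable (e (- \<tau>)) \<epsilon> B"
    and AB: "\<And>p q v. A p (B q v) = B q (A p v) + Z (p + q) v +
      (if p + q = 0 then scaleV (of_int p) (K v) else 0)"
    and \<epsilon>: "\<epsilon> = 1 \<or> \<epsilon> = - 1"
  shows "dress (e \<tau>) \<epsilon> A p (dress (e (- \<tau>)) \<epsilon> B q v) =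
    dress (e (- \<tau>)) \<epsilon> B q (dress (e \<tau>) \<epsilon> A p v) + Z (p + q) v +
    (if p + q = 0 then scaleV (of_int p) (K v) else 0) +
    (if \<epsilon> * (p + q) < 0 then scaleV (of_int \<epsilon> * \<tau>) (g (nat (- \<epsilon> * (p + q))) v) else 0)"
proof -
  have Ae: "A p (e \<sigma> s v) = e \<sigma> s (A p v)" and Be: "B p (e \<sigma> s v) = e \<sigma> s (B p v)" for p \<sigma> s v
    by (rule newton_commute; simp add: A B gA gB KA KB)+
  obtain N1 where N1: "\<And>M. M \<ge> N1 \<Longrightarrow> dress (e \<tau>) \<epsilon> A p (dress (e (- \<tau>)) \<epsilon> B q v) =
      (\<Sum>r<M. \<Sum>s<M. e \<tau> r (e (- \<tau>) s (A (p + \<epsilon> * int r) (B (q + \<epsilon> * int s) v))))"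
    and z1: "\<And>r s M. M \<ge> N1 \<Longrightarrow> r \<ge> M \<or> s \<ge> M \<Longrightarrow> e \<tau> r (e (- \<tau>) s (A (p + \<epsilon> * int r) (B (q + \<epsilon> * int s) v))) = 0"
    using dress_dress[OF newton_lin newton_lin A B finA finB Ae] by blast
  obtain N2 where N2: "\<And>M. M \<ge> N2 \<Longrightarrow> dress (e (- \<tau>)) \<epsilon> B q (dress (e \<tau>) \<epsilon> A p v) =
      (\<Sum>s<M. \<Sum>r<M. e (- \<tau>) s (e \<tau> r (B (q + \<epsilon> * int s) (A (p + \<epsilon> * int r) v))))"
    and z2: "\<And>r s M. M \<ge> N2 \<Longrightarrow> s \<ge> M \<or> r \<ge> M \<Longrightarrow> e (- \<tau>) s (e \<tau> r (B (q + \<epsilon> * int s) (A (p + \<epsilon> * int r) v))) = 0"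
    using dress_dress[OF newton_lin newton_lin B A finB finA Be] by blast
  \<comment> \<open>The last entry of the maximum puts the antidiagonal \<open>n\<close> of the
    central term below \<open>2 * N\<close>.\<close>
  define N where "N = max (max N1 N2) (nat \<bar>p + q\<bar> + 1)"
  have N: "N \<ge> N1" "N \<ge> N2" "N > nat \<bar>p + q\<bar>" by (auto simp: N_def)
  define n where "n = - (\<epsilon> * (p + q))"
  have n: "p + q + \<epsilon> * int k = 0 \<longleftrightarrow> int k = n" for k
    using \<epsilon> by (auto simp: n_def)
  \<comment> \<open>The \<open>(r, s)\<close> contribution of the commutator; the central term, of
    value \<open>p + \<epsilon> r\<close>, is present on the antidiagonal \<open>r + s = n\<close>
    only.\<close>
  define H where "H = (\<lambda>r s. e \<tau> r (e (- \<tau>) s (Z (p + q + \<epsilon> * int (r + s)) v +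
      (if int (r + s) = n then scaleV (of_int p) (K v) + scaleV (of_int \<epsilon> * of_nat r) (K v) else 0))))"
  have comm: "e \<tau> r (e (- \<tau>) s (A (p + \<epsilon> * int r) (B (q + \<epsilon> * int s) v))) =
      e (- \<tau>) s (e \<tau> r (B (q + \<epsilon> * int s) (A (p + \<epsilon> * int r) v))) + H r s" for r s
  proof -
    have "p + \<epsilon> * int r + (q + \<epsilon> * int s) = p + q + \<epsilon> * int (r + s)"
      by (simp add: algebra_simps)
    then have "A (p + \<epsilon> * int r) (B (q + \<epsilon> * int s) v) =
      B (q + \<epsilon> * int s) (A (p + \<epsilon> * int r) v) + Z (p + q + \<epsilon> * int (r + s)) v +
      (if int (r + s) = n then scaleV (of_int p) (K v) + scaleV (of_int \<epsilon> * of_nat r) (K v) else 0)"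
      by (simp only: AB n of_int_add of_int_mult of_int_of_nat_eq scaleV_add_left)
    then show ?thesis
      unfolding H_def by (simp only: lin_add[OF newton_lin] newton_newton[of "- \<tau>" s] add.assoc)
  qed
  have Hz: "H r s = 0" if "r \<ge> N \<or> s \<ge> N" for r s
    using comm[of r s] z1[OF N(1)] z2[OF N(2)] that by auto
  have "dress (e \<tau>) \<epsilon> A p (dress (e (- \<tau>)) \<epsilon> B q v) =
    dress (e (- \<tau>)) \<epsilon> B q (dress (e \<tau>) \<epsilon> A p v) + (\<Sum>r<N. \<Sum>s<N. H r s)"
    unfolding N1[OF N(1)] N2[OF N(2)] comm sum.distrib
    by (subst sum.swap) simp
  also have "(\<Sum>r<N. \<Sum>s<N. H r s) = (\<Sum>k<2 * N. \<Sum>r\<le>k. H r (k - r))"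
    by (rule sum_square_antidiagonal[OF Hz])
  also have "\<dots> = (\<Sum>k<2 * N. (if k = 0 then Z (p + q) v else 0) +
      ((if int k = n then (if k = 0 then scaleV (of_int p) (K v) else 0) else 0) +
       (if int k = n then (if k = 0 then 0 else scaleV (of_int \<epsilon> * \<tau>) (g k v)) else 0)))"
  proof (rule sum.cong[OF refl])
    fix k
    have "(\<Sum>r\<le>k. H r (k - r)) =
        (\<Sum>r\<le>k. e \<tau> r (e (- \<tau>) (k - r) (Z (p + q + \<epsilon> * int k) v))) +
        ((if int k = n then scaleV (of_int p) (\<Sum>r\<le>k. e \<tau> r (e (- \<tau>) (k - r) v)) else 0) +
         (if int k = n then scaleV (of_int \<epsilon>) (\<Sum>r\<le>k. scaleV (of_nat r) (e \<tau> r (e (- \<tau>) (k - r) v))) else 0))"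
      by (auto simp: H_def lin_add[OF newton_lin] lin_scale[OF newton_lin] lin_zero[OF newton_lin] newton_K
          scaleV_sum_right sum.distrib scaleV_add_right simp flip: of_nat_add)
    then show "(\<Sum>r\<le>k. H r (k - r)) = (if k = 0 then Z (p + q) v else 0) +
      ((if int k = n then (if k = 0 then scaleV (of_int p) (K v) else 0) else 0) +
       (if int k = n then (if k = 0 then 0 else scaleV (of_int \<epsilon> * \<tau>) (g k v)) else 0))"
      by (auto simp: newton_conv newton_conv_deriv KZ K_K)
  qed
  also have "\<dots> = Z (p + q) v + (if n = 0 then scaleV (of_int p) (K v) else 0) +
      (if n > 0 then scaleV (of_int \<epsilon> * \<tau>) (g (nat n) v) else 0)"
  proof -
    have N0: "2 * N > 0" and nN: "n > 0 \<Longrightarrow> nat n < 2 * N"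
      using N(3) \<epsilon> by (auto simp: n_def)
    have "(\<Sum>k<2 * N. if k = 0 then Z (p + q) v else 0) = Z (p + q) v"
      using N0 by simp
    moreover have "(\<Sum>k<2 * N. if int k = n then (if k = 0 then scaleV (of_int p) (K v) else 0) else 0) =
        (if n = 0 then scaleV (of_int p) (K v) else 0)"
    proof (cases "n = 0")
      case True
      have "(\<Sum>k<2 * N. if int k = n then (if k = 0 then scaleV (of_int p) (K v) else 0) else 0) =
         (\<Sum>k<2 * N. if k = 0 then scaleV (of_int p) (K v) else 0)"
        by (rule sum.cong) (auto simp: True)
      then show ?thesis using True N0 by simp
    qed (auto intro!: sum.neutral)
    moreover have "(\<Sum>k<2 * N. if int k = n then (if k = 0 then 0 else scaleV (of_int \<epsilon> * \<tau>) (g k v)) else 0) =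
        (if n > 0 then scaleV (of_int \<epsilon> * \<tau>) (g (nat n) v) else 0)"
    proof (cases "n > 0")
      case True
      have "(\<Sum>k<2 * N. if int k = n then (if k = 0 then 0 else scaleV (of_int \<epsilon> * \<tau>) (g k v)) else 0) =
         (\<Sum>k<2 * N. if k = nat n then scaleV (of_int \<epsilon> * \<tau>) (g k v) else 0)"
        by (rule sum.cong) (use True in auto)
      then show ?thesis using True nN by simp
    qed (auto intro!: sum.neutral)
    ultimately show ?thesis by (simp only: sum.distrib add.assoc)
  qed
  finally show ?thesis
    using \<epsilon> by (auto simp: n_def add.assoc)
qed

text \<open>For \<open>\<epsilon> n > 0\<close> the exponential adds
  \<open>\<epsilon> \<tau>\<close> to the coefficient in \<open>[D, A]\<close>, its factor
  \<open>z\<^sup>\<epsilon>\<^sup>n\<close> being the shift of modes by \<open>n\<close>. Depending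
  on \<open>\<tau>\<close> this removes the bracket with half of the modes of \<open>d\<close>, or
  creates it.\<close>

lemma dress_derivation:
  assumes A: "\<And>p. linear_op (A p)" and KA: "\<And>p v. K (A p v) = A p v"
    and finA: "dressable (e \<tau>) \<epsilon> A"
    and D: "linear_op D" and DK: "\<And>v. D (K v) = D v" "\<And>v. K (D v) = D v"
    and Dg: "\<And>k v. D (g (Suc k) v) =
      g (Suc k) (D v) + (if \<epsilon> * n = int (Suc k) then scaleV (of_int n) (K v) else 0)"
    and DA: "\<And>p v. D (A p v) = A p (D v) + scaleV s (A (p + n) v)"
    and \<epsilon>: "\<epsilon> = 1 \<or> \<epsilon> = - 1"
  shows "D (dress (e \<tau>) \<epsilon> A p v) = dress (e \<tau>) \<epsilon> A p (D v) +
    scaleV (s + (if \<epsilon> * n > 0 then of_int \<epsilon> * \<tau> else 0)) (dress (e \<tau>) \<epsilon> A (p + n) v)"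
proof -
  define k where "k = nat (\<epsilon> * n)"
  have De: "D (e \<tau> r w) = e \<tau> r (D w) + (if \<epsilon> * n > 0 \<and> k \<le> r then scaleV (\<tau> * of_int \<epsilon>) (e \<tau> (r - k) w) else 0)" for r w
  proof (cases "\<epsilon> * n > 0")
    case True
    have "D (e \<tau> r w) = e \<tau> r (D w) + (if k \<le> r then scaleV (\<tau> * of_int \<epsilon>) (e \<tau> (r - k) w) else 0)"
    proof (rule newton_derivation[OF D DK])
      show "k \<ge> 1" using True by (simp add: k_def)
      have "of_int n = of_nat k * (of_int \<epsilon> :: complex)" using True \<epsilon> by (auto simp: k_def)
      then show "D (g (Suc j) v) = g (Suc j) (D v) + (if Suc j = k then scaleV (of_nat k * of_int \<epsilon>) (K v) else 0)" for j v
      proof -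
        have "\<epsilon> * n = int (Suc j) \<longleftrightarrow> Suc j = k" using True by (auto simp: k_def)
        moreover have "of_nat k * of_int \<epsilon> = (of_int n :: complex)" using \<open>of_int n = _\<close> by simp
        ultimately show ?thesis using Dg[of j v] by simp
      qed
    qed
    then show ?thesis using True by simp
  next
    case False
    have "\<epsilon> * n \<noteq> int (Suc j)" for j using False by linarith
    then have "D (g (Suc j) v) = g (Suc j) (D v)" for j v using Dg[of j v] by simp
    then have "D (e \<tau> r w) = e \<tau> r (D w)"
      by (intro newton_commute[OF D]) (simp_all add: DK)
    then show ?thesis using False by simp
  qed
  obtain N1 where N1: "\<And>M. M \<ge> N1 \<Longrightarrow> dress (e \<tau>) \<epsilon> A p v = (\<Sum>r<M. e \<tau> r (A (p + \<epsilon> * int r) v))"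
    using dressableD[OF finA] by blast
  obtain N2 where N2: "\<And>M. M \<ge> N2 \<Longrightarrow> dress (e \<tau>) \<epsilon> A p (D v) = (\<Sum>r<M. e \<tau> r (A (p + \<epsilon> * int r) (D v)))"
    using dressableD[OF finA] by blast
  obtain N3 where N3: "\<And>M. M \<ge> N3 \<Longrightarrow> dress (e \<tau>) \<epsilon> A (p + n) v = (\<Sum>r<M. e \<tau> r (A (p + n + \<epsilon> * int r) v))"
    using dressableD[OF finA] by blast
  define N where "N = max N1 (max N2 N3)"
  have N: "N + k \<ge> N1" "N + k \<ge> N2" "N + k \<ge> N3" "N \<ge> N3" by (auto simp: N_def)
  have "D (dress (e \<tau>) \<epsilon> A p v) = (\<Sum>r<N+k. e \<tau> r (A (p + \<epsilon> * int r) (D v))) +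
     scaleV s (\<Sum>r<N+k. e \<tau> r (A (p + n + \<epsilon> * int r) v)) +
     (\<Sum>r<N+k. if \<epsilon> * n > 0 \<and> k \<le> r then scaleV (\<tau> * of_int \<epsilon>) (e \<tau> (r - k) (A (p + \<epsilon> * int r) v)) else 0)"
    by (simp add: N1[OF N(1)] lin_sum[OF D] De DA lin_add[OF newton_lin] lin_scale[OF newton_lin]
        sum.distrib scaleV_sum_right algebra_simps)
  also have "(\<Sum>r<N+k. if \<epsilon> * n > 0 \<and> k \<le> r then scaleV (\<tau> * of_int \<epsilon>) (e \<tau> (r - k) (A (p + \<epsilon> * int r) v)) else 0) =
     (if \<epsilon> * n > 0 then scaleV (of_int \<epsilon> * \<tau>) (dress (e \<tau>) \<epsilon> A (p + n) v) else 0)"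
  proof (cases "\<epsilon> * n > 0")
    case True
    have sh: "p + \<epsilon> * int (r + k) = p + n + \<epsilon> * int r" for r
      using True \<epsilon> by (auto simp: k_def algebra_simps)
    have sh': "p + n + \<epsilon> * int (r - k) = p + \<epsilon> * int r" if "k \<le> r" for r
      using sh[of "r - k"] that by simp
    have "(\<Sum>r<N+k. if \<epsilon> * n > 0 \<and> k \<le> r then scaleV (\<tau> * of_int \<epsilon>) (e \<tau> (r - k) (A (p + \<epsilon> * int r) v)) else 0) =
      (\<Sum>r\<in>{k..<N+k}. scaleV (\<tau> * of_int \<epsilon>) (e \<tau> (r - k) (A (p + \<epsilon> * int r) v)))"
      by (rule sum.mono_neutral_cong_right) (use True in auto)
    also have "\<dots> = (\<Sum>r<N. scaleV (\<tau> * of_int \<epsilon>) (e \<tau> r (A (p + n + \<epsilon> * int r) v)))"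
      by (rule sum.reindex_bij_witness[where i = "\<lambda>r. r + k" and j = "\<lambda>r. r - k"])
         (auto simp: sh' simp del: of_nat_diff)
    finally show ?thesis using True by (simp add: N3[OF N(4)] scaleV_sum_right mult.commute)
  qed auto
  finally show ?thesis
    by (simp add: N2[OF N(2)] N3[OF N(3)] scaleV_add_left add.assoc)
qed

text \<open>The two exponentials are inverse, and smoothness makes all sums finite. Recovering the
  modes from the dressed ones transfers invariance and vanishing statements back to them.\<close>

lemma undress:
  assumes smooth: "\<exists>N. \<forall>p\<ge>N. Y p v = 0" and K: "\<And>p. K (Y p v) = Y p v"
  shows "\<exists>N0. \<forall>N\<ge>N0. (\<Sum>r<N. e \<tau> r (dress (e (- \<tau>)) 1 Y (p + int r) v)) = Y p v"
proof -
  obtain M where M: "\<And>q. q \<ge> M \<Longrightarrow> Y q v = 0" using smooth by blast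
  show ?thesis
  proof (rule exI[of _ "Suc (nat (M - p))"], intro allI impI)
    fix N assume N: "N \<ge> Suc (nat (M - p))"
    have z: "Y (p + int r) v = 0" if "r \<ge> N" for r
      by (rule M) (use that N in auto)
    have d: "dress (e (- \<tau>)) 1 Y (p + int r) v = (\<Sum>s<N. e (- \<tau>) s (Y (p + int (r + s)) v))" for r
      using dress_eq_sum[of N "e (- \<tau>)" Y "p + int r" 1 v] z
      by (simp add: lin_zero[OF newton_lin] add.assoc flip: of_nat_add)
    have "(\<Sum>r<N. e \<tau> r (dress (e (- \<tau>)) 1 Y (p + int r) v)) =
       (\<Sum>r<N. \<Sum>s<N. e \<tau> r (e (- \<tau>) s (Y (p + int (r + s)) v)))"
      by (simp add: d lin_sum[OF newton_lin])
    also have "\<dots> = (\<Sum>k<2 * N. \<Sum>r\<le>k. e \<tau> r (e (- \<tau>) (k - r) (Y (p + int (r + (k - r))) v)))"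
      by (rule sum_square_antidiagonal) (auto simp: z lin_zero[OF newton_lin] simp del: of_nat_add)
    also have "\<dots> = (\<Sum>k<2 * N. if k = 0 then Y p v else 0)"
      by (rule sum.cong) (auto simp: newton_conv K)
    also have "\<dots> = Y p v" using N by simp
    finally show "(\<Sum>r<N. e \<tau> r (dress (e (- \<tau>)) 1 Y (p + int r) v)) = Y p v" .
  qed
qed

end

section \<open>Creation and annihilation operators\<close>

text \<open>The relations are imposed on a subspace \<open>U\<close> because the commutators become
  scalars only there. \<open>G\<close> is the space of vacua, of arbitrary dimension.\<close>

locale creation_annihilation =
  fixes y D :: "'j \<Rightarrow> ('i \<Rightarrow>\<^sub>0 complex) \<Rightarrow> ('i \<Rightarrow>\<^sub>0 complex)" and s :: "'j \<Rightarrow> complex"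
    and J :: "'j set" and G U :: "('i \<Rightarrow>\<^sub>0 complex) set"
  assumes y_lin: "linear_op (y i)" and D_lin: "linear_op (D i)"
    and G_sub: "subspaceV G" and U_sub: "subspaceV U" and G_U: "G \<subseteq> U"
    and y_U: "i \<in> J \<Longrightarrow> u \<in> U \<Longrightarrow> y i u \<in> U"
    and D_U: "i \<in> J \<Longrightarrow> u \<in> U \<Longrightarrow> D i u \<in> U"
    and D_G: "i \<in> J \<Longrightarrow> v \<in> G \<Longrightarrow> D i v = 0"
    and y_y: "i \<in> J \<Longrightarrow> j \<in> J \<Longrightarrow> u \<in> U \<Longrightarrow> y i (y j u) = y j (y i u)"
    and D_y: "i \<in> J \<Longrightarrow> j \<in> J \<Longrightarrow> u \<in> U \<Longrightarrow>
      D i (y j u) = y j (D i u) + (if i = j then scaleV (s i) u else 0)"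
    and s_nonzero: "i \<in> J \<Longrightarrow> s i \<noteq> 0"
begin

text \<open>A filtration by degree in the creation operators; nothing is assumed about independence
  of the monomials.\<close>

inductive W :: "'j set \<Rightarrow> nat \<Rightarrow> ('i \<Rightarrow>\<^sub>0 complex) \<Rightarrow> bool" for I where
  W_base: "v \<in> G \<Longrightarrow> W I k v"
| W_step: "i \<in> I \<Longrightarrow> W I k v \<Longrightarrow> W I (Suc k) (y i v)"
| W_add: "W I k u \<Longrightarrow> W I k v \<Longrightarrow> W I k (u + v)"
| W_Suc: "W I k v \<Longrightarrow> W I (Suc k) v"

lemma W_scale: "W I k v \<Longrightarrow> W I k (scaleV z v)"
proof (induction rule: W.induct)
  case (W_base v k)
  then show ?case by (intro W.W_base subspaceV_scale[OF G_sub])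
next
  case (W_step i k v)
  then show ?case using W.W_step[of i I k "scaleV z v"] by (simp add: lin_scale[OF y_lin])
qed (auto simp: scaleV_add_right intro: W.intros)

lemma W_zero: "W I k 0"
  by (intro W_base subspaceV_zero[OF G_sub])

lemma W_diff: "W I k u \<Longrightarrow> W I k v \<Longrightarrow> W I k (u - v)"
  using W_add[of I k u "scaleV (-1) v"] W_scale[of I k v "-1"] by (simp add: scaleV_minus_left)

lemma W_le: "W I k v \<Longrightarrow> k \<le> l \<Longrightarrow> W I l v"
  by (induction l) (auto simp: le_Suc_eq intro: W_Suc)

lemma W_mono: "W I k v \<Longrightarrow> I \<subseteq> I' \<Longrightarrow> W I' k v"
  by (induction rule: W.induct) (auto intro: W.intros)

lemma W_0: "W I 0 v \<Longrightarrow> v \<in> G"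
  by (induction k\<equiv>"0::nat" v rule: W.induct) (auto intro: subspaceV_add[OF G_sub])

lemma W_U: "W I k v \<Longrightarrow> I \<subseteq> J \<Longrightarrow> v \<in> U"
  by (induction rule: W.induct) (use G_U in \<open>auto intro: y_U subspaceV_add[OF U_sub]\<close>)

text \<open>Since \<open>0 - 1 = 0\<close> for naturals, a separate clause has to express that the
  degree falls below zero when \<open>k = 0\<close>.\<close>

lemma W_D:
  assumes "W I k v" "I \<subseteq> J" "i \<in> J"
  shows "(k = 0 \<longrightarrow> D i v = 0) \<and> W I (k - 1) (D i v)"
  using assms(1)
proof (induction rule: W.induct)
  case (W_base v k)
  then show ?case using assms by (simp add: D_G W_zero)
next
  case (W_step j k v)
  have u: "v \<in> U" using W_step assms by (blast intro: W_U)
  have "W I k (y j (D i v))"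
    using W_step W.W_step[of j I "k - 1" "D i v"] by (cases k) (auto simp: lin_zero[OF y_lin] W_zero)
  then show ?case using W_step u assms D_y[of i j v]
    by (auto intro!: W_add W_scale)
next
  case (W_add k u v)
  then show ?case by (auto simp: lin_add[OF D_lin] intro: W.W_add)
next
  case (W_Suc k v)
  then show ?case by (cases k) (auto intro: W.W_Suc W_zero)
qed

text \<open>The number operator. The factors \<open>1 / s i\<close> are chosen so that every
  creation operator of \<open>I\<close> raises it by exactly one.\<close>

definition euler :: "'j set \<Rightarrow> ('i \<Rightarrow>\<^sub>0 complex) \<Rightarrow> ('i \<Rightarrow>\<^sub>0 complex)" where
  "euler I v = (\<Sum>i\<in>I. scaleV (1 / s i) (y i (D i v)))"

lemma euler_lin: "linear_op (euler I)"
  unfolding euler_def by (intro linear_op_sum linear_op_scale linear_op_compose[OF y_lin] D_lin)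

lemma euler_step:
  assumes "finite I" "I \<subseteq> J" "j \<in> I" "u \<in> U"
  shows "euler I (y j u) = y j (euler I u) + y j u"
proof -
  have "euler I (y j u) = (\<Sum>i\<in>I. scaleV (1 / s i) (y i (y j (D i u))) + (if i = j then y j u else 0))"
    unfolding euler_def
  proof (rule sum.cong[OF refl])
    fix i assume i: "i \<in> I"
    then have "s i \<noteq> 0" using assms s_nonzero by blast
    then show "scaleV (1 / s i) (y i (D i (y j u))) = scaleV (1 / s i) (y i (y j (D i u))) + (if i = j then y j u else 0)"
      using i assms by (subst D_y) (auto simp: lin_add[OF y_lin] lin_scale[OF y_lin] lin_zero[OF y_lin] scaleV_add_right)
  qed
  also have "\<dots> = (\<Sum>i\<in>I. scaleV (1 / s i) (y i (y j (D i u)))) + y j u"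
    using assms by (simp add: sum.distrib)
  also have "(\<Sum>i\<in>I. scaleV (1 / s i) (y i (y j (D i u)))) = y j (euler I u)"
    unfolding euler_def lin_sum[OF y_lin] lin_scale[OF y_lin]
    by (rule sum.cong) (use assms in \<open>auto simp: y_y D_U subset_iff\<close>)
  finally show ?thesis .
qed

text \<open>Modulo lower degree the number operator is the scalar \<open>k\<close>; every rule that
  generates \<open>W\<close> respects this.\<close>

lemma W_euler:
  assumes "W I k v" "finite I" "I \<subseteq> J"
  shows "(k = 0 \<longrightarrow> euler I v = 0) \<and> W I (k - 1) (euler I v - scaleV (of_nat k) v)"
  using assms(1)
proof (induction rule: W.induct)
  case (W_base v k)
  have "euler I v = 0"
    unfolding euler_def using assms W_base by (auto intro!: sum.neutral simp: D_G lin_zero[OF y_lin] subset_iff)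
  then show ?case using W_scale[OF W.W_base[OF W_base], of I "k - 1" "- of_nat k"]
    by (simp add: scaleV_minus_left)
next
  case (W_step j k v)
  have u: "v \<in> U" using W_step assms by (blast intro: W_U)
  have "euler I (y j v) - scaleV (of_nat (Suc k)) (y j v) = y j (euler I v - scaleV (of_nat k) v)"
    using assms W_step u
    by (simp add: euler_step lin_diff[OF y_lin] lin_scale[OF y_lin] scaleV_add_left)
  moreover have "W I k (y j (euler I v - scaleV (of_nat k) v))"
    using W_step W.W_step[of j I "k - 1"] by (cases k) (auto simp: lin_zero[OF y_lin] W_zero)
  ultimately show ?case by simp
next
  case (W_add k u v)
  then show ?case
    using W.W_add[of I "k - 1" "euler I u - scaleV (of_nat k) u" "euler I v - scaleV (of_nat k) v"]
    by (auto simp: lin_add[OF euler_lin] scaleV_add_right algebra_simps)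
next
  case (W_Suc k v)
  then have "W I k (euler I v - scaleV (of_nat k) v)"
    using W.W_Suc[of I "k - 1"] by (cases k) (auto simp: W_zero)
  from W_diff[OF this W_Suc.hyps] show ?case
    by (simp add: scaleV_add_left diff_diff_eq add.commute)
qed

text \<open>A single vector involves finitely many creation operators only, so an infinite index set
  reduces to one for which the number operator is a finite sum.\<close>

lemma W_finite: "W J k v \<Longrightarrow> \<exists>I. finite I \<and> I \<subseteq> J \<and> W I k v"
proof (induction rule: W.induct)
  case (W_base v k)
  then show ?case by (intro exI[of _ "{}"]) (auto intro: W.W_base)
next
  case (W_step i k v)
  then obtain I where "finite I" "I \<subseteq> J" "W I k v" by blast
  then show ?case using W_step
    by (intro exI[of _ "insert i I"]) (auto intro!: W.W_step elim: W_mono)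
next
  case (W_add k u v)
  then obtain I I' where "finite I" "I \<subseteq> J" "W I k u" "finite I'" "I' \<subseteq> J" "W I' k v" by blast
  then show ?case
    by (intro exI[of _ "I \<union> I'"]) (auto intro!: W.W_add elim: W_mono)
qed (blast intro: W.W_Suc)

text \<open>On a vector killed by all annihilation operators the Euler operator vanishes, while it acts
  as \<open>k\<close> on the top layer of \<open>W I k\<close>; hence the top layer is \<open>0\<close>.\<close>

lemma killed_in_G:
  assumes "W J k v" "\<And>i. i \<in> J \<Longrightarrow> D i v = 0"
  shows "v \<in> G"
proof -
  obtain I where I: "finite I" "I \<subseteq> J" "W I k v" using W_finite assms(1) by blast
  have e: "euler I v = 0"
    unfolding euler_def using assms I by (auto intro!: sum.neutral simp: lin_zero[OF y_lin] subset_iff)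
  have "W I 0 v" using I(3)
  proof (induction k)
    case (Suc k)
    have "W I k (scaleV (- of_nat (Suc k)) v)"
      using W_euler[OF Suc.prems I(1,2)] by (simp add: e scaleV_minus_left del: of_nat_Suc)
    then have "W I k (scaleV (- 1 / of_nat (Suc k)) (scaleV (- of_nat (Suc k)) v))" by (rule W_scale)
    also have "scaleV (- 1 / of_nat (Suc k)) (scaleV (- of_nat (Suc k)) v) = v"
      using of_nat_neq_0[of k, where 'a = complex] by (simp del: of_nat_Suc)
    finally show ?case by (rule Suc.IH)
  qed
  then show ?thesis by (rule W_0)
qed

text \<open>An annihilation operator that does not kill the vector lowers its degree without leaving
  \<open>H\<close>. When none is left, \<open>killed_in_G\<close> applies.\<close>

lemma invariant_meets_G:
  assumes H: "\<And>i v. i \<in> J \<Longrightarrow> v \<in> H \<Longrightarrow> D i v \<in> H" and "v \<in> H" "v \<noteq> 0" "W J k v"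
  shows "\<exists>u\<in>H. u \<in> G \<and> u \<noteq> 0"
  using assms(2-4)
proof (induction k arbitrary: v rule: less_induct)
  case (less k)
  show ?case
  proof (cases "\<exists>i\<in>J. D i v \<noteq> 0")
    case True
    then obtain i where i: "i \<in> J" "D i v \<noteq> 0" by blast
    have "k \<noteq> 0" "W J (k - 1) (D i v)" using W_D[OF less.prems(3) _ i(1)] i by auto
    then show ?thesis using less.IH[of "k - 1" "D i v"] i H less.prems by auto
  next
    case False
    then show ?thesis using killed_in_G less.prems by blast
  qed
qed

end

section \<open>Smooth modules\<close>

text \<open>The relations of the affine algebra after the shift \<open>A\<^sub>p = a(p - m)\<close>, \<open>B\<^sub>p = b(p + m)\<close>,
  \<open>C\<^sub>0 = c(0) - m \<^bold>k\<close>, which brings \<open>m\<close> to \<open>0\<close>.\<close>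

locale aff_module =
  fixes A B C D :: "int \<Rightarrow> ('i \<Rightarrow>\<^sub>0 complex) \<Rightarrow> ('i \<Rightarrow>\<^sub>0 complex)"
    and K :: "('i \<Rightarrow>\<^sub>0 complex) \<Rightarrow> ('i \<Rightarrow>\<^sub>0 complex)"
  assumes A_lin: "linear_op (A p)" and B_lin: "linear_op (B p)" and C_lin: "linear_op (C p)"
    and D_lin: "linear_op (D p)" and K_lin: "linear_op K"
    and K_simps: "K (K v) = K v" "K (A p v) = A p v" "A p (K v) = A p v"
      "K (B p v) = B p v" "B p (K v) = B p v" "K (C p v) = C p v" "C p (K v) = C p v"
      "K (D p v) = D p v" "D p (K v) = D p v"
    and AA: "A p (A q v) = A q (A p v)" and BB: "B p (B q v) = B q (B p v)"
    and CC: "C p (C q v) = C q (C p v)" and DD: "D p (D q v) = D q (D p v)"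
    and CA: "C p (A q v) = A q (C p v)" and CB: "C p (B q v) = B q (C p v)"
    and DA: "D p (A q v) = A q (D p v) + A (p + q) v"
    and DB: "D p (B q v) = B q (D p v) - B (p + q) v"
    and DC: "D p (C q v) = C q (D p v) + (if p + q = 0 then scaleV (of_int p) (K v) else 0)"
    and AB: "A p (B q v) = B q (A p v) + C (p + q) v + (if p + q = 0 then scaleV (of_int p) (K v) else 0)"

locale smooth_module = aff_module +
  assumes smooth: "\<exists>N. \<forall>p\<ge>N. A p v = 0 \<and> B p v = 0"
begin

sublocale cf: commuting_family "\<lambda>k. C (- int k)" K
  by standard (simp_all add: C_lin K_lin CC K_simps)

abbreviation "e \<equiv> newton (\<lambda>k. C (- int k)) K"

lemma dressable_A: "dressable (e \<tau>) 1 A" and dressable_B: "dressable (e \<tau>) 1 B"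
proof -
  have "\<exists>N. \<forall>r\<ge>N. A (p + int r) v = 0 \<and> B (p + int r) v = 0" for p v
  proof -
    obtain N where N: "\<And>q. q \<ge> N \<Longrightarrow> A q v = 0 \<and> B q v = 0" using smooth by blast
    then show ?thesis by (intro exI[of _ "nat (N - p)"]) (auto intro!: N)
  qed
  then show "dressable (e \<tau>) 1 A" "dressable (e \<tau>) 1 B"
    unfolding dressable_def by (metis mult_1 lin_zero[OF cf.newton_lin])+
qed

text \<open>The factor \<open>exp (\<plusminus> \<Sum>\<^sub>k c(-k) z\<^sup>k / k)\<close> makes \<open>a(z)\<close> and \<open>b(z)\<close> commute with the
  positive modes of \<open>d\<close>.\<close>

definition "Ah = dress (e (- 1)) 1 A"
definition "Bh = dress (e 1) 1 B"

lemma Ah_lin: "linear_op (Ah p)" and Bh_lin: "linear_op (Bh p)"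
  unfolding Ah_def Bh_def by (intro dress_lin cf.newton_lin A_lin B_lin dressable_A dressable_B)+

lemma e_comm:
  "A p (e \<tau> r v) = e \<tau> r (A p v)" "B p (e \<tau> r v) = e \<tau> r (B p v)" "C p (e \<tau> r v) = e \<tau> r (C p v)"
  by (rule cf.newton_commute; simp add: A_lin B_lin C_lin CA CB CC K_simps)+

lemma C_Ah: "C p (Ah q v) = Ah q (C p v)" and C_Bh: "C p (Bh q v) = Bh q (C p v)"
  unfolding Ah_def Bh_def by (rule dress_commute; simp add: C_lin e_comm CA CB dressable_A dressable_B)+

lemma K_Ah: "K (Ah q v) = Ah q v" and K_Bh: "K (Bh q v) = Bh q v"
proof -
  have 1: "Ah q (K v) = Ah q v" "Bh q (K v) = Bh q v"
    by (simp_all add: Ah_def Bh_def dress_def K_simps)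
  have "K (Ah q v) = Ah q (K v)" "K (Bh q v) = Bh q (K v)"
    unfolding Ah_def Bh_def by (rule dress_commute; simp add: K_lin cf.newton_K K_simps dressable_A dressable_B)+
  then show "K (Ah q v) = Ah q v" "K (Bh q v) = Bh q v" by (simp_all add: 1)
qed

lemma Ah_Ah: "Ah p (Ah q v) = Ah q (Ah p v)"
  unfolding Ah_def by (rule dress_dress_commute)
     (simp_all add: A_lin cf.newton_lin dressable_A e_comm cf.newton_newton[of "-1" _ "-1"] AA)

lemma Bh_Bh: "Bh p (Bh q v) = Bh q (Bh p v)"
  unfolding Bh_def by (rule dress_dress_commute)
     (simp_all add: B_lin cf.newton_lin dressable_B e_comm cf.newton_newton[of 1 _ 1] BB)

text \<open>The correction term of \<open>dress_commutator\<close> equals \<open>- C (p + q)\<close>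
  for \<open>p + q < 0\<close> and removes the negative modes of \<open>C\<close>; the remaining
  ones are scalars on \<open>\<Omega>\<close> below.\<close>

lemma Ah_Bh: "Ah p (Bh q v) = Bh q (Ah p v) + (if p + q < 0 then 0 else C (p + q) v) +
   (if p + q = 0 then scaleV (of_int p) (K v) else 0)"
proof -
  \<comment> \<open>\<open>- (- 1)\<close> stays unsimplified so that the second parameter is
    literally the negative of the first.\<close>
  have fB: "dressable (e (- (- 1))) 1 B" by (rule dressable_B)
  have "dress (e (- 1)) 1 A p (dress (e (- (- 1))) 1 B q v) =
      dress (e (- (- 1))) 1 B q (dress (e (- 1)) 1 A p v) + C (p + q) v +
      (if p + q = 0 then scaleV (of_int p) (K v) else 0) +
      (if 1 * (p + q) < 0 then scaleV (of_int 1 * - 1) (C (- int (nat (- 1 * (p + q)))) v) else 0)"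
    by (rule cf.dress_commutator) (simp_all add: A_lin B_lin CA CB K_simps dressable_A fB[simplified] AB)
  then show ?thesis
    unfolding minus_minus Ah_def[symmetric] Bh_def[symmetric]
    by (auto simp: scaleV_minus_left add.commute[of q p])
qed

lemma D_Ah: "D n (Ah p v) = Ah p (D n v) + (if n > 0 then 0 else Ah (p + n) v)"
proof -
  have "D n (Ah p v) = Ah p (D n v) + scaleV (1 + (if 1 * n > 0 then of_int 1 * - 1 else 0)) (Ah (p + n) v)"
    unfolding Ah_def Bh_def by (rule cf.dress_derivation)
       (auto simp: A_lin D_lin K_simps dressable_A DC DA add.commute)
  then show ?thesis by auto
qed

lemma D_Bh: "D n (Bh p v) = Bh p (D n v) - (if n > 0 then 0 else Bh (p + n) v)"
proof -
  have "D n (Bh p v) = Bh p (D n v) + scaleV (- 1 + (if 1 * n > 0 then of_int 1 * 1 else 0)) (Bh (p + n) v)"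
    unfolding Ah_def Bh_def by (rule cf.dress_derivation)
       (auto simp: B_lin D_lin K_simps dressable_B DC DB add.commute scaleV_minus_left)
  then show ?thesis by (auto simp: scaleV_minus_left)
qed

lemma A_undress: "\<exists>N. A p v = (\<Sum>r<N. e 1 r (Ah (p + int r) v))"
proof -
  have "\<exists>N. \<forall>p\<ge>N. A p v = 0" using smooth[of v] by blast
  then show ?thesis using cf.undress[of A v 1 p] unfolding Ah_def by (metis K_simps(2) order_refl)
qed

lemma B_undress: "\<exists>N. B p v = (\<Sum>r<N. e (- 1) r (Bh (p + int r) v))"
proof -
  have "\<exists>N. \<forall>p\<ge>N. B p v = 0" using smooth[of v] by blast
  then show ?thesis using cf.undress[of B v "- 1" p] unfolding Bh_def minus_minus
    by (metis K_simps(4) order_refl)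
qed

lemma e_closed:
  assumes "subspaceV S" "\<And>v. v \<in> S \<Longrightarrow> K v \<in> S" "\<And>k v. v \<in> S \<Longrightarrow> C (- int (Suc k)) v \<in> S" "v \<in> S"
  shows "e \<tau> r v \<in> S"
proof (induction r rule: less_induct)
  case (less r)
  then show ?case
    by (cases r) (auto simp: newton.simps(2) assms simp del: sum.lessThan_Suc of_nat_Suc
        intro!: assms subspaceV_scale[OF assms(1)] subspaceV_sum[OF assms(1)])
qed

end

section \<open>Highest weight vectors and invariant subspaces\<close>

text \<open>Indices of the creation operators \<open>a(-p)\<close>, \<open>b(-q)\<close>, \<open>c(-k)\<close>.\<close>

datatype letter = LA nat | LB nat | LC nat

text \<open>\<open>LB 0\<close> is included and \<open>LA 0\<close> is not: of the zero modes,
  \<open>A 0\<close> kills the highest weight vector while \<open>B 0\<close> need not.\<close>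

definition letter_set :: "letter set" where
  "letter_set = {i. case i of LA p \<Rightarrow> p \<ge> 1 | LB q \<Rightarrow> True | LC k \<Rightarrow> k \<ge> 1}"

text \<open>The commutator of \<open>ann i\<close> with \<open>cre i\<close> on vectors where
  \<open>C 0\<close> acts as \<open>\<kappa>\<close>. For \<open>\<kappa> = cc - m\<close> it
  vanishes at \<open>LB n\<close> if \<open>cc + n = m\<close> and at \<open>LA n\<close> if
  \<open>cc = m + n\<close>; these are the cases of the theorem, with \<open>LB 0\<close> for
  \<open>cc = m\<close>.\<close>

definition wt :: "complex \<Rightarrow> letter \<Rightarrow> complex" where
  "wt \<kappa> i = (case i of LA p \<Rightarrow> of_nat p - \<kappa> | LB q \<Rightarrow> \<kappa> + of_nat q | LC k \<Rightarrow> of_nat k)"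

context smooth_module
begin

definition cre :: "letter \<Rightarrow> ('a \<Rightarrow>\<^sub>0 complex) \<Rightarrow> ('a \<Rightarrow>\<^sub>0 complex)" where
  "cre i = (case i of LA p \<Rightarrow> Ah (- int p) | LB q \<Rightarrow> Bh (- int q) | LC k \<Rightarrow> C (- int k))"

definition ann :: "letter \<Rightarrow> ('a \<Rightarrow>\<^sub>0 complex) \<Rightarrow> ('a \<Rightarrow>\<^sub>0 complex)" where
  "ann i = (case i of LA p \<Rightarrow> Bh (int p) | LB q \<Rightarrow> Ah (int q) | LC k \<Rightarrow> D (int k))"

lemma cre_lin: "linear_op (cre i)"
  unfolding cre_def by (cases i) (simp_all add: Ah_lin Bh_lin C_lin)

lemma ann_lin: "linear_op (ann i)"
  unfolding ann_def by (cases i) (simp_all add: Ah_lin Bh_lin D_lin)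

end

text \<open>A creation operator of weight \<open>0\<close> is invisible to its annihilation partner,
  so the space \<open>G\<close> of vacua has to be closed under it. In the applications
  \<open>G\<close> is a line or the span of the powers of one such operator.\<close>

locale hw_module = smooth_module +
  fixes \<kappa> :: complex and G :: "('a \<Rightarrow>\<^sub>0 complex) set"
  assumes G_sub: "subspaceV G"
    and G_K: "v \<in> G \<Longrightarrow> K v = v" and G_C0: "v \<in> G \<Longrightarrow> C 0 v = scaleV \<kappa> v"
    and G_C: "v \<in> G \<Longrightarrow> n \<ge> 1 \<Longrightarrow> C n v = 0"
    and G_ann: "v \<in> G \<Longrightarrow> i \<in> letter_set \<Longrightarrow> ann i v = 0"
    and G_cre: "v \<in> G \<Longrightarrow> i \<in> letter_set \<Longrightarrow> wt \<kappa> i = 0 \<Longrightarrow> cre i v \<in> G"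
    and G_D0: "v \<in> G \<Longrightarrow> D 0 v \<in> G"
begin

text \<open>Here the nonnegative modes of \<open>C\<close> are scalars, which turns
  \<open>Ah_Bh\<close> into canonical commutation relations. The negative modes of \<open>D\<close>
  do not preserve this space.\<close>

definition \<Omega> :: "('a \<Rightarrow>\<^sub>0 complex) set" where
  "\<Omega> = {v. K v = v \<and> C 0 v = scaleV \<kappa> v \<and> (\<forall>n\<ge>1. C n v = 0)}"

definition J :: "letter set" where "J = {i \<in> letter_set. wt \<kappa> i \<noteq> 0}"

lemma \<Omega>_sub: "subspaceV \<Omega>"
  by (auto simp: subspaceV_def \<Omega>_def lin_zero[OF K_lin] lin_zero[OF C_lin] lin_add[OF K_lin]
      lin_add[OF C_lin] lin_scale[OF K_lin] lin_scale[OF C_lin] scaleV_add_right mult.commute)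

lemma \<Omega>_C: "v \<in> \<Omega> \<Longrightarrow> n \<ge> 0 \<Longrightarrow> C n v = (if n = 0 then scaleV \<kappa> v else 0)"
  by (auto simp: \<Omega>_def)

lemma \<Omega>_K: "v \<in> \<Omega> \<Longrightarrow> K v = v"
  by (auto simp: \<Omega>_def)

lemma G_\<Omega>: "G \<subseteq> \<Omega>"
  by (auto simp: \<Omega>_def G_K G_C0 G_C)

lemma commute_\<Omega>:
  assumes "linear_op Y" "\<And>n v. n \<ge> 0 \<Longrightarrow> C n (Y v) = Y (C n v)" "\<And>v. K (Y v) = Y v" "v \<in> \<Omega>"
  shows "Y v \<in> \<Omega>"
  using assms(4) by (auto simp: \<Omega>_def assms(2,3) lin_zero[OF assms(1)] lin_scale[OF assms(1)])

lemma C_D_commute: "m \<ge> 0 \<Longrightarrow> n \<ge> 0 \<Longrightarrow> C m (D n v) = D n (C m v)"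
  using DC[of n m v] by (cases "n = 0") auto

lemma Ah_\<Omega>: "v \<in> \<Omega> \<Longrightarrow> Ah p v \<in> \<Omega>" and Bh_\<Omega>: "v \<in> \<Omega> \<Longrightarrow> Bh p v \<in> \<Omega>"
  and C_\<Omega>: "v \<in> \<Omega> \<Longrightarrow> C p v \<in> \<Omega>" and D_\<Omega>: "v \<in> \<Omega> \<Longrightarrow> n \<ge> 0 \<Longrightarrow> D n v \<in> \<Omega>"
  by (rule commute_\<Omega>; simp add: Ah_lin Bh_lin C_lin D_lin C_Ah C_Bh CC C_D_commute K_Ah K_Bh K_simps)+

lemma cre_\<Omega>: "v \<in> \<Omega> \<Longrightarrow> cre i v \<in> \<Omega>"
  unfolding cre_def by (cases i) (simp_all add: Ah_\<Omega> Bh_\<Omega> C_\<Omega>)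

lemma ann_\<Omega>: "v \<in> \<Omega> \<Longrightarrow> ann i v \<in> \<Omega>"
  unfolding ann_def by (cases i) (simp_all add: Ah_\<Omega> Bh_\<Omega> D_\<Omega>)

lemma Ah_Bh_\<Omega>: "v \<in> \<Omega> \<Longrightarrow> Ah p (Bh q v) = Bh q (Ah p v) + (if p + q = 0 then scaleV (\<kappa> + of_int p) v else 0)"
  by (auto simp: Ah_Bh \<Omega>_C \<Omega>_K scaleV_add_left)

lemma Bh_Ah_\<Omega>: "v \<in> \<Omega> \<Longrightarrow> Bh p (Ah q v) = Ah q (Bh p v) + (if p + q = 0 then scaleV (of_int p - \<kappa>) v else 0)"
proof -
  assume v: "v \<in> \<Omega>"
  have "scaleV (of_int p - \<kappa>) v = - scaleV (\<kappa> + of_int q) v" if "p + q = 0"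
  proof -
    have "of_int p - \<kappa> = - (\<kappa> + of_int q)" using that by (simp add: eq_neg_iff_add_eq_0 flip: of_int_add)
    then show ?thesis by (simp only: scaleV_minus_left)
  qed
  then show ?thesis using Ah_Bh_\<Omega>[OF v, of q p] by (auto simp: add.commute)
qed

lemma cre_cre: "v \<in> \<Omega> \<Longrightarrow> i \<in> letter_set \<Longrightarrow> j \<in> letter_set \<Longrightarrow> cre i (cre j v) = cre j (cre i v)"
  by (cases i; cases j) (auto simp: cre_def letter_set_def Ah_Ah Bh_Bh Ah_Bh_\<Omega> CC C_Ah C_Bh)

lemma ann_cre:
  "v \<in> \<Omega> \<Longrightarrow> i \<in> letter_set \<Longrightarrow> j \<in> letter_set \<Longrightarrow>
    ann i (cre j v) = cre j (ann i v) + (if i = j then scaleV (wt \<kappa> i) v else 0)"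
  unfolding cre_def ann_def wt_def letter_set_def
  by (cases i; cases j; simp;
      (simp add: Bh_Ah_\<Omega>; fail | simp add: Ah_Bh_\<Omega>; fail |
       auto simp: Ah_Ah Bh_Bh C_Ah C_Bh D_Ah D_Bh DC \<Omega>_K))

sublocale inner: creation_annihilation cre ann "wt \<kappa>" J G \<Omega>
  by standard
     (auto simp: cre_lin ann_lin G_sub \<Omega>_sub G_\<Omega> cre_\<Omega> ann_\<Omega> G_ann J_def ann_cre intro: cre_cre)

section \<open>Invariance of the space generated by the dressed creation operators\<close>

definition S0 :: "('a \<Rightarrow>\<^sub>0 complex) set" where "S0 = {v. \<exists>k. inner.W J k v}"

lemma S0_sub: "subspaceV S0"
proof -
  have "\<exists>k. inner.W J k (u + v)" if "inner.W J k u" "inner.W J l v" for u v k l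
    using inner.W_add[OF inner.W_le[OF that(1) max.cobounded1] inner.W_le[OF that(2) max.cobounded2]] by blast
  then show ?thesis
    unfolding subspaceV_def S0_def using inner.W_zero inner.W_scale by blast
qed

lemma S0_\<Omega>: "v \<in> S0 \<Longrightarrow> v \<in> \<Omega>"
  unfolding S0_def using inner.W_U by blast

lemma S0_J: "v \<in> S0 \<Longrightarrow> i \<in> J \<Longrightarrow> cre i v \<in> S0"
  unfolding S0_def by (blast intro: inner.W_step)

text \<open>Commutation is asked for up to a multiple of the creation operator itself, so that the
  lemma serves the degenerate letters as well as the charge operator \<open>D 0\<close>.\<close>

lemma S0_transport:
  assumes Y: "linear_op Y" and YG: "\<And>v. v \<in> G \<Longrightarrow> Y v \<in> S0"
    and comm: "\<And>i v. i \<in> J \<Longrightarrow> v \<in> \<Omega> \<Longrightarrow> \<exists>z. Y (cre i v) = cre i (Y v) + scaleV z (cre i v)"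
    and v: "v \<in> S0"
  shows "Y v \<in> S0"
proof -
  obtain k where "inner.W J k v" using v S0_def by blast
  then show ?thesis
  proof (induction rule: inner.W.induct)
    case (W_step i k v)
    have "v \<in> S0" using W_step S0_def by blast
    moreover obtain z where "Y (cre i v) = cre i (Y v) + scaleV z (cre i v)"
      using comm[OF W_step(1)] S0_\<Omega>[OF \<open>v \<in> S0\<close>] by blast
    ultimately show ?case using W_step
      by (auto intro!: subspaceV_add[OF S0_sub] subspaceV_scale[OF S0_sub] S0_J)
  qed (auto simp: YG lin_add[OF Y] intro: subspaceV_add[OF S0_sub])
qed

lemma G_S0: "v \<in> G \<Longrightarrow> v \<in> S0"
  unfolding S0_def using inner.W_base by blast

lemma S0_cre:
  assumes "i \<in> letter_set" "v \<in> S0" shows "cre i v \<in> S0"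
proof (cases "i \<in> J")
  case False
  show ?thesis
  proof (rule S0_transport[OF cre_lin _ _ assms(2)])
    show "cre i g \<in> S0" if "g \<in> G" for g
      using that False assms by (auto simp: J_def intro!: G_S0 G_cre)
    show "\<exists>z. cre i (cre j u) = cre j (cre i u) + scaleV z (cre j u)" if "j \<in> J" "u \<in> \<Omega>" for j u
      using that assms by (intro exI[of _ 0]) (auto simp: J_def intro: cre_cre)
  qed
qed (use assms S0_J in blast)

lemma S0_ann:
  assumes "i \<in> letter_set" "v \<in> S0" shows "ann i v \<in> S0"
proof (cases "i \<in> J")
  case True
  then show ?thesis using assms(2) inner.W_D unfolding S0_def by blast
next
  case False
  show ?thesis
  proof (rule S0_transport[OF ann_lin _ _ assms(2)])
    show "ann i g \<in> S0" if "g \<in> G" for g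
      using that assms subspaceV_zero[OF S0_sub] by (auto simp: G_ann)
    show "\<exists>z. ann i (cre j u) = cre j (ann i u) + scaleV z (cre j u)" if "j \<in> J" "u \<in> \<Omega>" for j u
      using that assms False by (intro exI[of _ 0]) (auto simp: J_def ann_cre)
  qed
qed

lemma S0_Ah: "v \<in> S0 \<Longrightarrow> Ah p v \<in> S0" and S0_Bh: "v \<in> S0 \<Longrightarrow> Bh p v \<in> S0"
proof -
  assume v: "v \<in> S0"
  show "Ah p v \<in> S0"
  proof (cases "p < 0")
    case True
    then show ?thesis using S0_cre[of "LA (nat (- p))" v] v by (auto simp: cre_def letter_set_def)
  next
    case False
    then show ?thesis using S0_ann[of "LB (nat p)" v] v by (auto simp: ann_def letter_set_def)
  qed
  show "Bh p v \<in> S0"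
  proof (cases "p > 0")
    case True
    then show ?thesis using S0_ann[of "LA (nat p)" v] v by (auto simp: ann_def letter_set_def)
  next
    case False
    then show ?thesis using S0_cre[of "LB (nat (- p))" v] v by (auto simp: cre_def letter_set_def)
  qed
qed

lemma S0_C: "v \<in> S0 \<Longrightarrow> C p v \<in> S0"
proof (cases "p < 0")
  case True
  then show "v \<in> S0 \<Longrightarrow> C p v \<in> S0" using S0_cre[of "LC (nat (- p))" v] by (auto simp: cre_def letter_set_def)
next
  case False
  then show "v \<in> S0 \<Longrightarrow> C p v \<in> S0"
    by (auto simp: \<Omega>_C S0_\<Omega> subspaceV_zero[OF S0_sub] subspaceV_scale[OF S0_sub])
qed

lemma S0_D:
  assumes v: "v \<in> S0" and n: "n \<ge> 0" shows "D n v \<in> S0"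
proof (cases "n = 0")
  case True
  have "D 0 v \<in> S0"
  proof (rule S0_transport[OF D_lin _ _ v])
    \<comment> \<open>The witness is the charge of the letter under \<open>D 0\<close>:
      \<open>1\<close> for \<open>a\<close>, \<open>- 1\<close> for \<open>b\<close> and
      \<open>0\<close> for \<open>c\<close>.\<close>
    show "\<exists>z. D 0 (cre i u) = cre i (D 0 u) + scaleV z (cre i u)" if "i \<in> J" "u \<in> \<Omega>" for i u
      by (rule exI[of _ "case i of LA p \<Rightarrow> 1 | LB p \<Rightarrow> - 1 | LC k \<Rightarrow> 0"], cases i)
         (auto simp: cre_def D_Ah D_Bh DC scaleV_minus_left)
  qed (auto intro: G_S0 G_D0)
  then show ?thesis using True by simp
next
  case False
  then show ?thesis using S0_ann[of "LC (nat n)" v] v n by (auto simp: ann_def letter_set_def)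
qed

lemma S0_e: "v \<in> S0 \<Longrightarrow> e \<tau> r v \<in> S0"
  by (rule e_closed) (auto simp: S0_sub S0_C \<Omega>_K S0_\<Omega>)

lemma S0_A: "v \<in> S0 \<Longrightarrow> A p v \<in> S0"
  using A_undress[of p v] by (auto intro!: subspaceV_sum[OF S0_sub] S0_e S0_Ah)

lemma S0_B: "v \<in> S0 \<Longrightarrow> B p v \<in> S0"
  using B_undress[of p v] by (auto intro!: subspaceV_sum[OF S0_sub] S0_e S0_Bh)

text \<open>The negative modes of \<open>d\<close> do not commute with the creation operators in \<open>letter_set\<close>; they
  are adjoined in a second step, with the positive modes of \<open>c\<close> as annihilation operators.\<close>

sublocale outer: creation_annihilation "\<lambda>n. D (- int n)" "\<lambda>n. C (int n)" of_nat "{1..}" S0 "{v. K v = v}"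
proof
  show "C (int i) (D (- int j) u) = D (- int j) (C (int i) u) + (if i = j then scaleV (of_nat i) u else 0)"
    if "i \<in> {1..}" "j \<in> {1..}" "u \<in> {v. K v = v}" for i j u
    using that DC[of "- int j" "int i" u] by (auto simp: scaleV_minus_left)
  show "subspaceV {v. K v = v}"
    by (simp add: subspaceV_def lin_zero[OF K_lin] lin_add[OF K_lin] lin_scale[OF K_lin])
qed (auto simp: D_lin C_lin S0_sub K_simps DD \<Omega>_C \<Omega>_K S0_\<Omega> )

definition S :: "('a \<Rightarrow>\<^sub>0 complex) set" where "S = {v. \<exists>k. outer.W {1..} k v}"

lemma S_sub: "subspaceV S"
proof -
  have "\<exists>k. outer.W {1..} k (u + v)" if "outer.W {1..} k u" "outer.W {1..} l v" for u v k l
    using outer.W_add[OF outer.W_le[OF that(1) max.cobounded1] outer.W_le[OF that(2) max.cobounded2]] by blast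
  then show ?thesis
    unfolding subspaceV_def S_def using outer.W_zero outer.W_scale by blast
qed

lemma S0_S: "v \<in> S0 \<Longrightarrow> v \<in> S"
  unfolding S_def using outer.W_base by blast

lemma S_Dminus: "v \<in> S \<Longrightarrow> n \<ge> 1 \<Longrightarrow> D (- int n) v \<in> S"
  unfolding S_def using outer.W_step[of n "{1..}"] by auto

lemma S_K: "v \<in> S \<Longrightarrow> K v = v"
  unfolding S_def using outer.W_U by blast

text \<open>Moving a mode past \<open>D (- int n)\<close> produces a mode shifted by
  \<open>n\<close>, so the induction has to treat all modes at once. The scalar \<open>z\<close>
  accommodates the central term in the bracket of \<open>D\<close> with \<open>C\<close>.\<close>

lemma S_transport:
  assumes Y: "\<And>p. linear_op (Y p)" and YG: "\<And>v p. v \<in> S0 \<Longrightarrow> Y p v \<in> S"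
    and comm: "\<And>n p v. n \<ge> 1 \<Longrightarrow> K v = v \<Longrightarrow>
      \<exists>x z. Y p (D (- int n) v) = D (- int n) (Y p v) + scaleV x (Y (p - int n) v) + scaleV z v"
    and v: "v \<in> S"
  shows "Y p v \<in> S"
proof -
  obtain k where "outer.W {1..} k v" using v S_def by blast
  then show ?thesis
  proof (induction arbitrary: p rule: outer.W.induct)
    case (W_step n k v)
    have "v \<in> S" using W_step S_def by blast
    moreover obtain x z where "Y p (D (- int n) v) = D (- int n) (Y p v) + scaleV x (Y (p - int n) v) + scaleV z v"
      using comm[of n v p] W_step S_K[OF \<open>v \<in> S\<close>] by auto
    ultimately show ?case using W_step
      by (auto intro!: subspaceV_add[OF S_sub] subspaceV_scale[OF S_sub] S_Dminus)
  qed (auto simp: YG lin_add[OF Y] intro: subspaceV_add[OF S_sub])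
qed

lemma S_A: "v \<in> S \<Longrightarrow> A p v \<in> S"
proof (rule S_transport[OF A_lin])
  fix n p v
  show "\<exists>x z. A p (D (- int n) v) = D (- int n) (A p v) + scaleV x (A (p - int n) v) + scaleV z v"
    by (rule exI[of _ "-1"], rule exI[of _ 0]) (use DA[of "- int n" p v] in \<open>simp add: scaleV_minus_left\<close>)
qed (auto intro: S0_S S0_A)

lemma S_B: "v \<in> S \<Longrightarrow> B p v \<in> S"
proof (rule S_transport[OF B_lin])
  fix n p v
  show "\<exists>x z. B p (D (- int n) v) = D (- int n) (B p v) + scaleV x (B (p - int n) v) + scaleV z v"
    by (rule exI[of _ "1"], rule exI[of _ 0]) (use DB[of "- int n" p v] in \<open>simp add: scaleV_minus_left\<close>)
qed (auto intro: S0_S S0_B)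

lemma S_C: "v \<in> S \<Longrightarrow> C p v \<in> S"
proof (rule S_transport[OF C_lin])
  fix n p v assume "K v = v"
  then show "\<exists>x z. C p (D (- int n) v) = D (- int n) (C p v) + scaleV x (C (p - int n) v) + scaleV z v"
    by (intro exI[of _ "0"] exI[of _ "if - int n + p = 0 then - of_int (- int n) else 0"])
       (use DC[of "- int n" p v] in \<open>auto simp: scaleV_minus_left\<close>)
qed (auto intro: S0_S S0_C)

lemma S_D: "v \<in> S \<Longrightarrow> D p v \<in> S"
proof (cases "p < 0")
  case True
  then show "v \<in> S \<Longrightarrow> D p v \<in> S" using S_Dminus[of v "nat (- p)"] by simp
next
  case False
  assume v: "v \<in> S"
  obtain k where "outer.W {1..} k v" using v S_def by blast
  then show "D p v \<in> S"
  proof (induction rule: outer.W.induct)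
    case (W_base v k)
    then show ?case using False by (intro S0_S S0_D) auto
  next
    case (W_step n k v)
    then show ?case by (auto simp: DD[of p] intro: S_Dminus)
  qed (auto simp: lin_add[OF D_lin] intro: subspaceV_add[OF S_sub])
qed

text \<open>The positive modes of \<open>C\<close> are the annihilation operators of the outer
  stage, which puts the vector into \<open>S0\<close>. \<open>Ah p\<close> and \<open>Bh p\<close>
  are series in undressed modes of index at least \<open>p\<close>, so they vanish too and the inner
  stage applies.\<close>

lemma singular_in_G:
  assumes v: "v \<in> S" and "\<And>p. p \<ge> 0 \<Longrightarrow> A p v = 0" "\<And>p. p \<ge> 1 \<Longrightarrow> B p v = 0"
    "\<And>p. p \<ge> 1 \<Longrightarrow> C p v = 0" "\<And>p. p \<ge> 1 \<Longrightarrow> D p v = 0"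
  shows "v \<in> G"
proof -
  have "v \<in> S0" using v assms outer.killed_in_G[of _ v] unfolding S_def by auto
  moreover have "Ah p v = 0" if "p \<ge> 0" for p
    unfolding Ah_def Bh_def dress_def using that assms by (simp add: lin_zero[OF cf.newton_lin])
  moreover have "Bh p v = 0" if "p \<ge> 1" for p
    unfolding Ah_def Bh_def dress_def using that assms by (simp add: lin_zero[OF cf.newton_lin])
  ultimately have "ann i v = 0" if "i \<in> letter_set" for i
    using that assms by (cases i) (auto simp: ann_def letter_set_def)
  then show ?thesis using \<open>v \<in> S0\<close> inner.killed_in_G[of _ v] unfolding S0_def J_def by auto
qed

text \<open>The converse direction: undressing expresses a mode through dressed modes of at least
  the same index, and those kill \<open>G\<close>.\<close>

lemma G_killed:
  assumes v: "v \<in> G"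
  shows "\<forall>p\<ge>0. A p v = 0" "\<forall>p\<ge>1. B p v = 0" "\<forall>p\<ge>1. C p v = 0" "\<forall>p\<ge>1. D p v = 0"
proof -
  have "Ah p v = 0" if "p \<ge> 0" for p
    using that G_ann[OF v, of "LB (nat p)"] by (simp add: ann_def letter_set_def)
  then show "\<forall>p\<ge>0. A p v = 0"
    using A_undress[of _ v] by (metis (no_types, lifting) add_nonneg_nonneg lin_zero[OF cf.newton_lin] of_nat_0_le_iff sum.neutral)
  have "Bh p v = 0" if "p \<ge> 1" for p
    using that G_ann[OF v, of "LA (nat p)"] by (simp add: ann_def letter_set_def)
  then have "e (- 1) r (Bh (p + int r) v) = 0" if "p \<ge> 1" for p r
    using that by (simp add: lin_zero[OF cf.newton_lin])
  then show "\<forall>p\<ge>1. B p v = 0"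
    using B_undress[of _ v] by (metis (no_types, lifting) sum.neutral)
  show "\<forall>p\<ge>1. C p v = 0" using G_C[OF v] by blast
  have "D p v = 0" if "p \<ge> 1" for p
    using that G_ann[OF v, of "LC (nat p)"] by (simp add: ann_def letter_set_def)
  then show "\<forall>p\<ge>1. D p v = 0" by blast
qed

text \<open>The descent is made twice, from \<open>S\<close> to \<open>S0\<close> by the positive
  modes of \<open>C\<close> and from \<open>S0\<close> to \<open>G\<close> by \<open>ann\<close>.
  The dressed modes preserve \<open>H\<close> because on each vector they are finite sums of
  compositions of modes.\<close>

lemma submodule_meets_G:
  assumes H: "subspaceV H" and closed: "\<And>v p. v \<in> H \<Longrightarrow> A p v \<in> H" "\<And>v p. v \<in> H \<Longrightarrow> B p v \<in> H"
    "\<And>v p. v \<in> H \<Longrightarrow> C p v \<in> H" "\<And>v p. v \<in> H \<Longrightarrow> D p v \<in> H" "\<And>v. v \<in> H \<Longrightarrow> K v \<in> H"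
    and v: "v \<in> H" "v \<in> S" "v \<noteq> 0"
  shows "\<exists>u\<in>H. u \<in> G \<and> u \<noteq> 0"
proof -
  obtain k where k: "outer.W {1..} k v" using v(2) unfolding S_def by blast
  obtain u where u: "u \<in> H" "u \<in> S0" "u \<noteq> 0"
    using outer.invariant_meets_G[OF closed(3) v(1) v(3) k] by auto
  have e: "e \<tau> r w \<in> H" if "w \<in> H" for \<tau> r w
    using that by (intro e_closed H closed)
  have "Ah p w \<in> H" "Bh p w \<in> H" if "w \<in> H" for p w
  proof -
    obtain N where N: "Ah p w = (\<Sum>r<N. e (- 1) r (A (p + 1 * int r) w))"
      using dressableD[OF dressable_A] unfolding Ah_def by blast
    show "Ah p w \<in> H" unfolding N by (intro subspaceV_sum[OF H] e closed that)
    obtain N where N: "Bh p w = (\<Sum>r<N. e 1 r (B (p + 1 * int r) w))"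
      using dressableD[OF dressable_B] unfolding Bh_def by blast
    show "Bh p w \<in> H" unfolding N by (intro subspaceV_sum[OF H] e closed that)
  qed
  then have "ann i w \<in> H" if "w \<in> H" for i w
    using that closed by (cases i) (auto simp: ann_def)
  moreover obtain l where "inner.W J l u" using u(2) unfolding S0_def by blast
  ultimately show ?thesis using inner.invariant_meets_G[OF _ u(1) u(3)] by simp
qed

end

section \<open>The free field realization\<close>

definition lext :: "('i \<Rightarrow> ('j \<Rightarrow>\<^sub>0 complex)) \<Rightarrow> ('i \<Rightarrow>\<^sub>0 complex) \<Rightarrow> ('j \<Rightarrow>\<^sub>0 complex)" where
  "lext f v = (\<Sum>i\<in>Poly_Mapping.keys v. scaleV (Poly_Mapping.lookup v i) (f i))"

lemma lext_superset:
  "finite I \<Longrightarrow> Poly_Mapping.keys v \<subseteq> I \<Longrightarrow> lext f v = (\<Sum>i\<in>I. scaleV (Poly_Mapping.lookup v i) (f i))"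
  unfolding lext_def by (rule sum.mono_neutral_left) (auto simp: in_keys_iff)

lemma lext_lin: "linear_op (lext f)"
proof (rule linear_opI)
  fix u v :: "'a \<Rightarrow>\<^sub>0 complex"
  let ?I = "Poly_Mapping.keys u \<union> Poly_Mapping.keys v"
  show "lext f (u + v) = lext f u + lext f v"
    by (subst (1 2 3) lext_superset[of ?I])
       (auto simp: lookup_add scaleV_add_left sum.distrib dest: subsetD[OF Poly_Mapping.keys_add])
next
  fix z and v :: "'a \<Rightarrow>\<^sub>0 complex"
  show "lext f (scaleV z v) = scaleV z (lext f v)"
    by (subst (1 2) lext_superset[of "Poly_Mapping.keys v"])
       (auto simp: scaleV_sum_right in_keys_iff)
qed

lemma lext_single [simp]: "lext f (Poly_Mapping.single i z) = scaleV z (f i)"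
  by (subst lext_superset[of "{i}"]) auto

lemma linear_op_eqI:
  assumes "linear_op f" "linear_op h" "\<And>i. f (Poly_Mapping.single i 1) = h (Poly_Mapping.single i 1)"
  shows "f v = h v"
  by (subst (1 2) poly_mapping_expansion[of v])
     (simp add: lin_sum[OF assms(1)] lin_sum[OF assms(2)] lin_scale[OF assms(1)] lin_scale[OF assms(2)]
       assms(3) del: scaleV_single)

text \<open>Fock space: polynomials in variables indexed by \<open>osc\<close>, with multisets as monomials.\<close>

datatype osc = OA nat | OB nat | OC nat | OD nat

text \<open>Multiplication by the variable \<open>i\<close>; \<open>de i\<close> is the
  corresponding partial derivative.\<close>

definition cr :: "osc \<Rightarrow> (osc multiset \<Rightarrow>\<^sub>0 complex) \<Rightarrow> (osc multiset \<Rightarrow>\<^sub>0 complex)" where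
  "cr i = lext (\<lambda>\<mu>. Poly_Mapping.single (add_mset i \<mu>) 1)"

definition de :: "osc \<Rightarrow> (osc multiset \<Rightarrow>\<^sub>0 complex) \<Rightarrow> (osc multiset \<Rightarrow>\<^sub>0 complex)" where
  "de i = lext (\<lambda>\<mu>. Poly_Mapping.single (\<mu> - {#i#}) (of_nat (count \<mu> i)))"

definition diag :: "(osc multiset \<Rightarrow> complex) \<Rightarrow> (osc multiset \<Rightarrow>\<^sub>0 complex) \<Rightarrow> (osc multiset \<Rightarrow>\<^sub>0 complex)" where
  "diag f = lext (\<lambda>\<mu>. Poly_Mapping.single \<mu> (f \<mu>))"

lemma cr_lin: "linear_op (cr i)" and de_lin: "linear_op (de i)" and diag_lin: "linear_op (diag f)"
  unfolding cr_def de_def diag_def by (rule lext_lin)+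

lemma cr_single [simp]: "cr i (Poly_Mapping.single \<mu> z) = Poly_Mapping.single (add_mset i \<mu>) z"
  and de_single [simp]: "de i (Poly_Mapping.single \<mu> z) = Poly_Mapping.single (\<mu> - {#i#}) (z * of_nat (count \<mu> i))"
  and diag_single [simp]: "diag f (Poly_Mapping.single \<mu> z) = Poly_Mapping.single \<mu> (z * f \<mu>)"
  by (simp_all add: cr_def de_def diag_def)

lemma cr_cr: "cr i (cr j v) = cr j (cr i v)"
  by (rule linear_op_eqI[of "\<lambda>v. cr i (cr j v)" "\<lambda>v. cr j (cr i v)"])
     (simp_all add: linear_op_compose[OF cr_lin cr_lin] add_mset_commute)

lemma de_de: "de i (de j v) = de j (de i v)"
  by (rule linear_op_eqI[of "\<lambda>v. de i (de j v)" "\<lambda>v. de j (de i v)"])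
     (auto simp: linear_op_compose[OF de_lin de_lin] diff_diff_add add_mset_commute mult.commute)

lemma de_cr: "de i (cr j v) = cr j (de i v) + (if i = j then v else 0)"
proof (rule linear_op_eqI[of "\<lambda>v. de i (cr j v)" "\<lambda>v. cr j (de i v) + (if i = j then v else 0)"])
  show "linear_op (\<lambda>v. cr j (de i v) + (if i = j then v else 0))"
    by (intro linear_op_plus linear_op_compose[OF cr_lin de_lin]) (cases "i = j"; simp add: linear_op_ident linear_op_zero)
  fix \<mu>
  show "de i (cr j (Poly_Mapping.single \<mu> 1)) =
    cr j (de i (Poly_Mapping.single \<mu> 1)) + (if i = j then Poly_Mapping.single \<mu> 1 else 0)"
    by (cases "i \<in># \<mu>") (auto simp: add.commute not_in_iff lin_zero[OF cr_lin] simp flip: single_add)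
qed (rule linear_op_compose[OF de_lin cr_lin])

lemma diag_cr:
  assumes "\<And>\<mu>. f (add_mset i \<mu>) = f \<mu> + z"
  shows "diag f (cr i v) = cr i (diag f v) + scaleV z (cr i v)"
  by (rule linear_op_eqI[of "\<lambda>v. diag f (cr i v)" "\<lambda>v. cr i (diag f v) + scaleV z (cr i v)"])
     (simp_all add: linear_op_compose[OF cr_lin diag_lin] linear_op_compose[OF diag_lin cr_lin]
       linear_op_plus linear_op_scale cr_lin assms flip: single_add)

lemma diag_de:
  assumes "\<And>\<mu>. f (add_mset i \<mu>) = f \<mu> + z"
  shows "diag f (de i v) = de i (diag f v) - scaleV z (de i v)"
proof (rule linear_op_eqI[of "\<lambda>v. diag f (de i v)" "\<lambda>v. de i (diag f v) - scaleV z (de i v)"])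
  fix \<mu>
  have "f \<mu> = f (\<mu> - {#i#}) + z" if "i \<in># \<mu>"
    using assms[of "\<mu> - {#i#}"] that by simp
  then show "diag f (de i (Poly_Mapping.single \<mu> 1)) =
     de i (diag f (Poly_Mapping.single \<mu> 1)) - scaleV z (de i (Poly_Mapping.single \<mu> 1))"
    by (cases "i \<in># \<mu>") (auto simp: not_in_iff algebra_simps lin_zero[OF diag_lin] simp flip: single_diff)
qed (simp_all add: linear_op_compose[OF de_lin diag_lin] linear_op_compose[OF diag_lin de_lin]
    linear_op_minus linear_op_scale de_lin)

lemma de_eq_0:
  assumes "\<And>\<mu>. \<mu> \<in> Poly_Mapping.keys v \<Longrightarrow> i \<notin># \<mu>"
  shows "de i v = 0"
  unfolding de_def lext_def using assms by (auto intro!: sum.neutral simp: not_in_iff)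

lemma finite_support_bound: "\<exists>N. \<forall>k\<ge>N. de (OA k) v = 0 \<and> de (OB k) v = 0"
proof -
  let ?I = "\<Union>\<mu>\<in>Poly_Mapping.keys v. set_mset \<mu>"
  have "finite ?I" by simp
  then have "finite (OA -` ?I \<union> OB -` ?I)"
    by (intro finite_UnI finite_vimageI) (auto intro: injI)
  then obtain N where "OA -` ?I \<union> OB -` ?I \<subseteq> {..<N}"
    using finite_nat_iff_bounded by auto
  then have "k < N" if "OA k \<in> ?I \<or> OB k \<in> ?I" for k
    using that by blast
  then have "\<forall>k\<ge>N. de (OA k) v = 0 \<and> de (OB k) v = 0"
    by (intro allI impI conjI; intro de_eq_0) (meson UN_I linorder_not_less)+
  then show ?thesis ..
qed

text \<open>Bounds the number of nonzero terms of an exponential in the positive modes of \<open>c\<close>, which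
  act by \<open>de (OD k)\<close>.\<close>

definition dweight :: "osc multiset \<Rightarrow> nat" where
  "dweight \<mu> = sum_mset (image_mset (\<lambda>i. case i of OD k \<Rightarrow> k | _ \<Rightarrow> 0) \<mu>)"

text \<open>The bound is an integer so that it may become negative, in which case only
  \<open>0\<close> is left.\<close>

definition dbound :: "int \<Rightarrow> (osc multiset \<Rightarrow>\<^sub>0 complex) set" where
  "dbound w = {v. \<forall>\<mu>\<in>Poly_Mapping.keys v. int (dweight \<mu>) \<le> w}"

lemma dbound_sub: "subspaceV (dbound w)"
  unfolding subspaceV_def dbound_def
  by (auto simp: in_keys_iff dest!: subsetD[OF Poly_Mapping.keys_add])

lemma dbound_exists: "\<exists>w. v \<in> dbound w"
proof -
  let ?w = "Max (insert 0 ((\<lambda>\<mu>. int (dweight \<mu>)) ` Poly_Mapping.keys v))"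
  have "v \<in> dbound ?w" unfolding dbound_def by (auto intro!: Max_ge)
  then show ?thesis ..
qed

lemma dbound_neg: "v \<in> dbound w \<Longrightarrow> w < 0 \<Longrightarrow> v = 0"
  unfolding dbound_def by (auto simp flip: keys_eq_empty)

lemma de_dbound: "v \<in> dbound w \<Longrightarrow> de (OD k) v \<in> dbound (w - int k)"
  unfolding de_def lext_def
proof (rule subspaceV_sum[OF dbound_sub])
  fix \<mu> assume *: "v \<in> dbound w" "\<mu> \<in> Poly_Mapping.keys v"
  have "int (dweight (\<mu> - {#OD k#})) \<le> w - int k" if "OD k \<in># \<mu>"
  proof -
    have "dweight \<mu> = dweight (add_mset (OD k) (\<mu> - {#OD k#}))" using that by simp
    also have "\<dots> = k + dweight (\<mu> - {#OD k#})" unfolding dweight_def by simp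
    finally show ?thesis using * by (auto simp: dbound_def)
  qed
  then show "scaleV (Poly_Mapping.lookup v \<mu>) (Poly_Mapping.single (\<mu> - {#OD k#}) (of_nat (count \<mu> (OD k)))) \<in> dbound (w - int k)"
    by (auto simp: dbound_def split: if_splits)
qed

locale free_field =
  fixes \<kappa> \<delta> :: complex and fl :: bool
begin

text \<open>\<open>[Ao p, Bt (- p)] = \<kappa> + p\<close>; if this is \<open>0\<close>, the creation operator of the pair may be
  replaced by \<open>0\<close>, which is what the flag \<open>fl\<close> does.\<close>

definition w :: "int \<Rightarrow> complex" where
  "w p = (if fl \<and> \<kappa> + of_int p = 0 then 0 else 1)"

definition Ao :: "int \<Rightarrow> (osc multiset \<Rightarrow>\<^sub>0 complex) \<Rightarrow> (osc multiset \<Rightarrow>\<^sub>0 complex)" where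
  "Ao p = (if p \<ge> 0 then (\<lambda>v. scaleV (\<kappa> + of_int p) (de (OB (nat p)) v))
     else (\<lambda>v. scaleV (w p) (cr (OA (nat (- p))) v)))"

definition Bt :: "int \<Rightarrow> (osc multiset \<Rightarrow>\<^sub>0 complex) \<Rightarrow> (osc multiset \<Rightarrow>\<^sub>0 complex)" where
  "Bt p = (if p \<le> 0 then (\<lambda>v. scaleV (w (- p)) (cr (OB (nat (- p))) v))
     else (\<lambda>v. scaleV (of_int p - \<kappa>) (de (OA (nat p)) v)))"

text \<open>The modes of \<open>c\<close> and \<open>d\<close> are two families of conjugate
  variables: \<open>OC\<close> carries the creation operators of \<open>c\<close> and the
  annihilation operators of \<open>d\<close>, and \<open>OD\<close> the reverse.\<close>

definition Ct :: "int \<Rightarrow> (osc multiset \<Rightarrow>\<^sub>0 complex) \<Rightarrow> (osc multiset \<Rightarrow>\<^sub>0 complex)" where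
  "Ct n = (if n = 0 then scaleV \<kappa> else if n > 0 then (\<lambda>v. scaleV (of_int n) (de (OD (nat n)) v))
     else cr (OC (nat (- n))))"

definition charge :: "osc multiset \<Rightarrow> complex" where
  "charge \<mu> = \<delta> + sum_mset (image_mset (\<lambda>i. case i of OA p \<Rightarrow> 1 | OB p \<Rightarrow> - 1 | _ \<Rightarrow> 0) \<mu>)"

definition Dt :: "int \<Rightarrow> (osc multiset \<Rightarrow>\<^sub>0 complex) \<Rightarrow> (osc multiset \<Rightarrow>\<^sub>0 complex)" where
  "Dt n = (if n = 0 then diag charge else if n > 0 then (\<lambda>v. scaleV (of_int n) (de (OC (nat n)) v))
     else cr (OD (nat (- n))))"

lemma Ao_lin: "linear_op (Ao p)" and Bt_lin: "linear_op (Bt p)"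
  and Ct_lin: "linear_op (Ct p)" and Dt_lin: "linear_op (Dt p)"
  by (auto simp: Ao_def Bt_def Ct_def Dt_def cr_lin de_lin diag_lin intro!: linear_op_scale linear_op_ident)

lemmas osc_defs = Ao_def Bt_def Ct_def Dt_def
lemmas osc_simps = cr_cr de_de de_cr lin_scale[OF cr_lin] lin_scale[OF de_lin] mult.commute

section \<open>Commutation relations of the oscillators before dressing\<close>

lemma Ao_Ao: "Ao p (Ao q v) = Ao q (Ao p v)" and Bt_Bt: "Bt p (Bt q v) = Bt q (Bt p v)"
  and Ct_Ct: "Ct p (Ct q v) = Ct q (Ct p v)"
  and Ct_Ao: "Ct p (Ao q v) = Ao q (Ct p v)" and Ct_Bt: "Ct p (Bt q v) = Bt q (Ct p v)"
  by (simp_all add: osc_defs osc_simps)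

lemma diag_charge:
  "diag charge (cr (OA p) v) = cr (OA p) (diag charge v) + cr (OA p) v"
  "diag charge (cr (OB p) v) = cr (OB p) (diag charge v) - cr (OB p) v"
  "diag charge (cr (OC p) v) = cr (OC p) (diag charge v)"
  "diag charge (cr (OD p) v) = cr (OD p) (diag charge v)"
  "diag charge (de (OA p) v) = de (OA p) (diag charge v) - de (OA p) v"
  "diag charge (de (OB p) v) = de (OB p) (diag charge v) + de (OB p) v"
  "diag charge (de (OC p) v) = de (OC p) (diag charge v)"
  "diag charge (de (OD p) v) = de (OD p) (diag charge v)"
  using diag_cr[of charge "OA p" 1 v] diag_cr[of charge "OB p" "- 1" v] diag_cr[of charge "OC p" 0 v]
    diag_cr[of charge "OD p" 0 v] diag_de[of charge "OA p" 1 v] diag_de[of charge "OB p" "- 1" v]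
    diag_de[of charge "OC p" 0 v] diag_de[of charge "OD p" 0 v]
  by (simp_all add: charge_def scaleV_minus_left)

lemma Dt_Dt: "Dt p (Dt q v) = Dt q (Dt p v)"
  by (simp add: Dt_def osc_simps diag_charge lin_scale[OF diag_lin])

lemma Dt_Ct: "Dt p (Ct q v) = Ct q (Dt p v) + (if p + q = 0 then scaleV (of_int p) v else 0)"
proof (cases "p + q = 0")
  case True
  then have "q = - p" by simp
  then show ?thesis
    by (auto simp: Dt_def Ct_def osc_simps diag_charge scaleV_add_right scaleV_minus_left
        lin_scale[OF diag_lin] lin_minus[OF cr_lin])
next
  case False
  then show ?thesis by (auto simp: Dt_def Ct_def osc_simps diag_charge lin_scale[OF diag_lin])
qed

lemma Dt_Ao: "Dt n (Ao p v) = Ao p (Dt n v) + scaleV (if n = 0 then 1 else 0) (Ao (p + n) v)"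
  by (auto simp: Dt_def Ao_def osc_simps diag_charge lin_scale[OF diag_lin] scaleV_add_right)

lemma Dt_Bt: "Dt n (Bt p v) = Bt p (Dt n v) + scaleV (if n = 0 then - 1 else 0) (Bt (p + n) v)"
  by (auto simp: Dt_def Bt_def osc_simps diag_charge lin_scale[OF diag_lin] scaleV_diff_right scaleV_minus_left)

lemma Ao_Bt: "Ao p (Bt q v) = Bt q (Ao p v) + scaleV (if p + q = 0 then \<kappa> else 0) v +
   (if p + q = 0 then scaleV (of_int p) v else 0)"
proof (cases "p + q = 0")
  case True
  then have q: "q = - p" by simp
  \<comment> \<open>Where the flag makes \<open>w p\<close> vanish, the commutator is
    \<open>0\<close> anyway.\<close>
  have w: "(\<kappa> + of_int p) * w p = \<kappa> + of_int p" by (auto simp: w_def)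
  have "Ao p (Bt q v) = Bt q (Ao p v) + scaleV (\<kappa> + of_int p) v"
  proof (cases "p \<ge> 0")
    case True
    then show ?thesis using w by (auto simp: q Ao_def Bt_def osc_simps scaleV_add_right)
  next
    case False
    have "w p * (of_int (- p) - \<kappa>) = - (\<kappa> + of_int p)" using w by (simp add: algebra_simps)
    then show ?thesis using False
      by (simp add: q Ao_def Bt_def osc_simps scaleV_add_right mult.commute[of _ "w p"]
          flip: scaleV_add_left)
  qed
  then show ?thesis using True by (simp add: scaleV_add_left add.assoc)
next
  case False
  then show ?thesis by (auto simp: Ao_def Bt_def osc_simps)
qed

text \<open>The modes of \<open>a\<close> and \<open>b\<close> are obtained from \<open>Ao\<close> and \<open>Bt\<close> by multiplication with
  \<open>exp (\<plusminus> \<Sum>\<^sub>k c(-k) z\<^sup>k / k)\<close>, the sum being over all \<open>k \<noteq> 0\<close>; each half of the exponential is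
  locally finite.\<close>

sublocale neg: commuting_family "\<lambda>k. Ct (- int k)" "\<lambda>v. v"
  by standard (auto simp: Ct_lin Ct_Ct linear_op_ident)

sublocale pos: commuting_family "\<lambda>k. Ct (int k)" "\<lambda>v. v"
  by standard (auto simp: Ct_lin Ct_Ct linear_op_ident)

lemma oscillators_smooth: "\<exists>N. \<forall>p\<ge>N. Ao p v = 0 \<and> Bt p v = 0"
proof -
  obtain N where N: "\<And>k. k \<ge> N \<Longrightarrow> de (OA k) v = 0 \<and> de (OB k) v = 0"
    using finite_support_bound by blast
  then show ?thesis
    by (intro exI[of _ "int N + 1"]) (auto simp: Ao_def Bt_def)
qed

lemma dressable_neg: "dressable (neg.e \<tau>) 1 Ao" "dressable (neg.e \<tau>) 1 Bt"
proof -
  have "\<exists>N. \<forall>r\<ge>N. Ao (p + int r) v = 0 \<and> Bt (p + int r) v = 0" for p v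
  proof -
    obtain N where N: "\<And>q. q \<ge> N \<Longrightarrow> Ao q v = 0 \<and> Bt q v = 0" using oscillators_smooth by blast
    then show ?thesis by (intro exI[of _ "nat (N - p)"]) (auto intro!: N)
  qed
  then show "dressable (neg.e \<tau>) 1 Ao" "dressable (neg.e \<tau>) 1 Bt"
    unfolding dressable_def by (metis mult_1 lin_zero[OF neg.newton_lin])+
qed

definition A1 where "A1 = dress (neg.e 1) 1 Ao"
definition B1 where "B1 = dress (neg.e (- 1)) 1 Bt"

lemma A1_lin: "linear_op (A1 p)" and B1_lin: "linear_op (B1 p)"
  unfolding A1_def B1_def by (intro dress_lin neg.newton_lin Ao_lin Bt_lin dressable_neg)+

lemma neg_comm:
  "Ao p (neg.e \<tau> r v) = neg.e \<tau> r (Ao p v)" "Bt p (neg.e \<tau> r v) = neg.e \<tau> r (Bt p v)"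
  "Ct p (neg.e \<tau> r v) = neg.e \<tau> r (Ct p v)"
  by (rule neg.newton_commute; simp add: Ao_lin Bt_lin Ct_lin Ct_Ao Ct_Bt Ct_Ct)+

lemma Ct_A1: "Ct p (A1 q v) = A1 q (Ct p v)" and Ct_B1: "Ct p (B1 q v) = B1 q (Ct p v)"
  unfolding A1_def B1_def by (rule dress_commute; simp add: Ct_lin neg_comm Ct_Ao Ct_Bt dressable_neg)+

lemma A1_A1: "A1 p (A1 q v) = A1 q (A1 p v)"
  unfolding A1_def by (rule dress_dress_commute)
     (simp_all add: Ao_lin neg.newton_lin dressable_neg neg_comm neg.newton_newton[of 1 _ 1] Ao_Ao)

lemma B1_B1: "B1 p (B1 q v) = B1 q (B1 p v)"
  unfolding B1_def by (rule dress_dress_commute)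
     (simp_all add: Bt_lin neg.newton_lin dressable_neg neg_comm neg.newton_newton[of "-1" _ "-1"] Bt_Bt)

text \<open>The logarithmic derivative creates the negative half of \<open>[a, b] = c\<close> out of
  oscillators whose commutators are scalars; \<open>\<kappa>\<close> is the zero mode.\<close>

lemma A1_B1: "A1 p (B1 q v) = B1 q (A1 p v) +
   ((if p + q = 0 then scaleV \<kappa> v else 0) + (if p + q < 0 then Ct (p + q) v else 0)) +
   (if p + q = 0 then scaleV (of_int p) v else 0)"
proof -
  have "A1 p (B1 q v) = B1 q (A1 p v) + scaleV (if p + q = 0 then \<kappa> else 0) v +
      (if p + q = 0 then scaleV (of_int p) v else 0) +
      (if 1 * (p + q) < 0 then scaleV (of_int 1 * 1) (Ct (- int (nat (- 1 * (p + q)))) v) else 0)"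
    unfolding A1_def B1_def
    by (rule neg.dress_commutator)
       (simp_all add: Ao_lin Bt_lin Ct_Ao Ct_Bt dressable_neg Ao_Bt)
  then show ?thesis by (auto simp: add.commute[of q p])
qed

lemma Dt_A1: "Dt n (A1 p v) = A1 p (Dt n v) + scaleV (if n \<ge> 0 then 1 else 0) (A1 (p + n) v)"
proof -
  have "Dt n (A1 p v) = A1 p (Dt n v) +
      scaleV ((if n = 0 then 1 else 0) + (if 1 * n > 0 then of_int 1 * 1 else 0)) (A1 (p + n) v)"
    unfolding A1_def by (rule neg.dress_derivation)
       (auto simp: Ao_lin Dt_lin dressable_neg Dt_Ct Dt_Ao)
  then show ?thesis by (auto split: if_splits)
qed

lemma Dt_B1: "Dt n (B1 p v) = B1 p (Dt n v) + scaleV (if n \<ge> 0 then - 1 else 0) (B1 (p + n) v)"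
proof -
  have "Dt n (B1 p v) = B1 p (Dt n v) +
      scaleV ((if n = 0 then - 1 else 0) + (if 1 * n > 0 then of_int 1 * - 1 else 0)) (B1 (p + n) v)"
    unfolding B1_def by (rule neg.dress_derivation)
       (auto simp: Bt_lin Dt_lin dressable_neg Dt_Ct Dt_Bt)
  then show ?thesis by (auto split: if_splits)
qed

section \<open>Local finiteness of the positive half of the exponential\<close>

lemma pos_dbound: "v \<in> dbound b \<Longrightarrow> pos.e \<tau> r v \<in> dbound (b - int r)"
proof (induction r arbitrary: b v rule: less_induct)
  case (less r)
  show ?case
  proof (cases r)
    case (Suc s)
    have "Ct (int (Suc k)) (pos.e \<tau> (s - k) v) \<in> dbound (b - int (Suc s))" if "k < Suc s" for k
    proof -
      have "de (OD (Suc k)) (pos.e \<tau> (s - k) v) \<in> dbound (b - int (s - k) - int (Suc k))"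
        using that Suc by (intro de_dbound less) auto
      moreover have "b - int (s - k) - int (Suc k) = b - int (Suc s)" using that by auto
      moreover have "Ct (int (Suc k)) = (\<lambda>v. scaleV (of_int (int (Suc k))) (de (OD (Suc k)) v))"
        unfolding Ct_def by (simp del: of_nat_Suc)
      ultimately show ?thesis by (metis subspaceV_scale[OF dbound_sub])
    qed
    then show ?thesis
      unfolding Suc newton.simps(2)
      by (intro subspaceV_scale[OF dbound_sub] subspaceV_sum[OF dbound_sub]) auto
  qed (use less in simp)
qed

lemma pos_nilpotent: "\<exists>N. \<forall>r\<ge>N. pos.e \<tau> r v = 0"
proof -
  obtain b where b: "v \<in> dbound b" using dbound_exists by blast
  show ?thesis
    by (rule exI[of _ "nat (b + 1)"]) (auto intro!: dbound_neg[OF pos_dbound[OF b]])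
qed

lemma pos_comm: "A1 p (pos.e \<tau> r v) = pos.e \<tau> r (A1 p v)" "B1 p (pos.e \<tau> r v) = pos.e \<tau> r (B1 p v)"
  "Ct p (pos.e \<tau> r v) = pos.e \<tau> r (Ct p v)"
  by (rule pos.newton_commute; simp add: A1_lin B1_lin Ct_lin Ct_A1 Ct_B1 Ct_Ct)+

lemma dressable_pos: "dressable (pos.e \<tau>) (- 1) A1" "dressable (pos.e \<tau>) (- 1) B1"
  using pos_nilpotent unfolding dressable_def
  by (metis pos_comm lin_zero[OF A1_lin] lin_zero[OF B1_lin])+

text \<open>The positive half runs in powers of \<open>1 / z\<close>, that is
  \<open>\<epsilon> = - 1\<close>, so its parameters have the opposite sign: in both halves
  \<open>\<epsilon> \<tau>\<close> is \<open>1\<close> for \<open>a\<close> and \<open>- 1\<close>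
  for \<open>b\<close>, the coefficients in \<open>[d, a] = a\<close> and
  \<open>[d, b] = - b\<close>.\<close>

definition A2 where "A2 = dress (pos.e (- 1)) (- 1) A1"
definition B2 where "B2 = dress (pos.e 1) (- 1) B1"

lemma A2_lin: "linear_op (A2 p)" and B2_lin: "linear_op (B2 p)"
  unfolding A2_def B2_def by (intro dress_lin pos.newton_lin A1_lin B1_lin dressable_pos)+

lemma Ct_A2: "Ct p (A2 q v) = A2 q (Ct p v)" and Ct_B2: "Ct p (B2 q v) = B2 q (Ct p v)"
  unfolding A2_def B2_def by (rule dress_commute; simp add: Ct_lin pos_comm Ct_A1 Ct_B1 dressable_pos)+

lemma A2_A2: "A2 p (A2 q v) = A2 q (A2 p v)"
  unfolding A2_def by (rule dress_dress_commute)
     (simp_all add: A1_lin pos.newton_lin dressable_pos pos_comm pos.newton_newton[of "-1" _ "-1"] A1_A1)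

lemma B2_B2: "B2 p (B2 q v) = B2 q (B2 p v)"
  unfolding B2_def by (rule dress_dress_commute)
     (simp_all add: B1_lin pos.newton_lin dressable_pos pos_comm pos.newton_newton[of 1 _ 1] B1_B1)

lemma A2_B2: "A2 p (B2 q v) = B2 q (A2 p v) + Ct (p + q) v + (if p + q = 0 then scaleV (of_int p) v else 0)"
proof -
  have "A2 p (dress (pos.e (- (- 1))) (- 1) B1 q v) = dress (pos.e (- (- 1))) (- 1) B1 q (A2 p v) +
      ((if p + q = 0 then scaleV \<kappa> v else 0) + (if p + q < 0 then Ct (p + q) v else 0)) +
      (if p + q = 0 then scaleV (of_int p) v else 0) +
      (if - 1 * (p + q) < 0 then scaleV (of_int (- 1) * - 1) (Ct (int (nat (- (- 1) * (p + q)))) v) else 0)"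
    unfolding A2_def
    by (rule pos.dress_commutator)
       (simp_all add: A1_lin B1_lin Ct_A1 Ct_B1 dressable_pos A1_B1)
  then show ?thesis unfolding minus_minus B2_def[symmetric] by (auto simp: Ct_def)
qed

lemma Dt_A2: "Dt n (A2 p v) = A2 p (Dt n v) + A2 (p + n) v"
proof -
  have "Dt n (A2 p v) = A2 p (Dt n v) +
      scaleV ((if n \<ge> 0 then 1 else 0) + (if - 1 * n > 0 then of_int (- 1) * - 1 else 0)) (A2 (p + n) v)"
    unfolding A2_def by (rule pos.dress_derivation)
       (auto simp: A1_lin Dt_lin dressable_pos Dt_Ct Dt_A1)
  then show ?thesis by (auto split: if_splits)
qed

lemma Dt_B2: "Dt n (B2 p v) = B2 p (Dt n v) - B2 (p + n) v"
proof -
  have "Dt n (B2 p v) = B2 p (Dt n v) +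
      scaleV ((if n \<ge> 0 then - 1 else 0) + (if - 1 * n > 0 then of_int (- 1) * 1 else 0)) (B2 (p + n) v)"
    unfolding B2_def by (rule pos.dress_derivation)
       (auto simp: B1_lin Dt_lin dressable_pos Dt_Ct Dt_B1)
  then show ?thesis by (auto simp: scaleV_minus_left split: if_splits)
qed

lemma A1_zero: "(\<And>q. q \<ge> p \<Longrightarrow> Ao q v = 0) \<Longrightarrow> A1 p v = 0"
  and B1_zero: "(\<And>q. q \<ge> p \<Longrightarrow> Bt q v = 0) \<Longrightarrow> B1 p v = 0"
  unfolding A1_def B1_def dress_def by (simp_all add: lin_zero[OF neg.newton_lin])

text \<open>The positive half lowers mode indices, but on a given vector by less than
  \<open>R1\<close> or \<open>R2\<close>, so a large enough index stays above
  \<open>M\<close>.\<close>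

lemma A2_B2_smooth: "\<exists>N. \<forall>p\<ge>N. A2 p v = 0 \<and> B2 p v = 0"
proof -
  obtain M where M: "\<And>p. p \<ge> M \<Longrightarrow> Ao p v = 0 \<and> Bt p v = 0" using oscillators_smooth by blast
  obtain R1 where R1: "\<And>r. r \<ge> R1 \<Longrightarrow> pos.e (- 1) r v = 0" using pos_nilpotent by blast
  obtain R2 where R2: "\<And>r. r \<ge> R2 \<Longrightarrow> pos.e 1 r v = 0" using pos_nilpotent by blast
  have "A2 p v = 0 \<and> B2 p v = 0" if p: "p \<ge> M + int R1 + int R2" for p
  proof -
    have "pos.e (- 1) r (A1 (p + - 1 * int r) v) = 0" for r
    proof (cases "r \<ge> R1")
      case True
      then show ?thesis by (simp add: R1 lin_zero[OF A1_lin] flip: pos_comm)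
    next
      case False
      then have "A1 (p + - 1 * int r) v = 0" using p by (intro A1_zero) (auto intro!: conjunct1[OF M])
      then show ?thesis by (simp add: lin_zero[OF pos.newton_lin])
    qed
    moreover have "pos.e 1 r (B1 (p + - 1 * int r) v) = 0" for r
    proof (cases "r \<ge> R2")
      case True
      then show ?thesis by (simp add: R2 lin_zero[OF B1_lin] flip: pos_comm)
    next
      case False
      then have "B1 (p + - 1 * int r) v = 0" using p by (intro B1_zero) (auto intro!: conjunct2[OF M])
      then show ?thesis by (simp add: lin_zero[OF pos.newton_lin])
    qed
    ultimately show ?thesis unfolding A2_def B2_def dress_def by simp
  qed
  then show ?thesis by blast
qed

sublocale mod: smooth_module A2 B2 Ct Dt "\<lambda>v. v"
  by standard (simp_all add: A2_lin B2_lin Ct_lin Dt_lin linear_op_ident A2_A2 B2_B2 Ct_Ct Dt_Dt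
      Ct_A2 Ct_B2 Dt_A2 Dt_B2 Dt_Ct A2_B2 A2_B2_smooth add.commute)

section \<open>The vacuum vector and the dressed modes on it\<close>

definition vac :: "osc multiset \<Rightarrow>\<^sub>0 complex" where "vac = Poly_Mapping.single {#} 1"

lemma Ao_vac: "p \<ge> 0 \<Longrightarrow> Ao p vac = 0" and Bt_vac: "p \<ge> 1 \<Longrightarrow> Bt p vac = 0"
  and Ct_vac: "p \<ge> 1 \<Longrightarrow> Ct p vac = 0" and Dt_vac: "p \<ge> 1 \<Longrightarrow> Dt p vac = 0"
  and Ct_0_vac: "Ct 0 vac = scaleV \<kappa> vac" and Dt_0_vac: "Dt 0 vac = scaleV \<delta> vac"
  by (simp_all add: Ao_def Bt_def Ct_def Dt_def vac_def charge_def del: single_one)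

lemma pos_trivial:
  assumes "\<And>k. k \<ge> 1 \<Longrightarrow> Ct k v = 0"
  shows "pos.e \<tau> r v = (if r = 0 then v else 0)"
proof (cases r)
  case (Suc s)
  have "Ct (int (Suc k)) (pos.e \<tau> (s - k) v) = 0" for k
    by (simp only: pos_comm) (simp add: assms lin_zero[OF pos.newton_lin])
  then show ?thesis by (simp add: Suc newton.simps(2) del: sum.lessThan_Suc of_nat_Suc)
qed simp

lemma A2_eq_A1: "(\<And>k. k \<ge> 1 \<Longrightarrow> Ct k v = 0) \<Longrightarrow> A2 p v = A1 p v"
  and B2_eq_B1: "(\<And>k. k \<ge> 1 \<Longrightarrow> Ct k v = 0) \<Longrightarrow> B2 p v = B1 p v"
proof -
  assume *: "\<And>k. k \<ge> 1 \<Longrightarrow> Ct k v = 0"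
  have "pos.e \<tau> r (A1 (p + - 1 * int r) v) = (if r = 0 then A1 p v else 0)" for r \<tau>
    using pos_comm[of "p + - 1 * int r" \<tau> r v] by (cases "r = 0") (simp_all add: pos_trivial[OF *] lin_zero[OF A1_lin])
  then show "A2 p v = A1 p v" by (simp add: A2_def dress_def)
  have "pos.e \<tau> r (B1 (p + - 1 * int r) v) = (if r = 0 then B1 p v else 0)" for r \<tau>
    using pos_comm[of "p + - 1 * int r" \<tau> r v] by (cases "r = 0") (simp_all add: pos_trivial[OF *] lin_zero[OF B1_lin])
  then show "B2 p v = B1 p v" by (simp add: B2_def dress_def)
qed

lemma A2_vac: "p \<ge> 0 \<Longrightarrow> A2 p vac = 0" and B2_vac: "p \<ge> 1 \<Longrightarrow> B2 p vac = 0"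
  by (simp_all add: A2_eq_A1 B2_eq_B1 Ct_vac A1_zero B1_zero Ao_vac Bt_vac)

text \<open>Where the positive modes of \<open>Ct\<close> vanish, the positive half of the
  exponential is trivial, and dressing with parameter \<open>- 1\<close> inverts the negative half
  that defines \<open>A1\<close>. So the dressed modes are the original oscillators.\<close>

lemma Ah_eq_Ao:
  assumes "\<And>k. k \<ge> 1 \<Longrightarrow> Ct k v = 0"
  shows "mod.Ah p v = Ao p v"
proof -
  obtain N1 where N1: "\<And>M. M \<ge> N1 \<Longrightarrow> mod.Ah p v = (\<Sum>r<M. neg.e (- 1) r (A2 (p + 1 * int r) v))"
    using dressableD[OF mod.dressable_A] unfolding mod.Ah_def by blast
  have "\<exists>N. \<forall>p\<ge>N. Ao p v = 0" using oscillators_smooth[of v] by blast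
  then obtain N2 where N2: "\<And>N. N \<ge> N2 \<Longrightarrow>
      (\<Sum>r<N. neg.e (- 1) r (dress (neg.e (- (- 1))) 1 Ao (p + int r) v)) = Ao p v"
    using neg.undress[of Ao v "- 1" p] by blast
  show ?thesis
    using N1[of "max N1 N2"] N2[of "max N1 N2"] by (simp add: A2_eq_A1[OF assms] A1_def)
qed

lemma Bh_eq_Bt:
  assumes "\<And>k. k \<ge> 1 \<Longrightarrow> Ct k v = 0"
  shows "mod.Bh p v = Bt p v"
proof -
  obtain N1 where N1: "\<And>M. M \<ge> N1 \<Longrightarrow> mod.Bh p v = (\<Sum>r<M. neg.e 1 r (B2 (p + 1 * int r) v))"
    using dressableD[OF mod.dressable_B] unfolding mod.Bh_def by blast
  have "\<exists>N. \<forall>p\<ge>N. Bt p v = 0" using oscillators_smooth[of v] by blast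
  then obtain N2 where N2: "\<And>N. N \<ge> N2 \<Longrightarrow>
      (\<Sum>r<N. neg.e 1 r (dress (neg.e (- 1)) 1 Bt (p + int r) v)) = Bt p v"
    using neg.undress[of Bt v 1 p] by blast
  show ?thesis
    using N1[of "max N1 N2"] N2[of "max N1 N2"] by (simp add: B2_eq_B1[OF assms] B1_def)
qed

lemma Ah_power_vac: "(mod.Ah p ^^ k) vac = (Ao p ^^ k) vac"
  and Bh_power_vac: "(mod.Bh p ^^ k) vac = (Bt p ^^ k) vac"
proof -
  have a: "Ct j ((Ao p ^^ k) vac) = 0" if "j \<ge> 1" for j k
    using that by (induction k) (simp_all add: Ct_vac Ct_Ao lin_zero[OF Ao_lin])
  have b: "Ct j ((Bt p ^^ k) vac) = 0" if "j \<ge> 1" for j k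
    using that by (induction k) (simp_all add: Ct_vac Ct_Bt lin_zero[OF Bt_lin])
  show "(mod.Ah p ^^ k) vac = (Ao p ^^ k) vac" by (induction k) (simp_all add: Ah_eq_Ao a)
  show "(mod.Bh p ^^ k) vac = (Bt p ^^ k) vac" by (induction k) (simp_all add: Bh_eq_Bt b)
qed

text \<open>With the flag off all \<open>w\<close> are \<open>1\<close> and the powers are distinct
  monomials; with the flag on, \<open>w\<close> vanishes exactly for a degenerate pair.\<close>

lemma Ao_power_vac: "n \<ge> 1 \<Longrightarrow> (Ao (- int n) ^^ k) vac =
    Poly_Mapping.single (replicate_mset k (OA n)) (w (- int n) ^ k)"
  by (induction k) (simp_all add: vac_def Ao_def)

lemma Bt_power_vac: "(Bt (- int n) ^^ k) vac =
    Poly_Mapping.single (replicate_mset k (OB n)) (w (int n) ^ k)"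
  by (induction k) (simp_all add: vac_def Bt_def)

end

section \<open>Powers of a creation operator\<close>

locale hw_vector = smooth_module +
  fixes \<kappa> \<delta> :: complex and vac
  assumes K_vac: "K vac = vac"
    and A_vac: "p \<ge> 0 \<Longrightarrow> A p vac = 0" and B_vac: "p \<ge> 1 \<Longrightarrow> B p vac = 0"
    and C_vac: "p \<ge> 1 \<Longrightarrow> C p vac = 0" and D_vac: "p \<ge> 1 \<Longrightarrow> D p vac = 0"
    and C_0_vac: "C 0 vac = scaleV \<kappa> vac" and D_0_vac: "D 0 vac = scaleV \<delta> vac"
begin

lemma Ah_zero: "(\<And>q. q \<ge> p \<Longrightarrow> A q v = 0) \<Longrightarrow> Ah p v = 0"
  and Bh_zero: "(\<And>q. q \<ge> p \<Longrightarrow> B q v = 0) \<Longrightarrow> Bh p v = 0"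
  unfolding Ah_def Bh_def dress_def by (simp_all add: lin_zero[OF cf.newton_lin])

lemma ann_vac: "i \<in> letter_set \<Longrightarrow> ann i vac = 0"
  by (cases i) (auto simp: ann_def letter_set_def D_vac intro!: Ah_zero Bh_zero A_vac B_vac)

text \<open>Covers two situations: no letter has weight \<open>0\<close>, or such a letter kills the
  vector, as \<open>LB 0\<close> does in the module with \<open>\<epsilon> = 0\<close>.\<close>

lemma hw_module_line:
  assumes "\<And>i. i \<in> letter_set \<Longrightarrow> wt \<kappa> i = 0 \<Longrightarrow> cre i vac = 0"
  shows "hw_module A B C D K \<kappa> (range (\<lambda>z. scaleV z vac))"
proof
  show "subspaceV (range (\<lambda>z. scaleV z vac))"
    unfolding subspaceV_def
    by (auto simp: image_iff simp flip: scaleV_add_left intro: exI[of _ 0])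
qed (auto simp: lin_scale[OF K_lin] lin_scale[OF C_lin] lin_scale[OF ann_lin] lin_scale[OF cre_lin]
    lin_scale[OF D_lin] K_vac C_0_vac C_vac ann_vac assms D_0_vac mult.commute image_iff
    intro: exI[of _ 0])

definition powspan :: "(('a \<Rightarrow>\<^sub>0 complex) \<Rightarrow> ('a \<Rightarrow>\<^sub>0 complex)) \<Rightarrow> ('a \<Rightarrow>\<^sub>0 complex) set" where
  "powspan Y = {\<Sum>k<N. scaleV (f k) ((Y ^^ k) vac) | N f. True}"

lemma powspanI: "(\<Sum>k<N. scaleV (f k) ((Y ^^ k) vac)) \<in> powspan Y"
  unfolding powspan_def by blast

lemma powspan_sub: "subspaceV (powspan Y)"
  unfolding subspaceV_def
proof (intro conjI ballI allI)
  show "0 \<in> powspan Y" using powspanI[of "\<lambda>k. 0" Y 0] by simp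
next
  fix u v assume "u \<in> powspan Y" "v \<in> powspan Y"
  then obtain N f N' f' where uv: "u = (\<Sum>k<N. scaleV (f k) ((Y ^^ k) vac))"
    "v = (\<Sum>k<N'. scaleV (f' k) ((Y ^^ k) vac))" unfolding powspan_def by blast
  have "(\<Sum>k<N. scaleV (f k) ((Y ^^ k) vac)) =
      (\<Sum>k<max N N'. scaleV (if k < N then f k else 0) ((Y ^^ k) vac))" for N N' and f :: "nat \<Rightarrow> complex"
    by (rule sum.mono_neutral_cong_left) auto
  from this[of f N N'] this[of f' N' N] have *: "u + v = (\<Sum>k<max N N'.
      scaleV ((if k < N then f k else 0) + (if k < N' then f' k else 0)) ((Y ^^ k) vac))"
    by (simp add: uv max.commute[of N' N] scaleV_add_left sum.distrib)
  show "u + v \<in> powspan Y" unfolding * by (rule powspanI)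
next
  fix z v assume "v \<in> powspan Y"
  then obtain N f where "v = (\<Sum>k<N. scaleV (f k) ((Y ^^ k) vac))" unfolding powspan_def by blast
  then have *: "scaleV z v = (\<Sum>k<N. scaleV (z * f k) ((Y ^^ k) vac))" by (simp add: scaleV_sum_right)
  show "scaleV z v \<in> powspan Y" unfolding * by (rule powspanI)
qed

lemma powspan_invariant:
  assumes S: "subspaceV S" and T: "linear_op T" and "\<And>k. T ((Y ^^ k) vac) \<in> S" and v: "v \<in> powspan Y"
  shows "T v \<in> S"
  using v unfolding powspan_def
  by (auto simp: lin_sum[OF T] lin_scale[OF T] intro!: subspaceV_sum[OF S] subspaceV_scale[OF S] assms)

text \<open>A creation operator of weight \<open>0\<close> commutes on \<open>\<Omega>\<close> with
  all annihilation operators, its own partner included, so its powers applied to \<open>vac\<close>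
  are again vacua.\<close>

lemma hw_module_powspan:
  assumes i0: "i0 \<in> letter_set" "wt \<kappa> i0 = 0" and uniq: "\<And>i. i \<in> letter_set \<Longrightarrow> wt \<kappa> i = 0 \<Longrightarrow> i = i0"
  shows "hw_module A B C D K \<kappa> (powspan (cre i0))"
proof -
  \<comment> \<open>The choice \<open>{0}\<close> for the vacua gives access to
    \<open>\<Omega>\<close> and the relations on it, which do not depend on
    \<open>G\<close>.\<close>
  interpret triv: hw_module A B C D K \<kappa> "{0}"
    by standard (auto simp: subspaceV_def lin_zero[OF K_lin] lin_zero[OF C_lin] lin_zero[OF D_lin]
        lin_zero[OF ann_lin] lin_zero[OF cre_lin])
  let ?v = "\<lambda>k. (cre i0 ^^ k) vac"
  have \<Omega>: "?v k \<in> triv.\<Omega>" for k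
    by (induction k) (auto simp: triv.cre_\<Omega>, auto simp: triv.\<Omega>_def K_vac C_0_vac C_vac)
  have ann: "ann i (?v k) = 0" if "i \<in> letter_set" for i k
    by (induction k) (use that i0 \<Omega> in \<open>auto simp: ann_vac triv.ann_cre lin_zero[OF cre_lin]\<close>)
  obtain z where z: "\<And>u. D 0 (cre i0 u) = cre i0 (D 0 u) + scaleV z (cre i0 u)"
  proof
    show "D 0 (cre i0 u) = cre i0 (D 0 u) +
        scaleV (case i0 of LA p \<Rightarrow> 1 | LB p \<Rightarrow> - 1 | LC k \<Rightarrow> 0) (cre i0 u)" for u
      by (cases i0) (auto simp: cre_def D_Ah D_Bh DC scaleV_minus_left)
  qed
  have D0: "D 0 (?v k) = scaleV (\<delta> + of_nat k * z) (?v k)" for k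
    by (induction k) (auto simp: D_0_vac z lin_scale[OF cre_lin] algebra_simps simp flip: scaleV_add_left)
  have mem: "?v k \<in> powspan (cre i0)" for k
  proof -
    have *: "?v k = (\<Sum>j<Suc k. scaleV (if j = k then 1 else 0) (?v j))" by simp
    show ?thesis by (subst *) (rule powspanI)
  qed
  have null: "subspaceV {0 :: 'a \<Rightarrow>\<^sub>0 complex}" by (simp add: subspaceV_def)
  show ?thesis
  proof
    show "subspaceV (powspan (cre i0))" by (rule powspan_sub)
    fix v assume v: "v \<in> powspan (cre i0)"
    \<comment> \<open>Linear identities are checked on the powers, as the statement that a
      difference of operators maps into \<open>{0}\<close>.\<close>
    show "K v = v"
      using powspan_invariant[OF null linear_op_minus[OF K_lin linear_op_ident] _ v] triv.\<Omega>_K[OF \<Omega>] by simp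
    show "C 0 v = scaleV \<kappa> v"
      using powspan_invariant[OF null linear_op_minus[OF C_lin linear_op_scale[OF linear_op_ident]] _ v]
        triv.\<Omega>_C[OF \<Omega>, of 0] by simp
    show "C n v = 0" if "n \<ge> 1" for n
      using powspan_invariant[OF null C_lin _ v] triv.\<Omega>_C[OF \<Omega>, of n] that by simp
    show "ann i v = 0" if "i \<in> letter_set" for i
      using powspan_invariant[OF null ann_lin _ v] ann that by simp
    show "cre i v \<in> powspan (cre i0)" if i: "i \<in> letter_set" "wt \<kappa> i = 0" for i
    proof -
      have "i = i0" using uniq i by blast
      have "cre i0 (?v k) \<in> powspan (cre i0)" for k using mem[of "Suc k"] by simp
      then show ?thesis unfolding \<open>i = i0\<close> by (rule powspan_invariant[OF powspan_sub cre_lin _ v])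
    qed
    show "D 0 v \<in> powspan (cre i0)"
      by (rule powspan_invariant[OF powspan_sub D_lin _ v]) (simp add: D0 mem subspaceV_scale[OF powspan_sub])
  qed
qed

text \<open>The positive modes of \<open>B\<close> kill \<open>v\<close>, so the sum ends with the
  mode \<open>0\<close>. In \<open>Ah_expand\<close> the mode \<open>0\<close> vanishes as well,
  which is why \<open>p\<close> starts at \<open>1\<close> there.\<close>

lemma Bh_expand:
  assumes "\<And>q. q \<ge> 1 \<Longrightarrow> B q v = 0"
  shows "Bh (- int n) v = (\<Sum>p\<le>n. e 1 (n - p) (B (- int p) v))"
proof -
  have "Bh (- int n) v = (\<Sum>r<Suc n. e 1 r (B (- int n + 1 * int r) v))"
    unfolding Bh_def by (rule dress_eq_sum) (simp add: assms lin_zero[OF cf.newton_lin])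
  also have "\<dots> = (\<Sum>p\<le>n. e 1 (n - p) (B (- int p) v))"
    by (rule sum.reindex_bij_witness[where i = "\<lambda>p. n - p" and j = "\<lambda>r. n - r"]) auto
  finally show ?thesis .
qed

lemma Ah_expand:
  assumes "\<And>q. q \<ge> 0 \<Longrightarrow> A q v = 0"
  shows "Ah (- int n) v = (\<Sum>p\<in>{1..n}. e (- 1) (n - p) (A (- int p) v))"
proof -
  have "Ah (- int n) v = (\<Sum>r<n. e (- 1) r (A (- int n + 1 * int r) v))"
    unfolding Ah_def by (rule dress_eq_sum) (simp add: assms lin_zero[OF cf.newton_lin])
  also have "\<dots> = (\<Sum>p\<in>{1..n}. e (- 1) (n - p) (A (- int p) v))"
    by (rule sum.reindex_bij_witness[where i = "\<lambda>p. n - p" and j = "\<lambda>r. n - r"]) auto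
  finally show ?thesis .
qed

text \<open>Makes \<open>Ah_expand\<close> applicable to every power of the dressed operator on
  \<open>vac\<close>, so that powers can be expanded one factor at a time.\<close>

lemma A_Ah_power: "p \<ge> 0 \<Longrightarrow> A p ((Ah q ^^ k) vac) = 0"
proof (induction k)
  case (Suc k)
  have "A p (Ah q v) = Ah q (A p v)" for v
    unfolding Ah_def by (rule dress_commute) (simp_all add: A_lin e_comm AA dressable_A)
  then show ?case using Suc by (simp add: lin_zero[OF Ah_lin])
qed (simp add: A_vac)

lemma B_Bh_power: "p \<ge> 1 \<Longrightarrow> B p ((Bh q ^^ k) vac) = 0"
proof (induction k)
  case (Suc k)
  have "B p (Bh q v) = Bh q (B p v)" for v
    unfolding Bh_def by (rule dress_commute) (simp_all add: B_lin e_comm BB dressable_B)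
  then show ?case using Suc by (simp add: lin_zero[OF Bh_lin])
qed (simp add: B_vac)

end

section \<open>Partitions\<close>

text \<open>\<open>zz \<mu>\<close> is the order of the centralizer of a permutation of cycle type \<open>\<mu>\<close>.\<close>

definition zz :: "nat multiset \<Rightarrow> complex" where
  "zz \<mu> = (\<Prod>k\<in>set_mset \<mu>. of_nat k ^ count \<mu> k * fact (count \<mu> k))"

lemma zz_empty [simp]: "zz {#} = 1"
  by (simp add: zz_def)

lemma zz_add: "zz (add_mset k \<mu>) = zz \<mu> * of_nat k * of_nat (Suc (count \<mu> k))"
proof -
  let ?f = "\<lambda>\<mu> j. of_nat j ^ count \<mu> j * fact (count \<mu> j) :: complex"
  have r: "(\<Prod>j\<in>set_mset \<mu> - {k}. ?f (add_mset k \<mu>) j) = (\<Prod>j\<in>set_mset \<mu> - {k}. ?f \<mu> j)"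
    by (rule prod.cong) auto
  have m: "zz \<mu> = ?f \<mu> k * (\<Prod>j\<in>set_mset \<mu> - {k}. ?f \<mu> j)"
  proof (cases "k \<in># \<mu>")
    case True
    then show ?thesis unfolding zz_def by (subst prod.remove[of _ k]) auto
  next
    case False
    then have "set_mset \<mu> - {k} = set_mset \<mu>" by simp
    then show ?thesis using False unfolding zz_def by (simp add: not_in_iff)
  qed
  have "zz (add_mset k \<mu>) = ?f (add_mset k \<mu>) k * (\<Prod>j\<in>set_mset \<mu> - {k}. ?f (add_mset k \<mu>) j)"
    unfolding zz_def by (subst prod.remove[of _ k]) auto
  then show ?thesis unfolding m r by (simp add: algebra_simps)
qed

lemma zz_nonzero: "0 \<notin># \<mu> \<Longrightarrow> zz \<mu> \<noteq> 0"
  unfolding zz_def by (auto intro!: Nat.gr0I)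

lemma zz_remove: "k \<in># \<mu> \<Longrightarrow> zz \<mu> = zz (\<mu> - {#k#}) * of_nat k * of_nat (count \<mu> k)"
  using zz_add[of k "\<mu> - {#k#}"] insert_DiffM[of k \<mu>] by simp

lemma inverse_zz_remove:
  assumes "0 \<notin># \<mu>" "k \<in># \<mu>"
  shows "1 / zz (\<mu> - {#k#}) = of_nat (k * count \<mu> k) / zz \<mu>"
proof -
  have "zz (\<mu> - {#k#}) \<noteq> 0" using assms by (intro zz_nonzero) (meson in_diffD)
  moreover have "of_nat k * of_nat (count \<mu> k) \<noteq> (0 :: complex)"
    using assms by (metis count_eq_zero_iff mult_eq_0_iff of_nat_eq_0_iff)
  ultimately show ?thesis unfolding zz_remove[OF assms(2)] by (simp add: field_simps)
qed

lemma sum_mset_count: "(\<Sum>k\<in>set_mset \<mu>. k * count \<mu> k) = sum_mset \<mu>" for \<mu> :: "nat multiset"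
proof (induction \<mu>)
  case (add x \<mu>)
  have "(\<Sum>k\<in>set_mset (add_mset x \<mu>). k * count (add_mset x \<mu>) k) =
      (\<Sum>k\<in>set_mset (add_mset x \<mu>). k * count \<mu> k + (if k = x then x else 0))"
    by (rule sum.cong) auto
  also have "\<dots> = (\<Sum>k\<in>set_mset \<mu>. k * count \<mu> k) + x"
    by (cases "x \<in># \<mu>") (auto simp: sum.distrib insert_absorb not_in_iff)
  finally show ?case using add by simp
qed simp

text \<open>Newton's identity for coefficients: the weights \<open>k * count \<mu> k\<close> add up
  to \<open>sum_mset \<mu>\<close>. The expansion of the exponential and the coefficient systems
  both rest on it.\<close>

lemma sum_inverse_zz_remove:
  assumes "0 \<notin># \<mu>"
  shows "(\<Sum>k\<in>set_mset \<mu>. 1 / zz (\<mu> - {#k#})) = of_nat (sum_mset \<mu>) / zz \<mu>"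
proof -
  have "(\<Sum>k\<in>set_mset \<mu>. 1 / zz (\<mu> - {#k#})) = (\<Sum>k\<in>set_mset \<mu>. of_nat (k * count \<mu> k) / zz \<mu>)"
    by (rule sum.cong) (simp_all add: inverse_zz_remove assms del: of_nat_mult)
  also have "\<dots> = of_nat (sum_mset \<mu>) / zz \<mu>"
    by (simp only: sum_mset_count[symmetric] of_nat_sum sum_divide_distrib)
  finally show ?thesis .
qed

lemma Part_0: "Part 0 = {{#}}"
  unfolding Part_def by auto (metis multiset_nonemptyE)

lemma Part_nonempty: "\<mu> \<in> Part n \<Longrightarrow> n \<ge> 1 \<Longrightarrow> \<mu> \<noteq> {#}"
  by (auto simp: Part_def)

lemma Part_add: "\<rho> \<in> Part (n - p) \<Longrightarrow> 1 \<le> p \<Longrightarrow> p \<le> n \<Longrightarrow> add_mset p \<rho> \<in> Part n"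
  by (auto simp: Part_def)

lemma Part_part: "\<mu> \<in> Part n \<Longrightarrow> p \<in># \<mu> \<Longrightarrow> 1 \<le> p \<and> p \<le> n"
  by (cases "p = 0") (auto simp: Part_def dest!: multi_member_split)

lemma Part_remove: "\<mu> \<in> Part n \<Longrightarrow> p \<in># \<mu> \<Longrightarrow> \<mu> - {#p#} \<in> Part (n - p)"
  by (auto simp: Part_def dest!: multi_member_split)

lemma size_le_sum_mset: "0 \<notin># \<mu> \<Longrightarrow> size \<mu> \<le> sum_mset \<mu>" for \<mu> :: "nat multiset"
  by (induction \<mu>) auto

lemma finite_Part: "finite (Part n)"
proof (rule finite_subset)
  show "finite (mset ` {xs. set xs \<subseteq> {..n} \<and> length xs \<le> n})"
    by (intro finite_imageI finite_lists_length_le) simp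
  show "Part n \<subseteq> mset ` {xs. set xs \<subseteq> {..n} \<and> length xs \<le> n}"
  proof
    fix \<mu> assume \<mu>: "\<mu> \<in> Part n"
    obtain xs where xs: "mset xs = \<mu>" using ex_mset by blast
    have "set xs \<subseteq> {..n}" using Part_part[OF \<mu>] xs by auto
    moreover have "length xs \<le> n" using size_le_sum_mset[of \<mu>] \<mu> xs by (auto simp: Part_def)
    ultimately show "\<mu> \<in> mset ` {xs. set xs \<subseteq> {..n} \<and> length xs \<le> n}" using xs by blast
  qed
qed

text \<open>Marking one of the distinct parts of a partition of \<open>n\<close> amounts to choosing
  \<open>p\<close> and a partition of \<open>n - p\<close>.\<close>

lemma sum_Part_remove:
  fixes h :: "nat multiset \<Rightarrow> nat \<Rightarrow> 'a::comm_monoid_add"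
  shows "(\<Sum>\<mu>\<in>Part n. \<Sum>p\<in>set_mset \<mu>. h (\<mu> - {#p#}) p) = (\<Sum>p\<in>{1..n}. \<Sum>\<rho>\<in>Part (n - p). h \<rho> p)"
proof -
  have "(\<Sum>\<mu>\<in>Part n. \<Sum>p\<in>set_mset \<mu>. h (\<mu> - {#p#}) p) =
      (\<Sum>(\<mu>, p)\<in>(SIGMA \<mu>:Part n. set_mset \<mu>). h (\<mu> - {#p#}) p)"
    by (rule sum.Sigma) (auto simp: finite_Part)
  also have "\<dots> = (\<Sum>(p, \<rho>)\<in>(SIGMA p:{1..n}. Part (n - p)). h \<rho> p)"
    by (rule sum.reindex_bij_witness[where j = "\<lambda>(\<mu>, p). (p, \<mu> - {#p#})" and i = "\<lambda>(p, \<rho>). (add_mset p \<rho>, p)"])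
       (auto simp: Part_add Part_remove dest: Part_part)
  also have "\<dots> = (\<Sum>p\<in>{1..n}. \<Sum>\<rho>\<in>Part (n - p). h \<rho> p)"
    by (rule sum.Sigma[symmetric]) (auto simp: finite_Part)
  finally show ?thesis .
qed

context commuting_family
begin

definition mono_op :: "nat multiset \<Rightarrow> ('i \<Rightarrow>\<^sub>0 complex) \<Rightarrow> ('i \<Rightarrow>\<^sub>0 complex)" where
  "mono_op \<rho> v = fold_mset g v \<rho>"

lemma mono_op_empty [simp]: "mono_op {#} v = v"
  by (simp add: mono_op_def)

lemma mono_op_add [simp]: "mono_op (add_mset k \<rho>) v = g k (mono_op \<rho> v)"
proof -
  interpret comp_fun_commute g
    by standard (auto simp: fun_eq_iff g_comm)
  show ?thesis by (simp add: mono_op_def)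
qed

lemma foldr_mono_op: "foldr g xs v = mono_op (mset xs) v"
  by (induction xs) simp_all

text \<open>Newton's recursion attaches a part to a smaller partition. Regrouped as a sum over
  partitions with a marked part, it produces the factor \<open>r\<close> by
  \<open>sum_inverse_zz_remove\<close>.\<close>

lemma newton_partition:
  "e \<tau> r v = (\<Sum>\<rho>\<in>Part r. scaleV (\<tau> ^ size \<rho> / zz \<rho>) (mono_op \<rho> (K v)))"
proof (induction r rule: less_induct)
  case (less r)
  show ?case
  proof (cases "r = 0")
    case False
    have "scaleV (of_nat r) (e \<tau> r v) = scaleV \<tau> (\<Sum>k<r. g (Suc k) (e \<tau> (r - Suc k) v))"
      by (rule newton_rec)
    also have "\<dots> = scaleV \<tau> (\<Sum>p\<in>{1..r}. g p (e \<tau> (r - p) v))"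
      by (rule arg_cong[of _ _ "scaleV \<tau>"],
          rule sum.reindex_bij_witness[where i = "\<lambda>p. p - 1" and j = Suc]) auto
    also have "\<dots> = (\<Sum>p\<in>{1..r}. \<Sum>\<rho>\<in>Part (r - p). scaleV (\<tau> ^ Suc (size \<rho>) / zz \<rho>) (mono_op (add_mset p \<rho>) (K v)))"
      by (simp add: less lin_sum[OF g_lin] lin_scale[OF g_lin] scaleV_sum_right)
    also have "\<dots> = (\<Sum>\<mu>\<in>Part r. \<Sum>p\<in>set_mset \<mu>. scaleV (\<tau> ^ Suc (size (\<mu> - {#p#})) / zz (\<mu> - {#p#})) (mono_op (add_mset p (\<mu> - {#p#})) (K v)))"
      by (rule sum_Part_remove[symmetric])
    also have "\<dots> = (\<Sum>\<mu>\<in>Part r. \<Sum>p\<in>set_mset \<mu>. scaleV (\<tau> ^ size \<mu> * (1 / zz (\<mu> - {#p#}))) (mono_op \<mu> (K v)))"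
    proof (intro sum.cong refl)
      fix \<mu> :: "nat multiset" and p assume p: "p \<in> set_mset \<mu>"
      have "Suc (size (\<mu> - {#p#})) = size \<mu>"
        using size_add_mset[of p "\<mu> - {#p#}"] insert_DiffM[OF p] by metis
      then show "scaleV (\<tau> ^ Suc (size (\<mu> - {#p#})) / zz (\<mu> - {#p#})) (mono_op (add_mset p (\<mu> - {#p#})) (K v)) =
          scaleV (\<tau> ^ size \<mu> * (1 / zz (\<mu> - {#p#}))) (mono_op \<mu> (K v))"
        by (simp only: insert_DiffM[OF p]) simp
    qed
    also have "\<dots> = (\<Sum>\<mu>\<in>Part r. scaleV (\<tau> ^ size \<mu> * (of_nat r / zz \<mu>)) (mono_op \<mu> (K v)))"
    proof (rule sum.cong[OF refl])
      fix \<mu> assume "\<mu> \<in> Part r"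
      then have "(\<Sum>p\<in>set_mset \<mu>. 1 / zz (\<mu> - {#p#})) = of_nat r / zz \<mu>"
        using sum_inverse_zz_remove[of \<mu>] by (auto simp: Part_def)
      then show "(\<Sum>p\<in>set_mset \<mu>. scaleV (\<tau> ^ size \<mu> * (1 / zz (\<mu> - {#p#}))) (mono_op \<mu> (K v))) =
          scaleV (\<tau> ^ size \<mu> * (of_nat r / zz \<mu>)) (mono_op \<mu> (K v))"
        by (simp only: scaleV_sum_left[symmetric] sum_distrib_left[symmetric])
    qed
    also have "\<dots> = scaleV (of_nat r) (\<Sum>\<rho>\<in>Part r. scaleV (\<tau> ^ size \<rho> / zz \<rho>) (mono_op \<rho> (K v)))"
      by (simp add: scaleV_sum_right mult.commute)
    finally have "scaleV (of_nat r) (e \<tau> r v - (\<Sum>\<rho>\<in>Part r. scaleV (\<tau> ^ size \<rho> / zz \<rho>) (mono_op \<rho> (K v)))) = 0"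
      by (simp only: scaleV_diff_right) simp
    then show ?thesis using False by (simp add: scaleV_eq_0_iff)
  qed (simp add: Part_0)
qed

end

section \<open>The coefficient systems\<close>

lemma merged_add_mset: "merged b (add_mset p \<rho>) p q = (if q \<in># \<rho> then b (\<rho> - {#q#}) (p + q) else 0)"
  by (simp add: merged_def)

text \<open>The default value \<open>0\<close> acts here: the term \<open>q = p\<close> counts only
  if \<open>p\<close> still occurs in \<open>\<rho>\<close>, that is, if it had multiplicity at
  least two.\<close>

lemma sum_merged:
  "(\<Sum>q\<in>set_mset (add_mset p \<rho>). merged b (add_mset p \<rho>) p q) = (\<Sum>q\<in>set_mset \<rho>. b (\<rho> - {#q#}) (p + q))"
  by (rule sum.mono_neutral_cong_right) (auto simp: merged_add_mset)

text \<open>Each step merges a part of \<open>\<rho>\<close> into \<open>p\<close> and so reduces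
  the number of parts; everything is determined by the final entry \<open>b {#} n\<close>. The
  factor \<open>n - p\<close> is nonzero as long as \<open>\<rho>\<close> is nonempty.\<close>

lemma coefficient_recursion:
  assumes rec: "\<And>p \<rho>. p \<in> {1..n} \<Longrightarrow> \<rho> \<in> Part (n - p) \<Longrightarrow>
      of_nat (n - p) * b \<rho> p = \<tau> * (\<Sum>q\<in>set_mset \<rho>. b (\<rho> - {#q#}) (p + q))"
    and "p \<in> {1..n}" "\<rho> \<in> Part (n - p)"
  shows "b \<rho> p = b {#} n * \<tau> ^ size \<rho> / zz \<rho>"
  using assms(2,3)
proof (induction "size \<rho>" arbitrary: \<rho> p)
  case 0
  then show ?case by (auto simp: Part_def)
next
  case (Suc s)
  have np: "n - p > 0" "0 \<notin># \<rho>" "sum_mset \<rho> = n - p"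
  proof -
    show 0: "0 \<notin># \<rho>" "sum_mset \<rho> = n - p" using Suc.prems by (auto simp: Part_def)
    show "n - p > 0" using size_le_sum_mset[OF 0(1)] 0 Suc.hyps by linarith
  qed
  have "b (\<rho> - {#q#}) (p + q) = b {#} n * \<tau> ^ s * (1 / zz (\<rho> - {#q#}))" if q: "q \<in># \<rho>" for q
  proof -
    have "s = size (\<rho> - {#q#})" using Suc.hyps(2) q by (simp add: size_Diff_singleton)
    moreover have "p + q \<in> {1..n}" "\<rho> - {#q#} \<in> Part (n - (p + q))"
      using Part_part[OF Suc.prems(2) q] Part_remove[OF Suc.prems(2) q] Suc.prems by auto
    ultimately show ?thesis using Suc.hyps(1)[of "\<rho> - {#q#}" "p + q"] by simp
  qed
  then have "(\<Sum>q\<in>set_mset \<rho>. b (\<rho> - {#q#}) (p + q)) =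
      (\<Sum>q\<in>set_mset \<rho>. b {#} n * \<tau> ^ s * (1 / zz (\<rho> - {#q#})))"
    by (rule sum.cong[OF refl])
  also have "\<dots> = b {#} n * \<tau> ^ s * (of_nat (n - p) / zz \<rho>)"
    by (simp only: sum_distrib_left[symmetric] sum_inverse_zz_remove[OF np(2)] np(3))
  finally have "(\<Sum>q\<in>set_mset \<rho>. b (\<rho> - {#q#}) (p + q)) = b {#} n * \<tau> ^ s * (of_nat (n - p) / zz \<rho>)" .
  then have "of_nat (n - p) * b \<rho> p = of_nat (n - p) * (b {#} n * \<tau> ^ Suc s / zz \<rho>)"
    by (simp add: rec[OF Suc.prems])
  moreover have "of_nat (n - p) \<noteq> (0::complex)" using np(1) by simp
  ultimately show ?case using Suc.hyps(2) by (metis mult_left_cancel)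
qed

text \<open>Newton's identity again, now showing that the closed form is a solution; used with
  \<open>\<tau> = 1\<close> for \<open>b\<close> and \<open>\<tau> = - 1\<close> for
  \<open>a\<close>.\<close>

lemma coefficient_recursion_holds:
  assumes "\<rho> \<in> Part (n - p)" "p \<le> n"
  shows "of_nat (n - p) * (\<tau> ^ size \<rho> / zz \<rho>) = \<tau> * (\<Sum>q\<in>set_mset \<rho>. \<tau> ^ size (\<rho> - {#q#}) / zz (\<rho> - {#q#}))"
proof -
  have "\<tau> * (\<Sum>q\<in>set_mset \<rho>. \<tau> ^ size (\<rho> - {#q#}) / zz (\<rho> - {#q#})) = (\<Sum>q\<in>set_mset \<rho>. \<tau> ^ size \<rho> * (1 / zz (\<rho> - {#q#})))"
    unfolding sum_distrib_left
  proof (rule sum.cong[OF refl])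
    fix q assume q: "q \<in># \<rho>"
    have "Suc (size (\<rho> - {#q#})) = size \<rho>"
      using size_add_mset[of q "\<rho> - {#q#}"] insert_DiffM[OF q] by metis
    then have "\<tau> ^ size \<rho> = \<tau> * \<tau> ^ size (\<rho> - {#q#})" by (metis power_Suc)
    then show "\<tau> * (\<tau> ^ size (\<rho> - {#q#}) / zz (\<rho> - {#q#})) = \<tau> ^ size \<rho> * (1 / zz (\<rho> - {#q#}))" by simp
  qed
  also have "\<dots> = \<tau> ^ size \<rho> * (of_nat (n - p) / zz \<rho>)"
    using assms sum_inverse_zz_remove[of \<rho>] by (simp only: sum_distrib_left[symmetric]) (simp add: Part_def)
  finally show ?thesis by simp
qed

text \<open>The factor \<open>\<beta>\<close> is the entry \<open>b {#} n\<close>. It cannot vanish,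
  since then all coefficients would.\<close>

lemma b_coefficients_unique:
  assumes n: "n \<ge> 1" and ab: "b_coefficients n a b"
  shows "\<exists>\<beta>. \<beta> \<noteq> 0 \<and> (\<forall>\<mu>\<in>Part n. a \<mu> = \<beta> / zz \<mu>) \<and> (\<forall>p\<in>{1..n}. \<forall>\<rho>\<in>Part (n - p). b \<rho> p = \<beta> / zz \<rho>)"
proof -
  have b: "b \<rho> p = b {#} n / zz \<rho>" if "p \<in> {1..n}" "\<rho> \<in> Part (n - p)" for \<rho> p
  proof -
    have "of_nat (n - p) * b \<rho> p = 1 * (\<Sum>q\<in>set_mset \<rho>. b (\<rho> - {#q#}) (p + q))"
      if "p \<in> {1..n}" "\<rho> \<in> Part (n - p)" for \<rho> p
    proof -
      have \<mu>: "add_mset p \<rho> \<in> Part n" "p \<in># add_mset p \<rho>" using that Part_add by auto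
      have "b (add_mset p \<rho> - {#p#}) p * (- of_nat n + of_nat p) +
         (\<Sum>q\<in>set_mset (add_mset p \<rho>). merged b (add_mset p \<rho>) p q) = 0"
        using ab \<mu> unfolding b_coefficients_def by blast
      then show ?thesis unfolding sum_merged using that by (simp add: of_nat_diff algebra_simps)
    qed
    from coefficient_recursion[of n b 1, OF this that] show ?thesis by simp
  qed
  have a: "a \<mu> = b {#} n / zz \<mu>" if \<mu>: "\<mu> \<in> Part n" for \<mu>
  proof -
    obtain p where p: "p \<in># \<mu>" using Part_nonempty[OF \<mu> n] by auto
    have "a \<mu> * of_nat (count \<mu> p) * of_nat p - b (\<mu> - {#p#}) p = 0"
      using ab \<mu> p unfolding b_coefficients_def by blast
    moreover have "b (\<mu> - {#p#}) p = b {#} n * (1 / zz (\<mu> - {#p#}))"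
      using b[OF _ Part_remove[OF \<mu> p]] Part_part[OF \<mu> p] by simp
    moreover have "1 / zz (\<mu> - {#p#}) = of_nat (p * count \<mu> p) / zz \<mu>"
      using \<mu> p by (intro inverse_zz_remove) (auto simp: Part_def)
    moreover have "of_nat (p * count \<mu> p) \<noteq> (0::complex)"
      using Part_part[OF \<mu> p] p by auto
    ultimately have "a \<mu> * of_nat (p * count \<mu> p) = b {#} n / zz \<mu> * of_nat (p * count \<mu> p)"
      by (simp add: mult_ac)
    then show ?thesis using \<open>of_nat (p * count \<mu> p) \<noteq> 0\<close> by (metis mult_right_cancel)
  qed
  have "b {#} n \<noteq> 0"
    using ab a b unfolding b_coefficients_def by (metis div_0)
  then show ?thesis using a b by blast
qed

lemma b_coefficients_exist:
  assumes n: "n \<ge> 1"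
  shows "b_coefficients n (\<lambda>\<mu>. 1 / zz \<mu>) (\<lambda>\<rho> p. 1 / zz \<rho>)"
  unfolding b_coefficients_def
proof (intro conjI ballI)
  have "{#} \<in> Part (n - n)" by (simp add: Part_0)
  then show "(\<exists>\<mu>\<in>Part n. 1 / zz \<mu> \<noteq> 0) \<or> (\<exists>p\<in>{1..n}. \<exists>\<rho>\<in>Part (n - p). 1 / zz \<rho> \<noteq> 0)"
    using n by (intro disjI2 bexI[of _ n] bexI[of _ "{#}"]) auto
next
  fix \<mu> p assume \<mu>: "\<mu> \<in> Part n" and p: "p \<in># \<mu>"
  have "1 / zz (\<mu> - {#p#}) = of_nat (p * count \<mu> p) / zz \<mu>"
    using \<mu> p by (intro inverse_zz_remove) (auto simp: Part_def)
  then show "1 / zz \<mu> * of_nat (count \<mu> p) * of_nat p - 1 / zz (\<mu> - {#p#}) = 0"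
    by (simp add: mult.commute)
  obtain \<rho> where \<rho>: "\<mu> = add_mset p \<rho>" using p by (auto dest: multi_member_split)
  have pn: "p \<le> n" "\<rho> \<in> Part (n - p)" using Part_part[OF \<mu> p] Part_remove[OF \<mu> p] \<rho> by auto
  show "1 / zz (\<mu> - {#p#}) * (- of_nat n + of_nat p) + (\<Sum>q\<in>set_mset \<mu>. merged (\<lambda>\<rho> p. 1 / zz \<rho>) \<mu> p q) = 0"
    using coefficient_recursion_holds[OF pn(2,1), of 1] pn(1)
    unfolding \<rho> sum_merged by (simp add: of_nat_diff algebra_simps)
qed

text \<open>The minus sign before the sum makes this the recursion with \<open>\<tau> = - 1\<close>,
  hence one sign for every part of \<open>\<rho>\<close>.\<close>

lemma a_coefficients_unique:
  assumes c: "a_coefficients n c"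
  shows "\<exists>\<beta>. \<beta> \<noteq> 0 \<and> (\<forall>p\<in>{1..n}. \<forall>\<rho>\<in>Part (n - p). c \<rho> p = \<beta> * (- 1) ^ size \<rho> / zz \<rho>)"
proof -
  have b: "c \<rho> p = c {#} n * (- 1) ^ size \<rho> / zz \<rho>" if "p \<in> {1..n}" "\<rho> \<in> Part (n - p)" for \<rho> p
  proof -
    have "of_nat (n - p) * c \<rho> p = - 1 * (\<Sum>q\<in>set_mset \<rho>. c (\<rho> - {#q#}) (p + q))"
      if "p \<in> {1..n}" "\<rho> \<in> Part (n - p)" for \<rho> p
    proof -
      have \<mu>: "add_mset p \<rho> \<in> Part n" "p \<in># add_mset p \<rho>" using that Part_add by auto
      have "c (add_mset p \<rho> - {#p#}) p * (- of_nat n + of_nat p) -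
         (\<Sum>q\<in>set_mset (add_mset p \<rho>). merged c (add_mset p \<rho>) p q) = 0"
        using c \<mu> unfolding a_coefficients_def by blast
      then show ?thesis unfolding sum_merged using that by (simp add: of_nat_diff algebra_simps)
    qed
    from coefficient_recursion[of n c "- 1", OF this that] show ?thesis .
  qed
  have "c {#} n \<noteq> 0"
    using c b unfolding a_coefficients_def by (metis div_0 mult_zero_left)
  then show ?thesis using b by blast
qed

lemma a_coefficients_exist:
  assumes n: "n \<ge> 1"
  shows "a_coefficients n (\<lambda>\<rho> p. (- 1) ^ size \<rho> / zz \<rho>)"
  unfolding a_coefficients_def
proof (intro conjI ballI impI)
  have "{#} \<in> Part (n - n)" by (simp add: Part_0)
  then show "\<exists>p\<in>{1..n}. \<exists>\<rho>\<in>Part (n - p). (- 1) ^ size \<rho> / zz \<rho> \<noteq> 0"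
    using n by (intro bexI[of _ n] bexI[of _ "{#}"]) auto
next
  fix \<mu> p assume \<mu>: "\<mu> \<in> Part n" and p: "p \<in># \<mu>"
  {
    fix q assume q: "q \<in># \<mu>" "p \<noteq> q"
    obtain \<mu>' where "\<mu> = add_mset p \<mu>'" using p by (auto dest: multi_member_split)
    moreover obtain \<nu> where "\<mu>' = add_mset q \<nu>"
      using q calculation by (auto dest: multi_member_split)
    ultimately have \<nu>: "\<mu> = add_mset p (add_mset q \<nu>)" by simp
    have z: "0 \<notin># add_mset p \<nu>" using \<mu> \<nu> by (auto simp: Part_def)
    have 1: "\<mu> - {#q#} = add_mset p \<nu>" using q \<nu> by simp
    \<comment> \<open>Taken for \<open>add_mset p \<nu>\<close> in place of \<open>\<mu>\<close>:
      removing a part \<open>q\<close> different from \<open>p\<close> leaves the multiplicity of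
      \<open>p\<close> unchanged.\<close>
    have E: "1 / zz \<nu> = of_nat (p * count \<mu> p) / zz (add_mset p \<nu>)"
      using inverse_zz_remove[OF z, of p] q(2) not_sym[OF q(2)] \<nu> by simp
    have M: "merged (\<lambda>\<rho> p. (- 1) ^ size \<rho> / zz \<rho>) \<mu> p q = (- 1) ^ size \<nu> * (1 / zz \<nu>)"
      by (simp add: merged_def \<nu>)
    show "of_nat (count \<mu> p) * of_nat p * ((- 1) ^ size (\<mu> - {#q#}) / zz (\<mu> - {#q#})) +
        merged (\<lambda>\<rho> p. (- 1) ^ size \<rho> / zz \<rho>) \<mu> p q = 0"
      unfolding 1 M E by (simp add: mult_ac)
  }
  obtain \<rho> where \<rho>: "\<mu> = add_mset p \<rho>" using p by (auto dest: multi_member_split)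
  have pn: "p \<le> n" "\<rho> \<in> Part (n - p)" using Part_part[OF \<mu> p] Part_remove[OF \<mu> p] \<rho> by auto
  show "(- 1) ^ size (\<mu> - {#p#}) / zz (\<mu> - {#p#}) * (- of_nat n + of_nat p) -
      (\<Sum>q\<in>set_mset \<mu>. merged (\<lambda>\<rho> p. (- 1) ^ size \<rho> / zz \<rho>) \<mu> p q) = 0"
  proof -
    have "x * (- of_nat n + of_nat p) = - (of_nat (n - p) * x)" for x :: complex
      using pn(1) by (simp add: of_nat_diff algebra_simps)
    then show ?thesis
      unfolding \<rho> sum_merged using coefficient_recursion_holds[OF pn(2,1), of "- 1"] by simp
  qed
qed

section \<open>The tensor algebra and the enveloping algebra\<close>

lemma vec_induct [case_names zero single add scale]:
  assumes "P 0" "\<And>i. P (Poly_Mapping.single i 1)" "\<And>u v. P u \<Longrightarrow> P v \<Longrightarrow> P (u + v)" "\<And>z v. P v \<Longrightarrow> P (scaleV z v)"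
  shows "P (v :: 'i \<Rightarrow>\<^sub>0 complex)"
proof -
  have "P (\<Sum>i\<in>I. scaleV (Poly_Mapping.lookup v i) (Poly_Mapping.single i 1))" for I
    by (induction I rule: infinite_finite_induct) (auto intro: assms simp del: scaleV_single)
  then show ?thesis by (subst poly_mapping_expansion)
qed

lemma vec_induct_on [consumes 1, case_names zero single add scale]:
  assumes "Poly_Mapping.keys v \<subseteq> S" "P 0" "\<And>i. i \<in> S \<Longrightarrow> P (Poly_Mapping.single i 1)"
    "\<And>u v. P u \<Longrightarrow> P v \<Longrightarrow> P (u + v)" "\<And>z v. P v \<Longrightarrow> P (scaleV z v)"
  shows "P (v :: 'i \<Rightarrow>\<^sub>0 complex)"
proof -
  have "P (\<Sum>i\<in>I. scaleV (Poly_Mapping.lookup v i) (Poly_Mapping.single i 1))" if "I \<subseteq> S" for I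
    using that by (induction I rule: infinite_finite_induct) (auto intro: assms(2-) simp del: scaleV_single)
  then show ?thesis by (subst poly_mapping_expansion) (use assms(1) in blast)
qed

lemma scaleV_conv_mult: "scaleV z t = Poly_Mapping.single 0 z * t" for t :: "'i::monoid_add \<Rightarrow>\<^sub>0 complex"
  by (simp add: scaleV_def mult_map_scale_conv_mult)

lemma scaleV_mult_left: "scaleV z s * t = scaleV z (s * t)" for t :: "'i::monoid_add \<Rightarrow>\<^sub>0 complex"
  by (simp add: scaleV_conv_mult mult.assoc)

lemma single_zero_commute: "t * Poly_Mapping.single 0 z = scaleV z t" for t :: "'i::monoid_add \<Rightarrow>\<^sub>0 complex"
  by (induction t rule: vec_induct)
     (simp_all add: mult_single algebra_simps scaleV_add_right scaleV_mult_left)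

lemma scaleV_mult_right: "s * scaleV z t = scaleV z (s * t)" for t :: "'i::monoid_add \<Rightarrow>\<^sub>0 complex"
proof -
  have "s * scaleV z t = (s * Poly_Mapping.single 0 z) * t" by (simp add: scaleV_conv_mult mult.assoc)
  then show ?thesis by (simp add: single_zero_commute scaleV_mult_left)
qed

abbreviation gen :: "'i \<Rightarrow> 'i word \<Rightarrow>\<^sub>0 complex" where
  "gen x \<equiv> Poly_Mapping.single (Word [x]) 1"

lemma word_append: "Word xs + Word ys = Word (xs @ ys)"
  by (simp add: plus_word_def)

lemma gen_times_word: "gen x * Poly_Mapping.single (Word xs) z = Poly_Mapping.single (Word (x # xs)) z"
  by (simp add: mult_single word_append)

lemma single_Nil: "Poly_Mapping.single (Word []) 1 = (1 :: 'i word \<Rightarrow>\<^sub>0 complex)"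
  by (simp only: single_one flip: zero_word_def)

lemma tensor_incl_eq_lext: "tensor_incl = lext gen"
  by (simp add: fun_eq_iff tensor_incl_def lext_def)

lemma bilinear_extension_eq_lext: "bilinear_extension br x y = lext (\<lambda>i. lext (br i) y) x"
  by (simp add: bilinear_extension_def lext_def scaleV_sum_right)

lemma keys_lext: "Poly_Mapping.keys (lext f v) \<subseteq> (\<Union>i\<in>Poly_Mapping.keys v. Poly_Mapping.keys (f i))"
  unfolding lext_def by (rule subset_trans[OF keys_sum]) (auto simp: in_keys_iff)

definition tact :: "('i \<Rightarrow> ('k \<Rightarrow>\<^sub>0 complex) \<Rightarrow> ('k \<Rightarrow>\<^sub>0 complex)) \<Rightarrow> ('i word \<Rightarrow>\<^sub>0 complex) \<Rightarrow> ('k \<Rightarrow>\<^sub>0 complex) \<Rightarrow> ('k \<Rightarrow>\<^sub>0 complex)" where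
  "tact act t v = lext (\<lambda>w. foldr act (letters w) v) t"

lemma tact_lin_left: "linear_op (\<lambda>t. tact act t v)"
  unfolding tact_def by (rule lext_lin)

lemma tact_add: "tact act (s + t) v = tact act s v + tact act t v"
  and tact_scale: "tact act (scaleV z t) v = scaleV z (tact act t v)"
  and tact_diff: "tact act (s - t) v = tact act s v - tact act t v"
  and tact_zero [simp]: "tact act 0 v = 0"
  using tact_lin_left[of act v] by (rule lin_add lin_scale lin_diff lin_zero)+

lemma tact_single: "tact act (Poly_Mapping.single w z) v = scaleV z (foldr act (letters w) v)"
  by (simp add: tact_def)

lemma foldr_lin: "(\<And>x. linear_op (act x)) \<Longrightarrow> linear_op (foldr act xs)"
proof (induction xs)
  case Nil
  then show ?case by (simp add: linear_op_def)
next
  case (Cons x xs)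
  then show ?case using linear_op_compose[of "act x" "foldr act xs"] by (simp add: comp_def)
qed

lemma tact_lin:
  assumes "\<And>x. linear_op (act x)"
  shows "linear_op (tact act t)"
  unfolding tact_def[abs_def] lext_def
  by (intro linear_op_sum linear_op_scale foldr_lin assms)

lemma tact_mult:
  assumes act: "\<And>x. linear_op (act x)"
  shows "tact act (s * t) v = tact act s (tact act t v)"
proof (induction s rule: vec_induct)
  case (single w)
  show ?case
  proof (induction t rule: vec_induct)
    case (single w')
    show ?case by (simp add: mult_single tact_single plus_word_def)
  next
    case zero
    then show ?case by (simp add: lin_zero[OF tact_lin[OF act]])
  qed (simp_all add: distrib_left tact_add scaleV_mult_right tact_scale lin_add[OF tact_lin[OF act]] lin_scale[OF tact_lin[OF act]])
qed (simp_all add: distrib_right tact_add scaleV_mult_left tact_scale)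

lemma tact_one [simp]: "tact act 1 v = v"
proof -
  have "tact act (Poly_Mapping.single 0 1) v = v"
    by (simp only: tact_single) (simp add: zero_word_def)
  then show ?thesis by (simp only: single_one)
qed

lemma tact_incl: "tact act (tensor_incl x) v = lext (\<lambda>i. act i v) x"
  by (induction x rule: vec_induct)
     (simp_all add: tensor_incl_eq_lext lin_zero[OF lext_lin] lin_add[OF lext_lin] lin_scale[OF lext_lin] tact_add tact_scale tact_single)

lemma tensor_incl_single: "tensor_incl (Poly_Mapping.single x z) = Poly_Mapping.single (Word [x]) z"
  by (simp add: tensor_incl_eq_lext)

section \<open>Tensor algebras of subspaces, their ideals and quotients\<close>

lemma carrier_tensor_alg: "t \<in> carrier (tensor_alg S) \<longleftrightarrow> (\<forall>w\<in>Poly_Mapping.keys t. set (letters w) \<subseteq> S)"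
  by (simp add: tensor_alg_def)

lemma tensor_alg_simps [simp]:
  "s \<otimes>\<^bsub>tensor_alg S\<^esub> t = s * t" "s \<oplus>\<^bsub>tensor_alg S\<^esub> t = s + t" "\<one>\<^bsub>tensor_alg S\<^esub> = 1" "\<zero>\<^bsub>tensor_alg S\<^esub> = 0"
  by (simp_all add: tensor_alg_def)

lemma tensor_alg_add: "s \<in> carrier (tensor_alg S) \<Longrightarrow> t \<in> carrier (tensor_alg S) \<Longrightarrow> s + t \<in> carrier (tensor_alg S)"
  using Poly_Mapping.keys_add[of s t] by (auto simp: carrier_tensor_alg)

lemma tensor_alg_minus: "s \<in> carrier (tensor_alg S) \<Longrightarrow> - s \<in> carrier (tensor_alg S)"
  by (auto simp: carrier_tensor_alg in_keys_iff)

lemma tensor_alg_diff: "s \<in> carrier (tensor_alg S) \<Longrightarrow> t \<in> carrier (tensor_alg S) \<Longrightarrow> s - t \<in> carrier (tensor_alg S)"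
  using tensor_alg_add[of s S "- t"] tensor_alg_minus[of t S] by simp

lemma tensor_alg_mult: "s \<in> carrier (tensor_alg S) \<Longrightarrow> t \<in> carrier (tensor_alg S) \<Longrightarrow> s * t \<in> carrier (tensor_alg S)"
  using Poly_Mapping.keys_mult[of s t] by (fastforce simp: carrier_tensor_alg plus_word_def)

lemma tensor_alg_scalar: "Poly_Mapping.single 0 z \<in> carrier (tensor_alg S)"
  by (auto simp: carrier_tensor_alg zero_word_def)

lemma tensor_alg_one: "1 \<in> carrier (tensor_alg S)"
  using tensor_alg_scalar[of 1] by simp

lemma tensor_alg_zero: "0 \<in> carrier (tensor_alg S)"
  by (simp add: carrier_tensor_alg)

lemma tensor_alg_incl: "Poly_Mapping.keys x \<subseteq> S \<Longrightarrow> tensor_incl x \<in> carrier (tensor_alg S)"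
  using keys_lext[of gen x] by (fastforce simp: carrier_tensor_alg tensor_incl_eq_lext)

lemma tensor_alg_gen: "x \<in> S \<Longrightarrow> gen x \<in> carrier (tensor_alg S)"
  by (simp add: carrier_tensor_alg)

lemma tensor_alg_UNIV [simp]: "carrier (tensor_alg UNIV) = UNIV"
  by (auto simp: carrier_tensor_alg)

lemma tensor_alg_ring: "ring (tensor_alg S)"
proof (rule ringI)
  show "abelian_group (tensor_alg S)"
  proof (rule abelian_groupI)
    show "\<exists>y\<in>carrier (tensor_alg S). y \<oplus>\<^bsub>tensor_alg S\<^esub> x = \<zero>\<^bsub>tensor_alg S\<^esub>" if "x \<in> carrier (tensor_alg S)" for x
      using tensor_alg_minus[OF that] by (intro bexI[of _ "- x"]) simp_all
  qed (simp_all add: tensor_alg_add tensor_alg_zero add.assoc add.commute)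
  show "Group.monoid (tensor_alg S)"
    by (rule Group.monoidI) (simp_all add: tensor_alg_mult tensor_alg_one mult.assoc)
qed (simp_all add: distrib_left distrib_right)

lemma tensor_alg_a_inv: "t \<in> carrier (tensor_alg S) \<Longrightarrow> \<ominus>\<^bsub>tensor_alg S\<^esub> t = - t"
proof -
  assume t: "t \<in> carrier (tensor_alg S)"
  interpret ring "tensor_alg S" by (rule tensor_alg_ring)
  show ?thesis by (rule minus_equality) (use t tensor_alg_minus in auto)
qed

lemma tensor_alg_idealI:
  assumes "J \<subseteq> carrier (tensor_alg S)" "0 \<in> J" "\<And>s t. s \<in> J \<Longrightarrow> t \<in> J \<Longrightarrow> s + t \<in> J" "\<And>s. s \<in> J \<Longrightarrow> - s \<in> J"
    "\<And>s t. s \<in> J \<Longrightarrow> t \<in> carrier (tensor_alg S) \<Longrightarrow> t * s \<in> J"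
    "\<And>s t. s \<in> J \<Longrightarrow> t \<in> carrier (tensor_alg S) \<Longrightarrow> s * t \<in> J"
  shows "ideal J (tensor_alg S)"
proof (rule idealI[OF tensor_alg_ring])
  show "subgroup J (add_monoid (tensor_alg S))"
  proof (rule subgroup.intro)
    fix t assume t: "t \<in> J"
    then have "\<ominus>\<^bsub>tensor_alg S\<^esub> t = - t" using assms(1) tensor_alg_a_inv by blast
    then show "inv\<^bsub>add_monoid (tensor_alg S)\<^esub> t \<in> J" using assms(4)[OF t] by (simp add: a_inv_def)
  qed (use assms in auto)
qed (use assms in auto)

locale lie_span =
  fixes br :: "'i \<Rightarrow> 'i \<Rightarrow> ('i \<Rightarrow>\<^sub>0 complex)" and S :: "'i set"
  assumes closed: "i \<in> S \<Longrightarrow> j \<in> S \<Longrightarrow> Poly_Mapping.keys (br i j) \<subseteq> S"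
begin

lemma bilinear_closed:
  "Poly_Mapping.keys x \<subseteq> S \<Longrightarrow> Poly_Mapping.keys y \<subseteq> S \<Longrightarrow> Poly_Mapping.keys (bilinear_extension br x y) \<subseteq> S"
proof
  fix k assume xy: "Poly_Mapping.keys x \<subseteq> S" "Poly_Mapping.keys y \<subseteq> S"
    and "k \<in> Poly_Mapping.keys (bilinear_extension br x y)"
  then obtain i where i: "i \<in> S" "k \<in> Poly_Mapping.keys (lext (br i) y)"
    using keys_lext[of "\<lambda>i. lext (br i) y" x] unfolding bilinear_extension_eq_lext by blast
  then obtain j where "j \<in> S" "k \<in> Poly_Mapping.keys (br i j)"
    using keys_lext[of "br i" y] xy by blast
  then show "k \<in> S" using closed i by blast
qed

definition rels :: "('i word \<Rightarrow>\<^sub>0 complex) set" where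
  "rels = {tensor_incl x * tensor_incl y - tensor_incl y * tensor_incl x
          - tensor_incl (bilinear_extension br x y) | x y.
        Poly_Mapping.keys x \<subseteq> S \<and> Poly_Mapping.keys y \<subseteq> S}"

lemma rels_carrier: "rels \<subseteq> carrier (tensor_alg S)"
  unfolding rels_def using bilinear_closed
  by (blast intro: tensor_alg_diff tensor_alg_mult tensor_alg_incl)

lemma uea_ideal_eq: "uea_ideal br S = Idl\<^bsub>tensor_alg S\<^esub> rels"
  by (simp add: uea_ideal_def rels_def)

lemma I_ideal: "ideal (uea_ideal br S) (tensor_alg S)"
  unfolding uea_ideal_eq by (rule ring.genideal_ideal[OF tensor_alg_ring rels_carrier])

lemma rels_I: "rels \<subseteq> uea_ideal br S"
  unfolding uea_ideal_eq by (rule ring.genideal_self[OF tensor_alg_ring rels_carrier])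

lemma uea_ideal_minimal: "ideal J (tensor_alg S) \<Longrightarrow> rels \<subseteq> J \<Longrightarrow> uea_ideal br S \<subseteq> J"
  unfolding uea_ideal_eq by (rule ring.genideal_minimal[OF tensor_alg_ring])

lemma I_carrier: "uea_ideal br S \<subseteq> carrier (tensor_alg S)"
  by (rule additive_subgroup.a_subset[OF ideal.axioms(1)[OF I_ideal]])

lemmas I_subgroup = additive_subgroup.a_subgroup[OF ideal.axioms(1)[OF I_ideal]]

lemma I_zero: "0 \<in> uea_ideal br S"
  using subgroup.one_closed[OF I_subgroup] by simp

lemma I_add: "s \<in> uea_ideal br S \<Longrightarrow> t \<in> uea_ideal br S \<Longrightarrow> s + t \<in> uea_ideal br S"
  using subgroup.m_closed[OF I_subgroup] by simp

lemma I_minus: "s \<in> uea_ideal br S \<Longrightarrow> - s \<in> uea_ideal br S"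
  using subgroup.m_inv_closed[OF I_subgroup, of s] tensor_alg_a_inv[of s S] I_carrier by (auto simp: a_inv_def)

lemma I_mult: "s \<in> uea_ideal br S \<Longrightarrow> t \<in> carrier (tensor_alg S) \<Longrightarrow> t * s \<in> uea_ideal br S"
    "s \<in> uea_ideal br S \<Longrightarrow> t \<in> carrier (tensor_alg S) \<Longrightarrow> s * t \<in> uea_ideal br S"
  using ideal.I_l_closed[OF I_ideal] ideal.I_r_closed[OF I_ideal] by auto

text \<open>The universal property of the enveloping algebra: the tensors that act as zero on every
  vector form a two-sided ideal, so it suffices that it contains the defining relations, which
  bilinearity reduces to basis vectors.\<close>

lemma uea_ideal_annihilates:
  assumes act: "\<And>x. linear_op (act x)"
    and rel: "\<And>i j v. i \<in> S \<Longrightarrow> j \<in> S \<Longrightarrow> act i (act j v) - act j (act i v) = lext (\<lambda>k. act k v) (br i j)"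
    and t: "t \<in> uea_ideal br S"
  shows "tact act t v = 0"
proof -
  let ?J = "{t \<in> carrier (tensor_alg S). \<forall>v. tact act t v = 0}"
  have "ideal ?J (tensor_alg S)"
  proof (rule tensor_alg_idealI)
    show "- s \<in> ?J" if "s \<in> ?J" for s
      using that tact_scale[of act "-1" s] by (auto simp: scaleV_minus_left tensor_alg_minus)
  qed (auto simp: tensor_alg_zero tensor_alg_add tensor_alg_mult tact_add tact_mult act lin_zero[OF tact_lin[OF act]])
  moreover have "rels \<subseteq> ?J"
  proof
    fix r assume r: "r \<in> rels"
    then obtain x y where r_eq: "r = tensor_incl x * tensor_incl y - tensor_incl y * tensor_incl x
          - tensor_incl (bilinear_extension br x y)" and x: "Poly_Mapping.keys x \<subseteq> S" and y: "Poly_Mapping.keys y \<subseteq> S"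
      unfolding rels_def by blast
    have y_lin: "lext (\<lambda>i. act i 0) y = 0"
      "lext (\<lambda>i. act i (u + v)) y = lext (\<lambda>i. act i u) y + lext (\<lambda>i. act i v) y"
      "lext (\<lambda>i. act i (scaleV z v)) y = scaleV z (lext (\<lambda>i. act i v) y)" for u v z
      using tact_lin[where act = act and t = "tensor_incl y", OF act] lin_zero[OF tact_lin[where act = act and t = "tensor_incl y", OF act]]
      unfolding linear_op_def tact_incl by auto
    have "tact act (tensor_incl x) (tact act (tensor_incl y) v) - tact act (tensor_incl y) (tact act (tensor_incl x) v) =
       tact act (tensor_incl (bilinear_extension br x y)) v" for v
      using x
    proof (induction x rule: vec_induct_on)
      case (single i)
      show ?case using y
      proof (induction y rule: vec_induct_on)
        case (single j)
        then show ?case using rel[OF \<open>i \<in> S\<close> single]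
          by (simp add: tact_incl bilinear_extension_eq_lext)
      qed (simp_all add: tact_incl bilinear_extension_eq_lext lin_zero[OF lext_lin] lin_add[OF lext_lin] lin_scale[OF lext_lin]
          lin_zero[OF act] lin_add[OF act] lin_scale[OF act] add_diff_add flip: scaleV_diff_right)
    qed (simp_all add: tact_incl bilinear_extension_eq_lext lin_zero[OF lext_lin] lin_add[OF lext_lin]
        lin_scale[OF lext_lin] y_lin add_diff_add flip: scaleV_diff_right)
    then show "r \<in> ?J" using r rels_carrier by (auto simp: r_eq tact_diff tact_mult act)
  qed
  ultimately show ?thesis using uea_ideal_minimal t by blast
qed

abbreviation cls :: "('i word \<Rightarrow>\<^sub>0 complex) \<Rightarrow> ('i word \<Rightarrow>\<^sub>0 complex) set" where
  "cls t \<equiv> uea_ideal br S +>\<^bsub>tensor_alg S\<^esub> t"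

lemma cls_set: "cls t = {s + t | s. s \<in> uea_ideal br S}"
  by (auto simp: a_r_coset_def')

lemma cls_eq_iff: "cls s = cls t \<longleftrightarrow> s - t \<in> uea_ideal br S"
proof
  assume "cls s = cls t"
  moreover have "s \<in> cls s" using I_zero by (force simp: cls_set)
  ultimately show "s - t \<in> uea_ideal br S" by (auto simp: cls_set)
next
  assume d: "s - t \<in> uea_ideal br S"
  show "cls s = cls t"
  proof (intro equalityI subsetI)
    fix x assume "x \<in> cls s"
    then obtain i where "i \<in> uea_ideal br S" "x = i + s" by (auto simp: cls_set)
    then show "x \<in> cls t" using I_add[of i "s - t"] d by (auto simp: cls_set intro!: exI[of _ "i + (s - t)"])
  next
    fix x assume "x \<in> cls t"
    then obtain i where "i \<in> uea_ideal br S" "x = i + t" by (auto simp: cls_set)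
    then show "x \<in> cls s" using I_add[of i "- (s - t)"] I_minus[OF d] by (auto simp: cls_set intro!: exI[of _ "i + - (s - t)"])
  qed
qed

lemma uea_ring: "ring (uea br S)"
  unfolding uea_def by (rule ideal.quotient_is_ring[OF I_ideal])

lemma carrier_uea: "carrier (uea br S) = cls ` carrier (tensor_alg S)"
  by (auto simp: uea_def FactRing_def A_RCOSETS_def' )

lemma uea_ops:
  "s \<in> carrier (tensor_alg S) \<Longrightarrow> t \<in> carrier (tensor_alg S) \<Longrightarrow> cls s \<otimes>\<^bsub>uea br S\<^esub> cls t = cls (s * t)"
  "s \<in> carrier (tensor_alg S) \<Longrightarrow> t \<in> carrier (tensor_alg S) \<Longrightarrow> cls s \<oplus>\<^bsub>uea br S\<^esub> cls t = cls (s + t)"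
  "\<one>\<^bsub>uea br S\<^esub> = cls 1"
  using ring_hom_mult[OF ideal.rcos_ring_hom[OF I_ideal], of s t] ring_hom_add[OF ideal.rcos_ring_hom[OF I_ideal], of s t] ring_hom_one[OF ideal.rcos_ring_hom[OF I_ideal]]
  by (simp_all add: uea_def)

end

section \<open>Presentations of the modules by left ideals of the tensor algebra\<close>

lemma nw_br_simps:
  "nw_br (At Ha p) (At Hb q) = Poly_Mapping.single (At Hc (p + q)) 1 + Poly_Mapping.single KK (if p + q = 0 then of_int p else 0)"
  "nw_br (At Hb p) (At Ha q) = Poly_Mapping.single (At Hc (p + q)) (- 1) + Poly_Mapping.single KK (if p + q = 0 then of_int p else 0)"
  "nw_br (At Hd p) (At Ha q) = Poly_Mapping.single (At Ha (p + q)) 1"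
  "nw_br (At Ha p) (At Hd q) = Poly_Mapping.single (At Ha (p + q)) (- 1)"
  "nw_br (At Hd p) (At Hb q) = Poly_Mapping.single (At Hb (p + q)) (- 1)"
  "nw_br (At Hb p) (At Hd q) = Poly_Mapping.single (At Hb (p + q)) 1"
  "nw_br (At Hc p) (At Hd q) = Poly_Mapping.single KK (if p + q = 0 then of_int p else 0)"
  "nw_br (At Hd p) (At Hc q) = Poly_Mapping.single KK (if p + q = 0 then of_int p else 0)"
  "nw_br (At Ha p) (At Ha q) = 0" "nw_br (At Hb p) (At Hb q) = 0"
  "nw_br (At Hc p) (At Hc q) = 0" "nw_br (At Hd p) (At Hd q) = 0"
  "nw_br (At Ha p) (At Hc q) = 0" "nw_br (At Hc p) (At Ha q) = 0"
  "nw_br (At Hb p) (At Hc q) = 0" "nw_br (At Hc p) (At Hb q) = 0"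
  by simp_all

declare nw_br.simps(1) [simp del] nw_br_simps [simp]

global_interpretation full: lie_span nw_br UNIV
  by standard simp

lemma nwu_class_eq_cls: "nwu_class t = full.cls t"
  by (simp add: nwu_class_def)

lemma carrier_NWU: "carrier NWU = range nwu_class"
  by (simp add: full.carrier_uea nwu_class_eq_cls[abs_def])

lemma nwu_class_carrier [simp]: "nwu_class t \<in> carrier NWU"
  by (simp add: carrier_NWU)

lemma nwu_class_eq_iff: "nwu_class s = nwu_class t \<longleftrightarrow> s - t \<in> uea_ideal nw_br UNIV"
  by (simp add: nwu_class_eq_cls full.cls_eq_iff)

lemma nwu_class_ops:
  "nwu_class s \<otimes>\<^bsub>NWU\<^esub> nwu_class t = nwu_class (s * t)"
  "nwu_class s \<oplus>\<^bsub>NWU\<^esub> nwu_class t = nwu_class (s + t)"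
  "\<one>\<^bsub>NWU\<^esub> = nwu_class 1"
  by (simp_all add: nwu_class_eq_cls full.uea_ops)

lemma NWU_ring: "ring NWU"
  by (rule full.uea_ring)

lemma nwu_class_zero: "\<zero>\<^bsub>NWU\<^esub> = nwu_class 0"
proof -
  interpret ring NWU by (rule NWU_ring)
  have "nwu_class 0 \<oplus>\<^bsub>NWU\<^esub> nwu_class 0 = nwu_class 0" by (simp add: nwu_class_ops)
  then show ?thesis by (metis add.l_cancel_one nwu_class_carrier)
qed

lemma nwu_class_finsum: "(\<Oplus>\<^bsub>NWU\<^esub>i\<in>A. nwu_class (f i)) = nwu_class (\<Sum>i\<in>A. f i)"
proof -
  interpret ring NWU by (rule NWU_ring)
  show ?thesis
    by (induction A rule: infinite_finite_induct)
       (simp_all add: finsum_infinite nwu_class_zero nwu_class_ops Pi_def)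
qed

lemma nwu_class_pow: "nwu_class t [^]\<^bsub>NWU\<^esub> (k::nat) = nwu_class (t ^ k)"
proof -
  interpret ring NWU by (rule NWU_ring)
  show ?thesis by (induction k) (simp_all add: nwu_class_ops power_commutes)
qed

definition left_ideal :: "('i word \<Rightarrow>\<^sub>0 complex) set \<Rightarrow> bool" where
  "left_ideal L \<longleftrightarrow> 0 \<in> L \<and> (\<forall>s\<in>L. \<forall>t\<in>L. s + t \<in> L) \<and> (\<forall>s. \<forall>t\<in>L. s * t \<in> L)"

lemma left_idealD:
  assumes "left_ideal L"
  shows "0 \<in> L" "s \<in> L \<Longrightarrow> t \<in> L \<Longrightarrow> s + t \<in> L" "t \<in> L \<Longrightarrow> s * t \<in> L"
  using assms by (auto simp: left_ideal_def)

lemma left_ideal_subspace: "left_ideal L \<Longrightarrow> subspaceV L"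
  by (auto simp: subspaceV_def left_ideal_def scaleV_conv_mult)

text \<open>\<open>M\<close> is the tensor algebra modulo the left ideal \<open>L\<close>, with the
  enveloping algebra acting by left multiplication. Submodules, quotients and isomorphisms become
  statements about left ideals, whatever cosets the carrier consists of.\<close>

definition presents :: "((nw word \<Rightarrow>\<^sub>0 complex) set, 'v) module \<Rightarrow> ((nw word \<Rightarrow>\<^sub>0 complex) \<Rightarrow> 'v) \<Rightarrow>
    (nw word \<Rightarrow>\<^sub>0 complex) set \<Rightarrow> bool" where
  "presents M ev L \<longleftrightarrow> carrier M = range ev \<and> (\<forall>s t. ev s \<oplus>\<^bsub>M\<^esub> ev t = ev (s + t)) \<and> \<zero>\<^bsub>M\<^esub> = ev 0 \<and>
     (\<forall>s t. nwu_class s \<odot>\<^bsub>M\<^esub> ev t = ev (s * t)) \<and> (\<forall>s t. ev s = ev t \<longleftrightarrow> s - t \<in> L)"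

locale presentation =
  fixes M :: "((nw word \<Rightarrow>\<^sub>0 complex) set, 'v) module" and ev and L
  assumes pres: "presents M ev L"
begin

lemma ev_simps: "carrier M = range ev" "ev s \<oplus>\<^bsub>M\<^esub> ev t = ev (s + t)" "\<zero>\<^bsub>M\<^esub> = ev 0"
  "nwu_class s \<odot>\<^bsub>M\<^esub> ev t = ev (s * t)" "ev s = ev t \<longleftrightarrow> s - t \<in> L"
  using pres by (auto simp: presents_def)

lemma ev_eq_zero: "ev t = \<zero>\<^bsub>M\<^esub> \<longleftrightarrow> t \<in> L"
  by (simp add: ev_simps)

lemma L_left_ideal: "left_ideal L"
  unfolding left_ideal_def
proof (intro conjI ballI allI)
  have L: "t \<in> L \<longleftrightarrow> ev t = ev 0" for t using ev_simps(5)[of t 0] by simp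
  show "0 \<in> L" by (simp add: L)
  show "s + t \<in> L" if "s \<in> L" "t \<in> L" for s t
    using that ev_simps(2)[of s t] ev_simps(2)[of 0 0] by (simp add: L)
  show "s * t \<in> L" if "t \<in> L" for s t
    using that ev_simps(4)[of s t] ev_simps(4)[of s 0] by (simp add: L)
qed

lemma abelian_group_M: "abelian_group M"
proof (rule abelian_groupI)
  show "\<exists>y\<in>carrier M. y \<oplus>\<^bsub>M\<^esub> x = \<zero>\<^bsub>M\<^esub>" if x: "x \<in> carrier M" for x
  proof -
    obtain t where "x = ev t" using x by (auto simp: ev_simps)
    then have "ev (- t) \<oplus>\<^bsub>M\<^esub> x = \<zero>\<^bsub>M\<^esub>" by (simp add: ev_simps(2,3))
    then show ?thesis by (intro bexI[of _ "ev (- t)"]) (auto simp: ev_simps(1))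
  qed
qed (auto simp: ev_simps(1-3) add_ac)

lemma a_inv_ev: "inv\<^bsub>add_monoid M\<^esub> ev t = ev (- t)"
proof -
  interpret abelian_group M by (rule abelian_group_M)
  have "\<ominus>\<^bsub>M\<^esub> ev t = ev (- t)"
    by (rule minus_equality) (simp_all add: ev_simps(1-3))
  then show ?thesis by (simp add: a_inv_def)
qed

lemma submodule_left_ideal:
  assumes "submodule H NWU M"
  shows "left_ideal {t. ev t \<in> H}" "H = ev ` {t. ev t \<in> H}"
proof -
  interpret H: submodule H NWU M by fact
  show "left_ideal {t. ev t \<in> H}"
    unfolding left_ideal_def
  proof (intro conjI ballI allI)
    show "0 \<in> {t. ev t \<in> H}" using H.one_closed by (simp add: ev_simps(3))
    show "s + t \<in> {t. ev t \<in> H}" if "s \<in> {t. ev t \<in> H}" "t \<in> {t. ev t \<in> H}" for s t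
      using that H.m_closed[of "ev s" "ev t"] by (simp add: ev_simps(2))
    show "s * t \<in> {t. ev t \<in> H}" if "t \<in> {t. ev t \<in> H}" for s t
      using that H.smult_closed[of "nwu_class s" "ev t"] by (simp add: ev_simps(4))
  qed
  show "H = ev ` {t. ev t \<in> H}"
    using H.subset by (auto simp: ev_simps(1))
qed

lemma left_ideal_submodule:
  assumes H: "left_ideal H"
  shows "submodule (ev ` H) NWU M"
proof (intro submodule.intro subgroup.intro)
  show "x \<otimes>\<^bsub>add_monoid M\<^esub> y \<in> ev ` H" if "x \<in> ev ` H" "y \<in> ev ` H" for x y
    using that left_idealD[OF H] by (auto simp: ev_simps(2))
  show "inv\<^bsub>add_monoid M\<^esub> x \<in> ev ` H" if "x \<in> ev ` H" for x
    using that subspaceV_minus[OF left_ideal_subspace[OF H]] by (auto simp: a_inv_ev)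
  show "submodule_axioms (ev ` H) NWU M"
    using left_idealD(3)[OF H] by (auto simp: submodule_axioms_def carrier_NWU ev_simps(4))
qed (use left_idealD(1)[OF H] in \<open>auto simp: ev_simps(1,3)\<close>)

text \<open>Submodules correspond to left ideals above \<open>L\<close>, and one that contains
  \<open>1\<close> is everything.\<close>

lemma irreducibleI:
  assumes "1 \<notin> L" and "\<And>H v. left_ideal H \<Longrightarrow> L \<subseteq> H \<Longrightarrow> v \<in> H \<Longrightarrow> v \<notin> L \<Longrightarrow> 1 \<in> H"
  shows "irreducible_module NWU M"
  unfolding irreducible_module_def
proof (intro conjI allI impI)
  have "ev 1 \<noteq> \<zero>\<^bsub>M\<^esub>" "ev 1 \<in> carrier M" using assms(1) by (auto simp: ev_eq_zero ev_simps(1))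
  then show "carrier M \<noteq> {\<zero>\<^bsub>M\<^esub>}" by blast
  fix H assume H: "submodule H NWU M"
  let ?H = "{t. ev t \<in> H}"
  have lid: "left_ideal ?H" and eq: "H = ev ` ?H" using submodule_left_ideal[OF H] by auto
  have LH: "L \<subseteq> ?H"
  proof
    fix x assume "x \<in> L"
    then have "ev x = ev 0" using ev_eq_zero[of x] ev_simps(3) by simp
    then show "x \<in> ?H" using left_idealD(1)[OF lid] by simp
  qed
  show "H = {\<zero>\<^bsub>M\<^esub>} \<or> H = carrier M"
  proof (cases "?H \<subseteq> L")
    case True
    then have "H = ev ` L" using eq LH by auto
    moreover have "ev t = ev 0" if "t \<in> L" for t
      using ev_eq_zero[of t] that ev_simps(3) by simp
    ultimately have "H = {\<zero>\<^bsub>M\<^esub>}"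
      using left_idealD(1)[OF L_left_ideal] unfolding ev_simps(3) by blast
    then show ?thesis ..
  next
    case False
    then have "1 \<in> ?H" using assms(2)[OF lid LH] by blast
    then have "t \<in> ?H" for t using left_idealD(3)[OF lid, of 1 t] by simp
    then show ?thesis using eq by (auto simp: ev_simps(1))
  qed
qed

lemma not_irreducibleI:
  assumes H: "left_ideal H" "L \<subseteq> H" "1 \<notin> H" and x: "x \<in> H" "x \<notin> L"
  shows "\<not> irreducible_module NWU M"
proof -
  have "ev 1 \<notin> ev ` H"
  proof
    assume "ev 1 \<in> ev ` H"
    then obtain h where h: "h \<in> H" "1 - h \<in> L" by (auto simp: ev_simps(5))
    then have "(1 - h) + h \<in> H" using left_idealD(2)[OF H(1)] H(2) by blast
    then show False using H(3) by simp
  qed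
  then have "ev ` H \<noteq> carrier M" by (auto simp: ev_simps(1))
  moreover have "ev ` H \<noteq> {\<zero>\<^bsub>M\<^esub>}" using x ev_eq_zero by blast
  ultimately show ?thesis
    unfolding irreducible_module_def using left_ideal_submodule[OF H(1)] by blast
qed

text \<open>The assumptions make \<open>L'\<close> the sum of \<open>L\<close> and the left ideal
  generated by \<open>b\<close>, which is the preimage of the cyclic submodule.\<close>

lemma quotient_presents:
  assumes b: "b \<in> L'" and L': "left_ideal L'" "L \<subseteq> L'" and gen: "\<And>t. t \<in> L' \<Longrightarrow> \<exists>s. t - s * b \<in> L"
  shows "presents (quotient_module M (cyclic_submodule NWU M (ev b)))
    (\<lambda>t. cyclic_submodule NWU M (ev b) +>\<^bsub>M\<^esub> ev t) L'"
proof -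
  interpret abelian_group M by (rule abelian_group_M)
  let ?H = "cyclic_submodule NWU M (ev b)"
  have H: "?H = ev ` L'"
  proof
    show "?H \<subseteq> ev ` L'"
      using left_idealD(3)[OF L'(1) b] by (auto simp: cyclic_submodule_def carrier_NWU ev_simps(4))
    show "ev ` L' \<subseteq> ?H"
    proof
      fix x assume "x \<in> ev ` L'"
      then obtain t s where "x = ev t" "t - s * b \<in> L" using gen by blast
      then have "x = nwu_class s \<odot>\<^bsub>M\<^esub> ev b" by (simp add: ev_simps(4,5))
      then show "x \<in> ?H" by (auto simp: cyclic_submodule_def)
    qed
  qed
  have coset: "?H +>\<^bsub>M\<^esub> ev t = {ev s | s. s - t \<in> L'}" for t
  proof -
    have "?H +>\<^bsub>M\<^esub> ev t = {ev (h + t) | h. h \<in> L'}"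
      by (auto simp: H a_r_coset_def' ev_simps(2))
    also have "\<dots> = {ev s | s. s - t \<in> L'}"
      by (auto intro: exI[of _ "_ - t"])
    finally show ?thesis .
  qed
  have mem: "ev s \<in> ?H +>\<^bsub>M\<^esub> ev t \<longleftrightarrow> s - t \<in> L'" for s t
  proof
    assume "ev s \<in> ?H +>\<^bsub>M\<^esub> ev t"
    then obtain s' where "s - s' \<in> L" "s' - t \<in> L'" unfolding coset by (auto simp: ev_simps(5))
    then have "(s - s') + (s' - t) \<in> L'" using L' left_idealD(2)[OF L'(1)] by blast
    then show "s - t \<in> L'" by simp
  qed (auto simp: coset)
  have minus: "- t \<in> L'" if "t \<in> L'" for t
    by (rule subspaceV_minus[OF left_ideal_subspace[OF L'(1)] that])
  have eq: "?H +>\<^bsub>M\<^esub> ev s = ?H +>\<^bsub>M\<^esub> ev t \<longleftrightarrow> s - t \<in> L'" for s t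
  proof
    assume "?H +>\<^bsub>M\<^esub> ev s = ?H +>\<^bsub>M\<^esub> ev t"
    moreover have "ev s \<in> ?H +>\<^bsub>M\<^esub> ev s" using left_idealD(1)[OF L'(1)] by (simp add: mem)
    ultimately show "s - t \<in> L'" by (simp add: mem)
  next
    assume st: "s - t \<in> L'"
    have "x - s \<in> L' \<longleftrightarrow> x - t \<in> L'" for x
      using left_idealD(2)[OF L'(1), of "x - s" "s - t"] left_idealD(2)[OF L'(1), of "x - t" "- (s - t)"] st minus[OF st]
      by auto
    then show "?H +>\<^bsub>M\<^esub> ev s = ?H +>\<^bsub>M\<^esub> ev t" unfolding coset by simp
  qed
  show ?thesis
    unfolding presents_def
  proof (intro conjI allI)
    show "carrier (quotient_module M ?H) = range (\<lambda>t. ?H +>\<^bsub>M\<^esub> ev t)"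
      by (auto simp: quotient_module_def A_RCOSETS_def' ev_simps(1))
    show "\<zero>\<^bsub>quotient_module M ?H\<^esub> = ?H +>\<^bsub>M\<^esub> ev 0"
      unfolding quotient_module_def coset by (auto simp: H)
    show "(?H +>\<^bsub>M\<^esub> ev s = ?H +>\<^bsub>M\<^esub> ev t) = (s - t \<in> L')" for s t by (rule eq)
    show "(?H +>\<^bsub>M\<^esub> ev s) \<oplus>\<^bsub>quotient_module M ?H\<^esub> (?H +>\<^bsub>M\<^esub> ev t) = ?H +>\<^bsub>M\<^esub> ev (s + t)" for s t
    proof -
      have "set_add M (?H +>\<^bsub>M\<^esub> ev s) (?H +>\<^bsub>M\<^esub> ev t) = {ev (s' + t') | s' t'. s' - s \<in> L' \<and> t' - t \<in> L'}"
        by (force simp: coset set_add_defs ev_simps(2))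
      also have "\<dots> = {ev u | u. u - (s + t) \<in> L'}"
      proof (intro equalityI subsetI)
        fix x assume "x \<in> {ev (s' + t') | s' t'. s' - s \<in> L' \<and> t' - t \<in> L'}"
        then obtain s' t' where *: "x = ev (s' + t')" "s' - s \<in> L'" "t' - t \<in> L'" by blast
        have "(s' - s) + (t' - t) \<in> L'" by (rule left_idealD(2)[OF L'(1) *(2,3)])
        then have "(s' + t') - (s + t) \<in> L'" by (simp add: algebra_simps)
        then show "x \<in> {ev u | u. u - (s + t) \<in> L'}" using * by blast
      next
        fix x assume "x \<in> {ev u | u. u - (s + t) \<in> L'}"
        then obtain u where u: "x = ev u" "u - (s + t) \<in> L'" by blast
        then have "x = ev ((u - t) + t)" "(u - t) - s \<in> L'" "t - t \<in> L'"
          using left_idealD(1)[OF L'(1)] by (simp_all add: algebra_simps)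
        then show "x \<in> {ev (s' + t') | s' t'. s' - s \<in> L' \<and> t' - t \<in> L'}" by blast
      qed
      finally show ?thesis by (simp add: quotient_module_def coset)
    qed
    show "nwu_class s \<odot>\<^bsub>quotient_module M ?H\<^esub> (?H +>\<^bsub>M\<^esub> ev t) = ?H +>\<^bsub>M\<^esub> ev (s * t)" for s t
    proof -
      have "?H +>\<^bsub>M\<^esub> (nwu_class s \<odot>\<^bsub>M\<^esub> x) = ?H +>\<^bsub>M\<^esub> ev (s * t)" if "x \<in> ?H +>\<^bsub>M\<^esub> ev t" for x
      proof -
        obtain t' where t': "x = ev t'" "t' - t \<in> L'" using \<open>x \<in> _\<close> unfolding coset by blast
        then have "s * t' - s * t \<in> L'" using left_idealD(3)[OF L'(1), of "t' - t" s] by (simp add: right_diff_distrib)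
        then show ?thesis by (simp add: t' ev_simps(4) eq)
      qed
      moreover have "?H +>\<^bsub>M\<^esub> ev t \<noteq> {}" using left_idealD(1)[OF L'(1)] mem[of t t] by auto
      ultimately show ?thesis by (simp add: quotient_module_def)
    qed
  qed
qed

end

lemma presents_isomorphic:
  assumes "presents M ev L" "presents N ev' L"
  shows "module_isomorphic NWU M N"
proof -
  interpret M: presentation M ev L by standard fact
  interpret N: presentation N ev' L by standard fact
  define f where "f x = ev' (SOME t. ev t = x)" for x
  have f: "f (ev t) = ev' t" for t
  proof -
    have "ev (SOME t'. ev t' = ev t) = ev t" by (rule someI[of _ t]) simp
    then show ?thesis unfolding f_def by (simp add: M.ev_simps(5) N.ev_simps(5))
  qed
  have "bij_betw f (carrier M) (carrier N)"
    by (auto simp: bij_betw_def inj_on_def M.ev_simps(1,5) N.ev_simps(1,5) f image_image)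
  moreover have "\<forall>x\<in>carrier M. \<forall>y\<in>carrier M. f (x \<oplus>\<^bsub>M\<^esub> y) = f x \<oplus>\<^bsub>N\<^esub> f y"
    by (auto simp: M.ev_simps(1,2) N.ev_simps(2) f)
  moreover have "\<forall>r\<in>carrier NWU. \<forall>x\<in>carrier M. f (r \<odot>\<^bsub>M\<^esub> x) = r \<odot>\<^bsub>N\<^esub> f x"
    by (auto simp: M.ev_simps(1,4) N.ev_simps(4) f carrier_NWU)
  ultimately show ?thesis unfolding module_isomorphic_def by blast
qed

text \<open>Realizes the quotient by \<open>L\<close> inside the ambient space, so that operators on
  the quotient have the type required by the operator locales. A basis of \<open>L\<close> is
  extended to the whole space; the old basis vectors are killed, the new ones fixed.\<close>

lemma subspace_projection:
  assumes L: "subspaceV L"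
  obtains \<pi> :: "('i \<Rightarrow>\<^sub>0 complex) \<Rightarrow> ('i \<Rightarrow>\<^sub>0 complex)"
  where "linear_op \<pi>" "\<And>v. \<pi> v = 0 \<longleftrightarrow> v \<in> L" "\<And>v. v - \<pi> v \<in> L"
proof -
  interpret vs: vector_space "scaleV :: complex \<Rightarrow> ('i \<Rightarrow>\<^sub>0 complex) \<Rightarrow> ('i \<Rightarrow>\<^sub>0 complex)"
    by standard (simp_all add: scaleV_add_right scaleV_add_left)
  interpret vp: vector_space_pair scaleV "scaleV :: complex \<Rightarrow> ('i \<Rightarrow>\<^sub>0 complex) \<Rightarrow> ('i \<Rightarrow>\<^sub>0 complex)"
    by unfold_locales (simp_all add: scaleV_add_right scaleV_add_left)
  have sub: "vs.subspace L" using L by (auto simp: vs.subspace_def subspaceV_def)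
  obtain B where B: "B \<subseteq> L" "vs.independent B" "L \<subseteq> vs.span B" "vs.span B = L"
    using vs.basis_exists[of L] vs.span_subspace[OF _ _ sub] by metis
  let ?E = "vs.extend_basis B"
  have E: "vs.independent ?E" "B \<subseteq> ?E" "vs.span ?E = UNIV"
    using vs.independent_extend_basis[OF B(2)] vs.extend_basis_superset[OF B(2)] vs.span_extend_basis[OF B(2)] by auto
  let ?f = "\<lambda>b. if b \<in> B then 0 else b"
  define \<pi> where "\<pi> = vp.construct ?E ?f"
  have lin: "Vector_Spaces.linear scaleV scaleV \<pi>"
    unfolding \<pi>_def by (rule vp.linear_construct[OF E(1)])
  have basis: "\<pi> b = ?f b" if "b \<in> ?E" for b
    unfolding \<pi>_def by (rule vp.construct_basis[OF E(1) that])
  have lo: "linear_op \<pi>"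
    using lin by (auto simp: linear_op_def Vector_Spaces.linear_iff module_hom_iff)
  have L0: "\<pi> v = 0" if "v \<in> L" for v
  proof -
    have "v \<in> vs.span B" using that B by blast
    then show ?thesis
      by (induction rule: vs.span_induct_alt) (use basis E(2) in \<open>auto simp: lin_zero[OF lo] lin_add[OF lo] lin_scale[OF lo]\<close>)
  qed
  have d: "v - \<pi> v \<in> L" for v
  proof -
    have "v \<in> vs.span ?E" using E(3) by simp
    then show ?thesis
    proof (induction rule: vs.span_induct_alt)
      case base
      then show ?case using subspaceV_zero[OF L] by (simp add: lin_zero[OF lo])
    next
      case (step c x y)
      have "x - \<pi> x \<in> L" using basis[OF step(1)] B(1) subspaceV_zero[OF L] by auto
      then have "scaleV c (x - \<pi> x) + (y - \<pi> y) \<in> L"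
        using step by (intro subspaceV_add[OF L] subspaceV_scale[OF L])
      moreover have "scaleV c (x - \<pi> x) + (y - \<pi> y) = scaleV c x + y - \<pi> (scaleV c x + y)"
        by (simp add: lin_add[OF lo] lin_scale[OF lo] scaleV_diff_right)
      ultimately show ?case by simp
    qed
  qed
  have "\<pi> v = 0 \<longleftrightarrow> v \<in> L" for v using L0[of v] d[of v] by auto
  then show ?thesis using that[of \<pi>] lo d by blast
qed

section \<open>The induced modules\<close>

text \<open>For \<open>\<epsilon> = 0\<close> the subalgebra contains both \<open>a(-m)\<close> and
  \<open>b(m)\<close>, whose bracket is \<open>c(0) - m k\<close>; a character has to vanish there,
  which forces \<open>cc = m\<close>.\<close>

locale nw_induced =
  fixes m \<epsilon> :: int and cc dd :: complex
  assumes \<epsilon>: "\<epsilon> = 1 \<or> \<epsilon> = 0 \<and> cc = of_int m"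
begin

sublocale sub: lie_span nw_br "nw_sub m \<epsilon>"
proof
  fix i j assume "i \<in> nw_sub m \<epsilon>" "j \<in> nw_sub m \<epsilon>"
  then show "Poly_Mapping.keys (nw_br i j) \<subseteq> nw_sub m \<epsilon>"
    using \<epsilon>
    by (cases i; cases j; (cases "case i of At x p \<Rightarrow> x | KK \<Rightarrow> Ha"; cases "case j of At x p \<Rightarrow> x | KK \<Rightarrow> Ha")?)
      (auto simp: nw_sub_def dest!: subsetD[OF Poly_Mapping.keys_add] split: if_splits)
qed

text \<open>The character as an action on a one-dimensional space, so that the universal property
  yields its vanishing on the ideal.\<close>

definition char_act :: "nw \<Rightarrow> (unit \<Rightarrow>\<^sub>0 complex) \<Rightarrow> (unit \<Rightarrow>\<^sub>0 complex)" where
  "char_act x v = scaleV (nw_char cc dd x) v"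

lemma char_act_lin: "linear_op (char_act x)"
  unfolding char_act_def by (intro linear_op_scale linear_op_ident)

lemma foldr_char_act: "foldr char_act xs v = scaleV (prod_list (map (nw_char cc dd) xs)) v"
  by (induction xs) (simp_all add: char_act_def)

lemma tact_char_act: "tact char_act t v = scaleV (nw_char_tensor cc dd t) v"
  by (simp add: tact_def lext_def foldr_char_act nw_char_tensor_def scaleV_sum_left)

lemma char_add: "nw_char_tensor cc dd (s + t) = nw_char_tensor cc dd s + nw_char_tensor cc dd t"
  and char_mult: "nw_char_tensor cc dd (s * t) = nw_char_tensor cc dd s * nw_char_tensor cc dd t"
proof -
  let ?v = "Poly_Mapping.single () (1::complex)"
  have *: "scaleV y ?v = scaleV z ?v \<longleftrightarrow> y = z" for y z by (metis lookup_single_eq scaleV_single mult_1_right)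
  show "nw_char_tensor cc dd (s + t) = nw_char_tensor cc dd s + nw_char_tensor cc dd t"
    using tact_add[of char_act s t ?v] unfolding tact_char_act scaleV_add_left[symmetric] * .
  show "nw_char_tensor cc dd (s * t) = nw_char_tensor cc dd s * nw_char_tensor cc dd t"
    using tact_mult[of char_act s t ?v, OF char_act_lin] unfolding tact_char_act scaleV_scaleV * .
qed

lemma char_single: "nw_char_tensor cc dd (Poly_Mapping.single w z) = z * prod_list (map (nw_char cc dd) (letters w))"
  by (cases "z = 0") (simp_all add: nw_char_tensor_def)

text \<open>Inside the subalgebra a central term can occur only between modes at the lower bounds,
  and there its scalar vanishes.\<close>

lemma central_term_zero:
  fixes x y :: int
  shows "x + y = 0 \<Longrightarrow> - m \<le> x \<Longrightarrow> m \<le> y \<Longrightarrow> scaleV (of_int m + of_int x) v = 0"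
    "x + y = 0 \<Longrightarrow> m \<le> x \<Longrightarrow> - m \<le> y \<Longrightarrow> scaleV (of_int x - of_int m) v = 0"
    "x + y = 0 \<Longrightarrow> 0 \<le> x \<Longrightarrow> 0 \<le> y \<Longrightarrow> scaleV (of_int x) v = 0"
  by (simp_all add: scaleV_eq_0_iff flip: of_int_add of_int_diff)

lemma char_ideal: "t \<in> uea_ideal nw_br (nw_sub m \<epsilon>) \<Longrightarrow> nw_char_tensor cc dd t = 0"
proof -
  assume t: "t \<in> uea_ideal nw_br (nw_sub m \<epsilon>)"
  have "tact char_act t (Poly_Mapping.single () 1) = 0"
  proof (rule sub.uea_ideal_annihilates[OF char_act_lin _ t])
    fix i j v assume "i \<in> nw_sub m \<epsilon>" "j \<in> nw_sub m \<epsilon>"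
    then have "lext (\<lambda>k. char_act k v) (nw_br i j) = 0"
      using \<epsilon>
      by (cases i; cases j; (cases "case i of At x p \<Rightarrow> x | KK \<Rightarrow> Ha"; cases "case j of At x p \<Rightarrow> x | KK \<Rightarrow> Ha")?)
        (auto simp: nw_sub_def lin_add[OF lext_lin] lin_zero[OF lext_lin] char_act_def
          simp flip: scaleV_add_left intro: central_term_zero)
    then show "char_act i (char_act j v) - char_act j (char_act i v) = lext (\<lambda>k. char_act k v) (nw_br i j)"
      by (simp add: char_act_def mult.commute)
  qed
  then show ?thesis by (metis tact_char_act scaleV_single mult_1_right lookup_single_eq lookup_zero)
qed

section \<open>The tensor product as a quotient of a free abelian group\<close>

abbreviation "P \<equiv> uea nw_br (nw_sub m \<epsilon>)"
abbreviation "N \<equiv> nw_line cc dd"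
abbreviation "F \<equiv> free_Abelian_group (carrier NWU \<times> carrier N)"
abbreviation "Kn \<equiv> tensor_kernel P nwu_incl NWU N"

lemma carrier_N [simp]: "carrier N = UNIV" and add_N [simp]: "y \<oplus>\<^bsub>N\<^esub> z = y + z"
  by (simp_all add: nw_line_def)

lemma smult_N:
  assumes "t \<in> carrier (tensor_alg (nw_sub m \<epsilon>))"
  shows "sub.cls t \<odot>\<^bsub>N\<^esub> z = nw_char_tensor cc dd t * z"
proof -
  have "nw_char_tensor cc dd ` sub.cls t = {nw_char_tensor cc dd t}"
    using sub.I_zero by (auto simp: sub.cls_set char_add char_ideal image_iff intro!: exI[of _ t] exI[of _ 0])
  then show ?thesis by (simp add: nw_line_def)
qed

lemma sub_ideal_subset: "uea_ideal nw_br (nw_sub m \<epsilon>) \<subseteq> uea_ideal nw_br UNIV"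
proof -
  let ?J = "uea_ideal nw_br UNIV \<inter> carrier (tensor_alg (nw_sub m \<epsilon>))"
  have "ideal ?J (tensor_alg (nw_sub m \<epsilon>))"
    by (rule tensor_alg_idealI)
       (auto simp: full.I_zero full.I_add full.I_minus full.I_mult tensor_alg_zero tensor_alg_add tensor_alg_minus tensor_alg_mult)
  moreover have "sub.rels \<subseteq> ?J"
    using sub.rels_carrier full.rels_I unfolding sub.rels_def full.rels_def by blast
  ultimately show ?thesis using sub.uea_ideal_minimal by blast
qed

lemma nwu_incl_cls: "nwu_incl (sub.cls t) = nwu_class t"
proof -
  have "nwu_incl (sub.cls t) = {i + (j + t) | i j. i \<in> uea_ideal nw_br UNIV \<and> j \<in> uea_ideal nw_br (nw_sub m \<epsilon>)}"
    by (auto simp: nwu_incl_def set_add_defs sub.cls_set)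
  also have "\<dots> = nwu_class t"
  proof (intro equalityI subsetI)
    fix x assume "x \<in> {i + (j + t) | i j. i \<in> uea_ideal nw_br UNIV \<and> j \<in> uea_ideal nw_br (nw_sub m \<epsilon>)}"
    then obtain i j where *: "x = (i + j) + t" "i \<in> uea_ideal nw_br UNIV" "j \<in> uea_ideal nw_br UNIV"
      using sub_ideal_subset by (auto simp: add.assoc)
    then show "x \<in> nwu_class t"
      using full.I_add[OF *(2,3)] by (auto simp: nwu_class_eq_cls full.cls_set)
  next
    fix x assume "x \<in> nwu_class t"
    then obtain i where "x = i + (0 + t)" "i \<in> uea_ideal nw_br UNIV" by (auto simp: nwu_class_eq_cls full.cls_set)
    then show "x \<in> {i + (j + t) | i j. i \<in> uea_ideal nw_br UNIV \<and> j \<in> uea_ideal nw_br (nw_sub m \<epsilon>)}"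
      using sub.I_zero by blast
  qed
  finally show ?thesis .
qed

definition gensK :: "((nw word \<Rightarrow>\<^sub>0 complex) set \<times> complex \<Rightarrow>\<^sub>0 int) set" where
  "gensK = {frag_of (u \<oplus>\<^bsub>NWU\<^esub> u', z) - frag_of (u, z) - frag_of (u', z) | u u' z.
           u \<in> carrier NWU \<and> u' \<in> carrier NWU \<and> z \<in> carrier N} \<union>
        {frag_of (u, z \<oplus>\<^bsub>N\<^esub> z') - frag_of (u, z) - frag_of (u, z') | u z z'.
           u \<in> carrier NWU \<and> z \<in> carrier N \<and> z' \<in> carrier N} \<union>
        {frag_of (u \<otimes>\<^bsub>NWU\<^esub> nwu_incl p, z) - frag_of (u, p \<odot>\<^bsub>N\<^esub> z) | u p z.
           u \<in> carrier NWU \<and> p \<in> carrier P \<and> z \<in> carrier N}"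

lemma Kn_eq: "Kn = generate F gensK"
  by (simp add: tensor_kernel_def gensK_def)

lemma gensK_cases:
  assumes "h \<in> gensK"
  obtains (1) s t z where "h = frag_of (nwu_class (s + t), z) - frag_of (nwu_class s, z) - frag_of (nwu_class t, z)"
  | (2) t y z where "h = frag_of (nwu_class t, y + z) - frag_of (nwu_class t, y) - frag_of (nwu_class t, z)"
  | (3) s t z where "t \<in> carrier (tensor_alg (nw_sub m \<epsilon>))"
     "h = frag_of (nwu_class (s * t), z) - frag_of (nwu_class s, nw_char_tensor cc dd t * z)"
  using assms unfolding gensK_def
  by (auto simp: carrier_NWU sub.carrier_uea nwu_class_ops nwu_incl_cls smult_N)

lemma gensK_I:
  "frag_of (nwu_class (s + t), z) - frag_of (nwu_class s, z) - frag_of (nwu_class t, z) \<in> gensK"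
  "frag_of (nwu_class t, y + z) - frag_of (nwu_class t, y) - frag_of (nwu_class t, z) \<in> gensK"
  "t' \<in> carrier (tensor_alg (nw_sub m \<epsilon>)) \<Longrightarrow>
     frag_of (nwu_class (s * t'), z) - frag_of (nwu_class s, nw_char_tensor cc dd t' * z) \<in> gensK"
proof -
  show "frag_of (nwu_class (s + t), z) - frag_of (nwu_class s, z) - frag_of (nwu_class t, z) \<in> gensK"
    unfolding gensK_def nwu_class_ops(2)[symmetric] using nwu_class_carrier carrier_N by blast
  show "frag_of (nwu_class t, y + z) - frag_of (nwu_class t, y) - frag_of (nwu_class t, z) \<in> gensK"
    unfolding gensK_def add_N[symmetric] using nwu_class_carrier carrier_N by blast
  assume t': "t' \<in> carrier (tensor_alg (nw_sub m \<epsilon>))"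
  then have "sub.cls t' \<in> carrier P" by (simp add: sub.carrier_uea)
  then show "frag_of (nwu_class (s * t'), z) - frag_of (nwu_class s, nw_char_tensor cc dd t' * z) \<in> gensK"
    unfolding gensK_def nwu_class_ops(1)[symmetric] smult_N[OF t', symmetric] nwu_incl_cls[of t', symmetric]
    using nwu_class_carrier carrier_N by blast
qed

lemma gensK_carrier: "gensK \<subseteq> carrier F"
proof
  fix h assume "h \<in> gensK"
  then show "h \<in> carrier F"
    by (cases rule: gensK_cases) (auto dest!: subsetD[OF keys_diff])
qed

lemma Kn_subgroup: "subgroup Kn F"
  unfolding Kn_eq by (rule group.generate_is_subgroup[OF group_free_Abelian_group gensK_carrier])

lemma Kn_zero: "0 \<in> Kn" and Kn_add: "f \<in> Kn \<Longrightarrow> g \<in> Kn \<Longrightarrow> f + g \<in> Kn"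
  using subgroup.one_closed[OF Kn_subgroup] subgroup.m_closed[OF Kn_subgroup, of f g] by simp_all

lemma Kn_carrier: "Kn \<subseteq> carrier F"
  by (rule subgroup.subset[OF Kn_subgroup])

lemma Kn_minus: "f \<in> Kn \<Longrightarrow> - f \<in> Kn"
proof -
  assume f: "f \<in> Kn"
  then have "f \<in> carrier F" using Kn_carrier by blast
  then show "- f \<in> Kn" using subgroup.m_inv_closed[OF Kn_subgroup f] by simp
qed

lemma Kn_diff: "f \<in> Kn \<Longrightarrow> g \<in> Kn \<Longrightarrow> f - g \<in> Kn"
  using Kn_add[of f "- g"] Kn_minus[of g] by simp

lemma Kn_induct [consumes 1, case_names zero gen minus add]:
  assumes "f \<in> Kn" "Q 0" "\<And>h. h \<in> gensK \<Longrightarrow> Q h" "\<And>h. Q h \<Longrightarrow> Q (- h)" "\<And>f g. Q f \<Longrightarrow> Q g \<Longrightarrow> Q (f + g)"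
  shows "Q f"
  using assms(1) unfolding Kn_eq
proof (induction rule: generate.induct)
  case (inv h)
  then have "h \<in> carrier F" using gensK_carrier by blast
  then show ?case using assms(3,4) inv by simp
qed (use assms in auto)

definition qf :: "((nw word \<Rightarrow>\<^sub>0 complex) set \<times> complex \<Rightarrow>\<^sub>0 int) \<Rightarrow> nwv" where
  "qf f = Kn #>\<^bsub>F\<^esub> f"

lemma qf_set: "qf f = {k + f | k. k \<in> Kn}"
  by (auto simp: qf_def r_coset_def)

lemma qf_eq_iff: "qf f = qf g \<longleftrightarrow> f - g \<in> Kn"
proof
  assume "qf f = qf g"
  moreover have "f \<in> qf f" using Kn_zero by (force simp: qf_set)
  ultimately show "f - g \<in> Kn" by (auto simp: qf_set)
next
  assume d: "f - g \<in> Kn"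
  show "qf f = qf g"
  proof (intro equalityI subsetI)
    fix x assume "x \<in> qf f"
    then obtain k where "k \<in> Kn" "x = (k + (f - g)) + g" by (auto simp: qf_set)
    then show "x \<in> qf g" using Kn_add[of k "f - g"] d unfolding qf_set by blast
  next
    fix x assume "x \<in> qf g"
    then obtain k where "k \<in> Kn" "x = (k - (f - g)) + f" by (auto simp: qf_set)
    then show "x \<in> qf f" using Kn_diff[of k "f - g"] d unfolding qf_set by blast
  qed
qed

abbreviation "V \<equiv> nw_verma cc dd m \<epsilon>"

lemma V_carrier: "carrier V = qf ` carrier F"
  by (auto simp: nw_verma_def extend_scalars_def Let_def FactGroup_def RCOSETS_def qf_def)

lemma V_zero: "\<zero>\<^bsub>V\<^esub> = qf 0"
  by (simp add: nw_verma_def extend_scalars_def Let_def FactGroup_def qf_set)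

lemma V_add: "qf f \<oplus>\<^bsub>V\<^esub> qf g = qf (f + g)"
proof -
  have "qf f \<oplus>\<^bsub>V\<^esub> qf g = {a + b | a b. a \<in> qf f \<and> b \<in> qf g}"
    by (auto simp: nw_verma_def extend_scalars_def Let_def FactGroup_def set_mult_def)
  also have "\<dots> = qf (f + g)"
  proof (intro equalityI subsetI)
    fix x assume "x \<in> {a + b | a b. a \<in> qf f \<and> b \<in> qf g}"
    then obtain k l where "k \<in> Kn" "l \<in> Kn" "x = (k + l) + (f + g)" by (auto simp: qf_set algebra_simps)
    then show "x \<in> qf (f + g)" using Kn_add unfolding qf_set by blast
  next
    fix x assume "x \<in> qf (f + g)"
    then obtain k where "k \<in> Kn" "x = (k + f) + (0 + g)" by (auto simp: qf_set algebra_simps)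
    then show "x \<in> {a + b | a b. a \<in> qf f \<and> b \<in> qf g}" using Kn_zero unfolding qf_set by blast
  qed
  finally show ?thesis .
qed

definition phi :: "(nw word \<Rightarrow>\<^sub>0 complex) \<Rightarrow> ((nw word \<Rightarrow>\<^sub>0 complex) set \<times> complex \<Rightarrow>\<^sub>0 int) \<Rightarrow> _" where
  "phi r = frag_extend (\<lambda>(u, z). frag_of (nwu_class r \<otimes>\<^bsub>NWU\<^esub> u, z))"

lemma phi_of: "phi r (frag_of (nwu_class t, z)) = frag_of (nwu_class (r * t), z)"
  by (simp add: phi_def nwu_class_ops)

lemma phi_diff: "phi r (f - g) = phi r f - phi r g" and phi_add: "phi r (f + g) = phi r f + phi r g"
  and phi_minus: "phi r (- f) = - phi r f" and phi_zero: "phi r 0 = 0"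
  by (simp_all add: phi_def frag_extend_diff frag_extend_add frag_extend_minus)

text \<open>Left multiplication commutes with the right multiplication used in balancing, so each
  family of generators is mapped into itself.\<close>

lemma phi_Kn: "f \<in> Kn \<Longrightarrow> phi r f \<in> Kn"
proof (induction rule: Kn_induct)
  case (gen h)
  have "phi r h \<in> gensK" using gen
  proof (cases rule: gensK_cases)
    case (1 s t z)
    then show ?thesis using gensK_I(1)[of "r * s" "r * t" z] by (simp add: phi_diff phi_of distrib_left)
  next
    case (2 t y z)
    then show ?thesis using gensK_I(2)[of "r * t" y z] by (simp add: phi_diff phi_of)
  next
    case (3 s t z)
    then show ?thesis using gensK_I(3)[of t "r * s" z] by (simp add: phi_diff phi_of mult.assoc)
  qed
  then show ?case unfolding Kn_eq by (rule generate.incl)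
qed (simp_all add: phi_zero phi_minus phi_add Kn_zero Kn_minus Kn_add)

lemma V_smult: "nwu_class r \<odot>\<^bsub>V\<^esub> qf f = qf (phi r f)"
proof -
  have "nwu_class r \<odot>\<^bsub>V\<^esub> qf f = (\<Union>g\<in>qf f. qf (phi r g))"
    by (simp add: nw_verma_def extend_scalars_def Let_def phi_def qf_def)
  also have "\<dots> = (\<Union>g\<in>qf f. qf (phi r f))"
  proof (rule SUP_cong[OF refl])
    fix g assume g: "g \<in> qf f"
    obtain k where k: "k \<in> Kn" "g = k + f" using g by (auto simp: qf_set)
    have "phi r g - phi r f = phi r k" by (simp add: k(2) phi_add)
    then show "qf (phi r g) = qf (phi r f)" unfolding qf_eq_iff using phi_Kn[OF k(1)] by metis
  qed
  also have "\<dots> = qf (phi r f)"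
  proof -
    have "f \<in> qf f" using Kn_zero by (force simp: qf_set)
    then show ?thesis by blast
  qed
  finally show ?thesis .
qed

section \<open>The presentation of the induced module by the left ideal \<open>L\<close>\<close>

definition ev :: "(nw word \<Rightarrow>\<^sub>0 complex) \<Rightarrow> nwv" where
  "ev t = qf (frag_of (nwu_class t, 1))"

definition L :: "(nw word \<Rightarrow>\<^sub>0 complex) set" where
  "L = {t. ev t = ev 0}"

lemma incl_Kn: "h \<in> gensK \<Longrightarrow> h \<in> Kn"
  unfolding Kn_eq by (rule generate.incl)

lemma ev_add: "ev s \<oplus>\<^bsub>V\<^esub> ev t = ev (s + t)"
proof -
  have "f + g - h = - (h - f - g)" for f g h :: "(nw word \<Rightarrow>\<^sub>0 complex) set \<times> complex \<Rightarrow>\<^sub>0 int"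
    by simp
  then show ?thesis
    unfolding ev_def V_add qf_eq_iff using Kn_minus[OF incl_Kn[OF gensK_I(1)[of s t 1]]] by metis
qed

lemma ev_zero: "\<zero>\<^bsub>V\<^esub> = ev 0"
proof -
  have "frag_of (nwu_class (0 + 0), 1) - frag_of (nwu_class 0, 1) - frag_of (nwu_class 0, 1) =
      0 - frag_of (nwu_class 0, 1 :: complex)" by simp
  then show ?thesis
    unfolding ev_def V_zero qf_eq_iff using incl_Kn[OF gensK_I(1)[of 0 0 1]] by metis
qed

lemma ev_smult: "nwu_class s \<odot>\<^bsub>V\<^esub> ev t = ev (s * t)"
  unfolding ev_def V_smult phi_of ..

lemma letters_zero: "letters 0 = []"
  by (simp add: zero_word_def)

text \<open>Scalars belong to the enveloping algebra of the subalgebra, so balancing moves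
  \<open>z\<close> across the tensor sign. Hence every element of the tensor product has second
  factor \<open>1\<close>.\<close>

lemma qf_scalar: "qf (frag_of (nwu_class t, z)) = ev (scaleV z t)"
proof -
  have "frag_of (nwu_class (t * Poly_Mapping.single 0 z), 1) - frag_of (nwu_class t, nw_char_tensor cc dd (Poly_Mapping.single 0 z) * 1) \<in> Kn"
    by (intro incl_Kn gensK_I tensor_alg_scalar)
  then have "frag_of (nwu_class (scaleV z t), 1) - frag_of (nwu_class t, z) \<in> Kn"
    by (simp add: single_zero_commute char_single letters_zero)
  then show ?thesis unfolding ev_def by (metis qf_eq_iff)
qed

lemma ev_diff: "qf f = ev s \<Longrightarrow> qf g = ev t \<Longrightarrow> qf (f - g) = ev (s - t)"
proof -
  assume fg: "qf f = ev s" "qf g = ev t"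
  have "ev s = qf (frag_of (nwu_class (s - t), 1) + frag_of (nwu_class t, 1))"
    using ev_add[of "s - t" t] by (simp add: ev_def V_add)
  then have "f - (frag_of (nwu_class (s - t), 1) + frag_of (nwu_class t, 1)) \<in> Kn"
    using fg(1) by (simp add: qf_eq_iff)
  moreover have "g - frag_of (nwu_class t, 1) \<in> Kn" using fg(2) by (simp add: ev_def qf_eq_iff)
  ultimately have "f - (frag_of (nwu_class (s - t), 1) + frag_of (nwu_class t, 1)) - (g - frag_of (nwu_class t, 1)) \<in> Kn"
    by (rule Kn_diff)
  then show ?thesis unfolding ev_def qf_eq_iff by (simp add: algebra_simps)
qed

lemma ev_surj: "f \<in> carrier F \<Longrightarrow> \<exists>t. qf f = ev t"
  unfolding carrier_free_Abelian_group_iff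
proof (induction rule: frag_induction)
  case zero
  then show ?case using ev_zero V_zero by metis
next
  case (one x)
  then obtain t z where "x = (nwu_class t, z)" by (auto simp: carrier_NWU)
  then show ?case using qf_scalar by blast
next
  case (diff f g)
  then show ?case using ev_diff by blast
qed

lemma ev_eq_iff: "ev s = ev t \<longleftrightarrow> s - t \<in> L"
proof
  assume "ev s = ev t"
  then have d: "frag_of (nwu_class s, 1) - frag_of (nwu_class t, 1) - 0 \<in> Kn"
    unfolding ev_def qf_eq_iff by simp
  have "qf (frag_of (nwu_class s, 1) - frag_of (nwu_class t, 1)) = ev (s - t)"
    by (rule ev_diff) (simp_all only: ev_def)
  moreover have "qf (frag_of (nwu_class s, 1) - frag_of (nwu_class t, 1)) = ev 0"
    using d qf_eq_iff ev_zero V_zero by metis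
  ultimately show "s - t \<in> L" by (simp add: L_def)
next
  assume "s - t \<in> L"
  then have "ev (s - t) = ev 0" by (simp add: L_def)
  then have "ev ((s - t) + t) = ev (0 + t)" by (simp only: ev_add[symmetric])
  then show "ev s = ev t" by simp
qed

lemma V_presents: "presents V ev L"
  unfolding presents_def
proof (intro conjI allI)
  show "carrier V = range ev"
  proof
    show "carrier V \<subseteq> range ev" unfolding V_carrier using ev_surj by blast
    show "range ev \<subseteq> carrier V" unfolding V_carrier ev_def by auto
  qed
qed (simp_all add: ev_add ev_zero ev_smult ev_eq_iff)

lemma vac_eq: "nw_vac cc dd m \<epsilon> = ev 1"
  by (simp add: nw_vac_def pure_tensor_def ev_def qf_def nwu_class_ops)

sublocale presentation V ev L
  by standard (rule V_presents)

lemma ideal_L: "t \<in> uea_ideal nw_br UNIV \<Longrightarrow> t \<in> L"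
  using nwu_class_eq_iff[of t 0] by (simp add: L_def ev_def)

lemma gen_L: "x \<in> nw_sub m \<epsilon> \<Longrightarrow> gen x - Poly_Mapping.single 0 (nw_char cc dd x) \<in> L"
proof -
  assume x: "x \<in> nw_sub m \<epsilon>"
  have "frag_of (nwu_class (1 * gen x), 1) - frag_of (nwu_class 1, nw_char_tensor cc dd (gen x) * 1) \<in> Kn"
    by (intro incl_Kn gensK_I tensor_alg_gen x)
  then have "ev (gen x) = qf (frag_of (nwu_class 1, nw_char cc dd x))"
    by (simp add: ev_def qf_eq_iff char_single)
  then show ?thesis by (simp add: qf_scalar ev_eq_iff scaleV_conv_mult)
qed

text \<open>With \<open>ideal_L\<close> and \<open>gen_L\<close> this characterizes \<open>L\<close>
  as the left ideal generated by the bracket relations and the elements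
  \<open>x - \<chi>(x)\<close>, where \<open>\<chi>\<close> is the character. The proof maps the
  free abelian group additively to tensors modulo \<open>L'\<close> and checks that the tensor
  kernel goes to zero.\<close>

lemma L_minimal:
  assumes L': "left_ideal L'" and I: "uea_ideal nw_br UNIV \<subseteq> L'"
    and gens: "\<And>x. x \<in> nw_sub m \<epsilon> \<Longrightarrow> gen x - Poly_Mapping.single 0 (nw_char cc dd x) \<in> L'"
  shows "L \<subseteq> L'"
proof -
  have sub: "subspaceV L'" by (rule left_ideal_subspace[OF L'])
  obtain \<pi> where lin: "linear_op \<pi>" and ker: "\<And>v. \<pi> v = 0 \<longleftrightarrow> v \<in> L'"
    and "\<And>v. v - \<pi> v \<in> L'"
    by (rule subspace_projection[OF sub], rule that)
  have right: "s * (t - Poly_Mapping.single 0 (nw_char_tensor cc dd t)) \<in> L'"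
    if "t \<in> carrier (tensor_alg (nw_sub m \<epsilon>))" for s t
  proof -
    have word: "Poly_Mapping.single (Word xs) 1 - Poly_Mapping.single 0 (nw_char_tensor cc dd (Poly_Mapping.single (Word xs) 1)) \<in> L'"
      if "set xs \<subseteq> nw_sub m \<epsilon>" for xs
      using that
    proof (induction xs)
      case Nil
      have "nw_char_tensor cc dd (Poly_Mapping.single (Word []) 1) = 1" by (simp add: char_single)
      then show ?case using left_idealD(1)[OF L'] by (simp only: zero_word_def diff_self)
    next
      case (Cons x xs)
      let ?z = "nw_char_tensor cc dd (Poly_Mapping.single (Word xs) 1)"
      \<comment> \<open>The decomposition \<open>x w - \<chi>(x w) = x (w - \<chi>(w)) + \<chi>(w)
        (x - \<chi>(x))\<close> uses left multiples only, as \<open>L'\<close> is merely a left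
        ideal.\<close>
      have "gen x * (Poly_Mapping.single (Word xs) 1 - Poly_Mapping.single 0 ?z) \<in> L'"
        using Cons by (intro left_idealD(3)[OF L']) auto
      moreover have "Poly_Mapping.single 0 ?z * (gen x - Poly_Mapping.single 0 (nw_char cc dd x)) \<in> L'"
        using Cons by (intro left_idealD(3)[OF L'] gens) auto
      ultimately have "gen x * (Poly_Mapping.single (Word xs) 1 - Poly_Mapping.single 0 ?z) +
          Poly_Mapping.single 0 ?z * (gen x - Poly_Mapping.single 0 (nw_char cc dd x)) \<in> L'"
        by (rule left_idealD(2)[OF L'])
      moreover have "gen x * (Poly_Mapping.single (Word xs) 1 - Poly_Mapping.single 0 ?z) =
          Poly_Mapping.single (Word (x # xs)) 1 - scaleV ?z (gen x)"
        by (simp only: right_diff_distrib gen_times_word single_zero_commute)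
      moreover have "Poly_Mapping.single 0 ?z * (gen x - Poly_Mapping.single 0 (nw_char cc dd x)) =
          scaleV ?z (gen x) - Poly_Mapping.single 0 (?z * nw_char cc dd x)"
        by (simp only: right_diff_distrib scaleV_conv_mult[symmetric] scaleV_single)
      moreover have "nw_char_tensor cc dd (Poly_Mapping.single (Word (x # xs)) 1) = ?z * nw_char cc dd x"
        by (simp add: char_single)
      ultimately show ?case by simp
    qed
    have "t - Poly_Mapping.single 0 (nw_char_tensor cc dd t) \<in> L'"
      if "Poly_Mapping.keys t \<subseteq> {w. set (letters w) \<subseteq> nw_sub m \<epsilon>}" for t
      using that
    proof (induction t rule: vec_induct_on)
      case (single w)
      then show ?case using word[of "letters w"] by simp
    next
      case (add u v)
      from subspaceV_add[OF sub add] show ?case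
        by (simp only: char_add single_add add_diff_add)
    next
      case (scale z v)
      have "nw_char_tensor cc dd (scaleV z v) = z * nw_char_tensor cc dd v"
        by (simp add: scaleV_conv_mult char_mult char_single letters_zero)
      then show ?case using subspaceV_scale[OF sub scale, of z] by (simp add: scaleV_diff_right)
    qed (use left_idealD(1)[OF L'] in \<open>simp add: nw_char_tensor_def\<close>)
    then have "t - Poly_Mapping.single 0 (nw_char_tensor cc dd t) \<in> L'"
      using that by (auto simp: carrier_tensor_alg)
    then show ?thesis by (rule left_idealD(3)[OF L'])
  qed
  \<comment> \<open>Any representative will do: two of them differ by the defining ideal, which lies
    in \<open>L'\<close> and is killed by \<open>\<pi>\<close>.\<close>
  define rep where "rep u = (SOME t. nwu_class t = u)" for u
  have rep: "\<pi> (rep (nwu_class t)) = \<pi> t" for t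
  proof -
    have "nwu_class (rep (nwu_class t)) = nwu_class t" unfolding rep_def by (rule someI[of _ t]) simp
    then have "rep (nwu_class t) - t \<in> L'" using I by (auto simp: nwu_class_eq_iff)
    then show ?thesis using ker by (simp add: lin_diff[OF lin] flip: ker)
  qed
  \<comment> \<open>The additive map that sends the pair \<open>(u, z)\<close> to \<open>z u\<close>
    modulo \<open>L'\<close>.\<close>
  define G where "G f = (\<Sum>x\<in>Poly_Mapping.keys f. scaleV (of_int (Poly_Mapping.lookup f x)) (case x of (u, z) \<Rightarrow> scaleV z (\<pi> (rep u))))" for f
  have G_sup: "G f = (\<Sum>x\<in>X'. scaleV (of_int (Poly_Mapping.lookup f x)) (case x of (u, z) \<Rightarrow> scaleV z (\<pi> (rep u))))"
    if "finite X'" "Poly_Mapping.keys f \<subseteq> X'" for f X'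
    unfolding G_def using that by (intro sum.mono_neutral_left) (auto simp: in_keys_iff)
  have G_add: "G (f + g) = G f + G g" for f g
    using G_sup[of "Poly_Mapping.keys f \<union> Poly_Mapping.keys g"] Poly_Mapping.keys_add[of f g]
    by (simp add: lookup_add scaleV_add_left sum.distrib)
  have G_minus: "G (- f) = - G f" for f
    by (simp add: G_def scaleV_minus_left sum_negf)
  have G_diff: "G (f - g) = G f - G g" for f g
    using G_add[of f "- g"] by (simp add: G_minus)
  have G_of: "G (frag_of (nwu_class t, z)) = scaleV z (\<pi> t)" for t z
    by (simp add: G_def keys_frag_of rep)
  have G_Kn: "G f = 0" if "f \<in> Kn" for f
    using that
  proof (induction rule: Kn_induct)
    case zero
    show ?case by (simp add: G_def)
  next
    case (gen h)
    then show ?case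
    proof (cases rule: gensK_cases)
      case (1 s t z)
      then show ?thesis by (simp add: G_diff G_of lin_add[OF lin] scaleV_add_right)
    next
      case (2 t y z)
      then show ?thesis by (simp add: G_diff G_of scaleV_add_left)
    next
      case (3 s t z)
      have "\<pi> (s * (t - Poly_Mapping.single 0 (nw_char_tensor cc dd t))) = 0" using right[OF 3(1)] ker by blast
      then have "\<pi> (s * t) = scaleV (nw_char_tensor cc dd t) (\<pi> s)"
        by (simp add: right_diff_distrib lin_diff[OF lin] single_zero_commute lin_scale[OF lin])
      then show ?thesis by (simp add: 3(2) G_diff G_of mult.commute)
    qed
  qed (simp_all add: G_minus G_add)
  show ?thesis
  proof
    fix t assume "t \<in> L"
    then have "frag_of (nwu_class t, 1) - frag_of (nwu_class 0, 1) \<in> Kn"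
      by (simp add: L_def ev_def qf_eq_iff)
    then have "\<pi> t = 0" using G_Kn by (fastforce simp: G_diff G_of lin_zero[OF lin])
    then show "t \<in> L'" by (simp add: ker)
  qed
qed

end

section \<open>Operators attached to a module\<close>

lemma gen_bracket:
  "gen x * gen y - gen y * gen x - tensor_incl (nw_br x y) \<in> uea_ideal nw_br UNIV"
proof -
  have "tensor_incl (Poly_Mapping.single x 1) * tensor_incl (Poly_Mapping.single y 1)
      - tensor_incl (Poly_Mapping.single y 1) * tensor_incl (Poly_Mapping.single x 1)
      - tensor_incl (bilinear_extension nw_br (Poly_Mapping.single x 1) (Poly_Mapping.single y 1)) \<in> full.rels"
    unfolding full.rels_def by blast
  then show ?thesis using full.rels_I by (simp add: tensor_incl_single bilinear_extension_eq_lext subset_iff)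
qed

definition cword :: "nat multiset \<Rightarrow> nw word \<Rightarrow>\<^sub>0 complex" where
  "cword \<rho> = Poly_Mapping.single (Word (map (\<lambda>k. At Hc (- int k)) (sorted_list_of_multiset \<rho>))) 1"

text \<open>The lift of \<open>newton\<close> to the tensor algebra, where the modes of
  \<open>c\<close> do not commute. The partition expansion fixes an order of the factors and so
  serves as the definition.\<close>

definition cexp :: "complex \<Rightarrow> nat \<Rightarrow> nw word \<Rightarrow>\<^sub>0 complex" where
  "cexp \<tau> r = (\<Sum>\<rho>\<in>Part r. scaleV (\<tau> ^ size \<rho> / zz \<rho>) (cword \<rho>))"

text \<open>The creation operators that become central when \<open>c(0) - m = - n\<close>, respectively \<open>n\<close>.\<close>

definition b_vertex :: "int \<Rightarrow> nat \<Rightarrow> nw word \<Rightarrow>\<^sub>0 complex" where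
  "b_vertex m n = (\<Sum>p\<le>n. cexp 1 (n - p) * gen (At Hb (- int p + m)))"

definition a_vertex :: "int \<Rightarrow> nat \<Rightarrow> nw word \<Rightarrow>\<^sub>0 complex" where
  "a_vertex m n = (\<Sum>p\<in>{1..n}. cexp (- 1) (n - p) * gen (At Ha (- int p - m)))"

text \<open>Serves two actions: the free field space, with \<open>K\<close> the identity, and the
  tensor algebra itself, acting on itself through the projection \<open>pr\<close>.\<close>

locale nw_action =
  fixes m :: int and T :: "(nw word \<Rightarrow>\<^sub>0 complex) \<Rightarrow> ('k \<Rightarrow>\<^sub>0 complex) \<Rightarrow> ('k \<Rightarrow>\<^sub>0 complex)"
    and K :: "('k \<Rightarrow>\<^sub>0 complex) \<Rightarrow> ('k \<Rightarrow>\<^sub>0 complex)"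
  assumes T_left: "linear_op (\<lambda>t. T t v)" and T_right: "linear_op (T t)"
    and T_mult: "T (s * t) v = T s (T t v)" and T_one: "T 1 v = K v"
    and T_ideal: "t \<in> uea_ideal nw_br UNIV \<Longrightarrow> T t v = 0" and T_KK: "T (gen KK) v = K v"
begin

abbreviation "act x \<equiv> T (gen x)"

definition "A p = act (At Ha (p - m))"
definition "B p = act (At Hb (p + m))"
definition "C p v = act (At Hc p) v - scaleV (if p = 0 then of_int m else 0) (K v)"
definition "D p = act (At Hd p)"

lemma K_lin: "linear_op K"
  using T_right[of 1] by (simp add: T_one[abs_def])

lemma K_T: "K (T t v) = T t v" and T_K: "T t (K v) = T t v"
  using T_mult[of 1 t v] T_mult[of t 1 v] by (simp_all add: T_one)

lemma K_K: "K (K v) = K v"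
  using T_K[of 1 v] by (simp add: T_one)

lemma act_bracket: "act x (act y v) = act y (act x v) + T (tensor_incl (nw_br x y)) v"
  using T_ideal[OF gen_bracket, of x y v] by (simp add: lin_diff[OF T_left] lin_add[OF T_left] T_mult algebra_simps)

lemma T_incl: "T (tensor_incl b) v = lext (\<lambda>x. act x v) b"
  by (induction b rule: vec_induct)
     (simp_all add: tensor_incl_eq_lext lin_zero[OF lext_lin] lin_add[OF lext_lin] lin_scale[OF lext_lin]
       lin_zero[OF T_left] lin_add[OF T_left] lin_scale[OF T_left])

lemmas bracket_simps = T_incl lin_zero[OF lext_lin] lin_add[OF lext_lin] T_KK K_T T_K
  lin_diff[OF T_right] lin_scale[OF T_right] lin_diff[OF K_lin] lin_scale[OF K_lin]

sublocale aff_module A B C D K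
proof
  show "linear_op (C p)" for p
    unfolding C_def by (intro linear_op_minus linear_op_scale T_right K_lin)
  show "linear_op K" by (rule K_lin)
  \<comment> \<open>The bracket of \<open>a(p - m)\<close> with \<open>b(q + m)\<close> has central
    term \<open>p - m\<close>; its part \<open>- m\<close> is absorbed into
    \<open>C 0\<close>.\<close>
  show "A p (B q v) = B q (A p v) + C (p + q) v + (if p + q = 0 then scaleV (of_int p) (K v) else 0)" for p q v
    using act_bracket[of "At Ha (p - m)" "At Hb (q + m)" v]
    by (auto simp: A_def B_def C_def bracket_simps scaleV_diff_left algebra_simps)
  show "D p (C q v) = C q (D p v) + (if p + q = 0 then scaleV (of_int p) (K v) else 0)" for p q v
    using act_bracket[of "At Hd p" "At Hc q" v] by (auto simp: C_def D_def bracket_simps)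
  show "C p (C q v) = C q (C p v)" for p q v
    using act_bracket[of "At Hc p" "At Hc q" v] by (simp add: C_def bracket_simps K_K)
  show "C p (A q v) = A q (C p v)" for p q v
    using act_bracket[of "At Hc p" "At Ha (q - m)" v] by (simp add: C_def A_def bracket_simps)
  show "C p (B q v) = B q (C p v)" for p q v
    using act_bracket[of "At Hc p" "At Hb (q + m)" v] by (simp add: C_def B_def bracket_simps)
  show "D p (A q v) = A q (D p v) + A (p + q) v" for p q v
    using act_bracket[of "At Hd p" "At Ha (q - m)" v] by (simp add: D_def A_def bracket_simps algebra_simps)
  show "D p (B q v) = B q (D p v) - B (p + q) v" for p q v
    using act_bracket[of "At Hd p" "At Hb (q + m)" v] by (simp add: D_def B_def bracket_simps algebra_simps scaleV_minus_left)
  show "D p (D q v) = D q (D p v)" for p q v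
    using act_bracket[of "At Hd p" "At Hd q" v] by (simp add: D_def bracket_simps)
  show "A p (A q v) = A q (A p v)" for p q v
    using act_bracket[of "At Ha (p - m)" "At Ha (q - m)" v] by (simp add: A_def bracket_simps)
  show "B p (B q v) = B q (B p v)" for p q v
    using act_bracket[of "At Hb (p + m)" "At Hb (q + m)" v] by (simp add: B_def bracket_simps)
qed (simp_all add: A_def B_def C_def D_def T_right bracket_simps T_one K_K)

end

locale nw_hw = nw_action +
  fixes cc dd :: complex and vac
  assumes vac_K: "K vac = vac"
    and hw_smooth: "\<exists>N. \<forall>p\<ge>N. A p v = 0 \<and> B p v = 0"
    and hw_A: "p \<ge> - m \<Longrightarrow> act (At Ha p) vac = 0"
    and hw_B: "p \<ge> m + 1 \<Longrightarrow> act (At Hb p) vac = 0"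
    and hw_C: "p \<ge> 0 \<Longrightarrow> act (At Hc p) vac = (if p = 0 then scaleV cc vac else 0)"
    and hw_D: "p \<ge> 0 \<Longrightarrow> act (At Hd p) vac = (if p = 0 then scaleV dd vac else 0)"
begin

sublocale hw_vector A B C D K "cc - of_int m" dd vac
proof
  show "\<exists>N. \<forall>p\<ge>N. A p v = 0 \<and> B p v = 0" for v by (rule hw_smooth)
  show "C 0 vac = scaleV (cc - of_int m) vac"
    by (simp add: C_def hw_C vac_K scaleV_diff_left)
qed (simp_all add: vac_K hw_smooth A_def B_def C_def D_def hw_A hw_B hw_C hw_D)

lemma act_C: "k \<ge> 1 \<Longrightarrow> act (At Hc (- int k)) v = C (- int k) v"
  by (simp add: C_def)

lemma T_cword:
  assumes "0 \<notin># \<rho>"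
  shows "T (cword \<rho>) v = cf.mono_op \<rho> (K v)"
proof -
  have "T (Poly_Mapping.single (Word (map (\<lambda>k. At Hc (- int k)) ks)) 1) v = foldr (\<lambda>k. C (- int k)) ks (K v)"
    if "0 \<notin> set ks" for ks
    using that
  proof (induction ks)
    case Nil
    then show ?case by (simp add: single_Nil T_one)
  next
    case (Cons k ks)
    have "T (Poly_Mapping.single (Word (map (\<lambda>k. At Hc (- int k)) (k # ks))) 1) v =
        act (At Hc (- int k)) (T (Poly_Mapping.single (Word (map (\<lambda>k. At Hc (- int k)) ks)) 1) v)"
      unfolding T_mult[symmetric] gen_times_word by simp
    then show ?case using Cons act_C[of k] by simp
  qed
  from this[of "sorted_list_of_multiset \<rho>"] show ?thesis
    using assms by (simp add: cword_def cf.foldr_mono_op)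
qed

lemma T_cexp: "T (cexp \<tau> r) v = e \<tau> r v"
  by (simp add: cexp_def lin_sum[OF T_left] lin_scale[OF T_left] cf.newton_partition)
     (rule sum.cong, auto simp: T_cword Part_def)

lemma T_b_vertex: "T (b_vertex m n) v = (\<Sum>p\<le>n. e 1 (n - p) (B (- int p) v))"
  by (simp add: b_vertex_def lin_sum[OF T_left] T_mult T_cexp B_def)

lemma T_a_vertex: "T (a_vertex m n) v = (\<Sum>p\<in>{1..n}. e (- 1) (n - p) (A (- int p) v))"
  by (simp add: a_vertex_def lin_sum[OF T_left] T_mult T_cexp A_def)

text \<open>\<open>b_vertex\<close> acts as \<open>Bh (- int n)\<close> on vectors killed by the
  positive modes of \<open>B\<close>, and the powers applied to \<open>vac\<close> are such
  vectors.\<close>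

lemma T_b_vertex_power: "T (b_vertex m n ^ k) vac = (Bh (- int n) ^^ k) vac"
proof (induction k)
  case (Suc k)
  have "T (b_vertex m n ^ Suc k) vac = T (b_vertex m n) ((Bh (- int n) ^^ k) vac)"
    by (simp add: T_mult Suc)
  also have "\<dots> = Bh (- int n) ((Bh (- int n) ^^ k) vac)"
    unfolding T_b_vertex by (rule Bh_expand[symmetric]) (rule B_Bh_power)
  finally show ?case by simp
qed (simp add: T_one vac_K)

lemma T_a_vertex_power: "T (a_vertex m n ^ k) vac = (Ah (- int n) ^^ k) vac"
proof (induction k)
  case (Suc k)
  have "T (a_vertex m n ^ Suc k) vac = T (a_vertex m n) ((Ah (- int n) ^^ k) vac)"
    by (simp add: T_mult Suc)
  also have "\<dots> = Ah (- int n) ((Ah (- int n) ^^ k) vac)"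
    unfolding T_a_vertex by (rule Ah_expand[symmetric]) (rule A_Ah_power)
  finally show ?case by simp
qed (simp add: T_one vac_K)

end

section \<open>The free field module as a quotient of the tensor algebra\<close>

locale free_field_action = free_field +
  fixes m :: int
begin

fun nact :: "nw \<Rightarrow> (osc multiset \<Rightarrow>\<^sub>0 complex) \<Rightarrow> (osc multiset \<Rightarrow>\<^sub>0 complex)" where
  "nact (At Ha n) v = A2 (n + m) v"
| "nact (At Hb n) v = B2 (n - m) v"
| "nact (At Hc n) v = Ct n v + scaleV (if n = 0 then of_int m else 0) v"
| "nact (At Hd n) v = Dt n v"
| "nact KK v = v"

lemma nact_lin: "linear_op (nact x)"
proof (cases x)
  case (At h n)
  then show ?thesis
    using linear_op_plus[OF Ct_lin[of n] linear_op_scale[OF linear_op_ident, of "if n = 0 then of_int m else 0"]]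
    by (cases h) (simp_all add: linear_op_def A2_lin[unfolded linear_op_def] B2_lin[unfolded linear_op_def] Dt_lin[unfolded linear_op_def])
qed (simp add: linear_op_def)

lemma nact_bracket: "nact x (nact y v) - nact y (nact x v) = lext (\<lambda>z. nact z v) (nw_br x y)"
proof (cases x)
  case (At h p)
  show ?thesis
  proof (cases y)
    case (At h' q)
    note l = lin_add[OF A2_lin] lin_add[OF B2_lin] lin_add[OF Ct_lin] lin_add[OF Dt_lin]
      lin_scale[OF A2_lin] lin_scale[OF B2_lin] lin_scale[OF Ct_lin] lin_scale[OF Dt_lin]
    note r = A2_A2[of _ _ v] B2_B2[of _ _ v] Ct_Ct[of _ _ v] Dt_Dt[of _ _ v] Ct_A2 Ct_B2 Dt_A2 Dt_B2 Dt_Ct A2_B2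
    show ?thesis
    proof (cases "p + q = 0")
      case True
      then have q: "q = - p" by simp
      show ?thesis unfolding \<open>x = At h p\<close> At q
        by (cases h; cases h')
           (auto simp: l r lin_add[OF lext_lin] lin_zero[OF lext_lin] scaleV_minus_left scaleV_add_left scaleV_diff_left
             scaleV_add_right algebra_simps)
    next
      case False
      then show ?thesis unfolding \<open>x = At h p\<close> At
        by (cases h; cases h')
           (auto simp: l r lin_add[OF lext_lin] lin_zero[OF lext_lin] scaleV_minus_left algebra_simps)
    qed
  qed (simp add: lin_zero[OF lext_lin])
qed (cases y; simp add: lin_zero[OF lext_lin])

sublocale nw: nw_action m "tact nact" "\<lambda>v. v"
proof
  show "tact nact t v = 0" if "t \<in> uea_ideal nw_br UNIV" for t v
    by (rule full.uea_ideal_annihilates[OF nact_lin nact_bracket that])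
qed (simp_all add: tact_lin_left tact_lin nact_lin tact_mult tact_single)

lemma nw_ops: "nw.A = A2" "nw.B = B2" "nw.C = Ct" "nw.D = Dt"
  by (simp_all add: fun_eq_iff nw.A_def nw.B_def nw.C_def nw.D_def tact_single)

sublocale nw: nw_hw m "tact nact" "\<lambda>v. v" "\<kappa> + of_int m" \<delta> vac
proof
  show "\<exists>N. \<forall>p\<ge>N. nw.A p v = 0 \<and> nw.B p v = 0" for v
    unfolding nw_ops by (rule A2_B2_smooth)
qed (simp_all add: tact_single A2_vac B2_vac Ct_vac Dt_vac Ct_0_vac Dt_0_vac scaleV_add_left)

lemma nw_hat: "nw.Ah = mod.Ah" "nw.Bh = mod.Bh"
  by (simp_all add: nw.Ah_def nw.Bh_def mod.Ah_def mod.Bh_def nw_ops)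

lemma b_vertex_power_vac: "tact nact (b_vertex m n ^ k) vac =
    Poly_Mapping.single (replicate_mset k (OB n)) (w (int n) ^ k)"
  by (simp add: nw.T_b_vertex_power nw_hat Bh_power_vac Bt_power_vac)

lemma a_vertex_power_vac: "n \<ge> 1 \<Longrightarrow> tact nact (a_vertex m n ^ k) vac =
    Poly_Mapping.single (replicate_mset k (OA n)) (w (- int n) ^ k)"
  by (simp add: nw.T_a_vertex_power nw_hat Ah_power_vac Ao_power_vac)

definition kern :: "(nw word \<Rightarrow>\<^sub>0 complex) set" where
  "kern = {t. tact nact t vac = 0}"

lemma kern_left_ideal: "left_ideal kern"
  by (auto simp: left_ideal_def kern_def tact_add tact_mult nact_lin lin_zero[OF tact_lin[OF nact_lin]])

lemma kern_one: "1 \<notin> kern"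
  by (simp add: kern_def vac_def)

lemma kern_ideal: "uea_ideal nw_br UNIV \<subseteq> kern"
  by (auto simp: kern_def nw.T_ideal)

text \<open>For \<open>\<epsilon> = 0\<close> also \<open>b(m)\<close> has to kill the vacuum. With
  \<open>\<kappa> = 0\<close> and the flag on, \<open>w 0 = 0\<close> switches off the creation
  operator \<open>Bt 0\<close>.\<close>

lemma kern_gen:
  assumes "x \<in> nw_sub m \<epsilon>" "\<epsilon> = 1 \<or> \<epsilon> = 0 \<and> \<kappa> = 0 \<and> fl"
  shows "gen x - Poly_Mapping.single 0 (nw_char (\<kappa> + of_int m) \<delta> x) \<in> kern"
proof -
  have "B2 0 vac = 0" if "\<kappa> = 0" fl
  proof -
    have "B2 0 vac = B1 0 vac" by (rule B2_eq_B1) (simp add: Ct_vac)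
    also have "\<dots> = 0"
    proof (rule B1_zero)
      have "w 0 = 0" unfolding w_def using that by simp
      moreover have "Bt 0 vac = scaleV (w 0) (cr (OB 0) vac)" by (simp add: Bt_def)
      ultimately show "Bt q vac = 0" if "q \<ge> 0" for q
        using that Bt_vac[of q] by (cases "q = 0") simp_all
    qed
    finally show ?thesis .
  qed
  then have "B2 q vac = 0" if "q \<ge> \<epsilon>" for q
    using assms(2) that B2_vac[of q] by (cases "q = 0") auto
  then have "nact x vac = scaleV (nw_char (\<kappa> + of_int m) \<delta> x) vac"
    using assms(1)
    by (cases x; cases "case x of At h n \<Rightarrow> h | KK \<Rightarrow> Ha")
       (auto simp: nw_sub_def A2_vac Ct_vac Dt_vac Ct_0_vac Dt_0_vac scaleV_add_left)
  then show ?thesis by (simp add: kern_def tact_diff tact_single zero_word_def)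
qed

end

section \<open>Singular vectors and submodules of the induced modules\<close>

context nw_induced
begin

text \<open>The range of \<open>pr\<close> is a copy of the induced module inside the tensor algebra.\<close>

definition pr :: "(nw word \<Rightarrow>\<^sub>0 complex) \<Rightarrow> (nw word \<Rightarrow>\<^sub>0 complex)" where
  "pr = (SOME \<pi>. linear_op \<pi> \<and> (\<forall>v. \<pi> v = 0 \<longleftrightarrow> v \<in> L) \<and> (\<forall>v. v - \<pi> v \<in> L))"

lemma L_sub: "subspaceV L"
  by (rule left_ideal_subspace[OF L_left_ideal])

lemma pr_props: "linear_op pr \<and> (\<forall>v. pr v = 0 \<longleftrightarrow> v \<in> L) \<and> (\<forall>v. v - pr v \<in> L)"
proof -
  have "\<exists>\<pi>. linear_op \<pi> \<and> (\<forall>v. \<pi> v = 0 \<longleftrightarrow> v \<in> L) \<and> (\<forall>v. v - \<pi> v \<in> L)"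
    by (rule subspace_projection[OF L_sub], intro exI conjI allI)
  then show ?thesis unfolding pr_def by (rule someI_ex)
qed

lemma pr_lin: "linear_op pr" and pr_zero_iff: "pr v = 0 \<longleftrightarrow> v \<in> L" and pr_diff: "v - pr v \<in> L"
  using pr_props by auto

lemma pr_eq_iff: "pr u = pr v \<longleftrightarrow> u - v \<in> L"
  by (simp add: lin_diff[OF pr_lin] flip: pr_zero_iff)

lemma pr_mult: "pr (t * pr v) = pr (t * v)"
proof -
  have "t * (v - pr v) \<in> L" by (rule left_idealD(3)[OF L_left_ideal pr_diff])
  then have "pr (t * v) = pr (t * pr v)" unfolding pr_eq_iff right_diff_distrib .
  then show ?thesis by simp
qed

lemma KK_central: "gen KK * t - t * gen KK \<in> uea_ideal nw_br UNIV"
proof (induction t rule: vec_induct)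
  case zero
  then show ?case using full.I_zero by simp
next
  case (add u v)
  from full.I_add[OF add] show ?case by (simp add: algebra_simps)
next
  case (scale z v)
  from full.I_mult(1)[OF scale, of "Poly_Mapping.single 0 z"] show ?case
    by (simp only: scaleV_conv_mult[symmetric] scaleV_diff_right scaleV_mult_left scaleV_mult_right) simp
next
  case (single w)
  have "gen KK * Poly_Mapping.single (Word xs) 1 - Poly_Mapping.single (Word xs) 1 * gen KK \<in> uea_ideal nw_br UNIV" for xs
  proof (induction xs)
    case Nil
    then show ?case using full.I_zero by (simp add: single_Nil)
  next
    case (Cons x xs)
    let ?W = "Poly_Mapping.single (Word xs) (1 :: complex)"
    have "gen KK * gen x - gen x * gen KK \<in> uea_ideal nw_br UNIV"
      using gen_bracket[of KK x] by (cases x) (simp_all add: tensor_incl_eq_lext lin_zero[OF lext_lin])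
    then have "(gen KK * gen x - gen x * gen KK) * ?W + gen x * (gen KK * ?W - ?W * gen KK) \<in> uea_ideal nw_br UNIV"
      using Cons by (intro full.I_add full.I_mult) auto
    moreover have "(gen KK * gen x - gen x * gen KK) * ?W + gen x * (gen KK * ?W - ?W * gen KK) =
        gen KK * (gen x * ?W) - (gen x * ?W) * gen KK"
      by (simp add: algebra_simps)
    ultimately show ?case by (simp only: gen_times_word)
  qed
  from this[of "letters w"] show ?case by simp
qed

lemma gen_one: "x \<in> nw_sub m \<epsilon> \<Longrightarrow> pr (gen x * pr 1) = scaleV (nw_char cc dd x) (pr 1)"
proof -
  assume x: "x \<in> nw_sub m \<epsilon>"
  have "pr (gen x * pr 1) = pr (gen x)" using pr_mult[of "gen x" 1] by simp
  also have "\<dots> = pr (scaleV (nw_char cc dd x) 1)"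
    unfolding pr_eq_iff using gen_L[OF x] by (simp only: scaleV_conv_mult mult_1_right)
  finally show ?thesis by (simp only: lin_scale[OF pr_lin])
qed

text \<open>Level one holds on the generator and spreads to all vectors since \<open>KK\<close> is
  central.\<close>

lemma pr_KK: "pr (gen KK * v) = pr v"
proof -
  have "gen KK * v - v * gen KK \<in> L" by (rule ideal_L[OF KK_central])
  moreover have "v * (gen KK - 1) \<in> L"
    using gen_L[of KK] by (intro left_idealD(3)[OF L_left_ideal]) (simp add: nw_sub_def)
  ultimately have "(gen KK * v - v * gen KK) + v * (gen KK - 1) \<in> L"
    by (rule left_idealD(2)[OF L_left_ideal])
  then show ?thesis by (simp add: pr_eq_iff algebra_simps)
qed

sublocale mact: nw_action m "\<lambda>t v. pr (t * v)" pr
proof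
  show "linear_op (\<lambda>t. pr (t * v))" for v
    by (rule linear_opI) (simp_all add: distrib_right lin_add[OF pr_lin] scaleV_mult_left lin_scale[OF pr_lin])
  show "linear_op (\<lambda>v. pr (t * v))" for t
    by (rule linear_opI) (simp_all add: distrib_left lin_add[OF pr_lin] scaleV_mult_right lin_scale[OF pr_lin])
  show "pr (t * v) = 0" if "t \<in> uea_ideal nw_br UNIV" for t v
    using that by (simp add: pr_zero_iff ideal_L full.I_mult)
qed (simp_all add: pr_mult mult.assoc pr_KK)

lemma invariant_contains_range:
  assumes H: "subspaceV H" and one: "pr 1 \<in> H" and A: "\<And>v p. v \<in> H \<Longrightarrow> mact.A p v \<in> H"
    and B: "\<And>v p. v \<in> H \<Longrightarrow> mact.B p v \<in> H" and C: "\<And>v p. v \<in> H \<Longrightarrow> mact.C p v \<in> H"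
    and D: "\<And>v p. v \<in> H \<Longrightarrow> mact.D p v \<in> H"
  shows "pr t \<in> H"
proof (induction t rule: vec_induct)
  case (single w)
  have "pr (Poly_Mapping.single (Word xs) 1) \<in> H" for xs
  proof (induction xs)
    case Nil
    then show ?case using one by (simp add: single_Nil)
  next
    case (Cons x xs)
    let ?v = "pr (Poly_Mapping.single (Word xs) 1)"
    have v: "pr ?v = ?v" using pr_mult[of 1 "Poly_Mapping.single (Word xs) 1"] by simp
    have "pr (gen x * ?v) \<in> H"
    proof (cases x)
      case (At h n)
      have c: "pr (gen (At Hc n) * ?v) = mact.C n ?v + scaleV (if n = 0 then of_int m else 0) ?v"
        by (simp add: mact.C_def v)
      show ?thesis
        using A[OF Cons, of "n + m"] B[OF Cons, of "n - m"] D[OF Cons, of n]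
          subspaceV_add[OF H C[OF Cons, of n] subspaceV_scale[OF H Cons, of "if n = 0 then of_int m else 0"]]
        unfolding At by (cases h) (simp_all only: c[symmetric] mact.A_def mact.B_def mact.D_def, simp_all)
    next
      case KK
      then show ?thesis using Cons by (simp add: pr_KK v)
    qed
    then show ?case by (simp only: pr_mult gen_times_word)
  qed
  from this[of "letters w"] show ?case by simp
qed (simp_all add: lin_zero[OF pr_lin] lin_add[OF pr_lin] lin_scale[OF pr_lin] subspaceV_zero[OF H]
    subspaceV_add[OF H] subspaceV_scale[OF H])

text \<open>The vectors killed by all high modes form a subspace that contains the generator and is
  stable under every mode, because the bracket of a high mode with a fixed one is again a high
  mode.\<close>

lemma module_smooth: "\<exists>N. \<forall>p\<ge>N. \<forall>h. pr (gen (At h p) * pr t) = 0"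
proof -
  define sm where "sm v \<longleftrightarrow> (\<exists>N. \<forall>p\<ge>N. \<forall>h. pr (gen (At h p) * v) = 0)" for v
  have sub: "subspaceV {v. sm v}"
    unfolding subspaceV_def
  proof (intro conjI ballI allI)
    show "0 \<in> {v. sm v}" by (simp add: sm_def lin_zero[OF pr_lin])
    fix u v assume "u \<in> {v. sm v}" "v \<in> {v. sm v}"
    then obtain N N' where "\<forall>p\<ge>N. \<forall>h. pr (gen (At h p) * u) = 0" "\<forall>p\<ge>N'. \<forall>h. pr (gen (At h p) * v) = 0"
      unfolding sm_def by blast
    then show "u + v \<in> {v. sm v}"
      unfolding sm_def by (auto simp: distrib_left lin_add[OF pr_lin] intro!: exI[of _ "max N N'"])
  next
    fix z v assume "v \<in> {v. sm v}"
    then obtain N where "\<forall>p\<ge>N. \<forall>h. pr (gen (At h p) * v) = 0" unfolding sm_def by blast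
    then show "scaleV z v \<in> {v. sm v}"
      unfolding sm_def by (auto simp: scaleV_mult_right lin_scale[OF pr_lin] intro!: exI[of _ N])
  qed
  have sm_pr: "sm (pr v)" if "sm v" for v using that by (simp add: sm_def pr_mult)
  have step: "sm (pr (gen (At h' q) * v))" if v: "sm v" for h' q v
  proof -
    obtain N where N: "\<And>p h. p \<ge> N \<Longrightarrow> pr (gen (At h p) * v) = 0" using v unfolding sm_def by blast
    \<comment> \<open>\<open>N - q\<close> makes the bracket a high mode; \<open>1 - q\<close> makes
      \<open>p + q\<close> positive and thereby excludes the central term.\<close>
    have "pr (gen (At h p) * pr (gen (At h' q) * v)) = 0" if p: "p \<ge> max N (max (N - q) (1 - q))" for p h
    proof -
      have "pr (gen (At h p) * pr (gen (At h' q) * v)) =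
          pr (gen (At h' q) * pr (gen (At h p) * v)) + pr (tensor_incl (nw_br (At h p) (At h' q)) * v)"
        by (rule mact.act_bracket)
      moreover have "pr (gen (At h p) * v) = 0" using N p by simp
      moreover have "pr (gen (At g (p + q)) * v) = 0" for g using N p by simp
      then have "pr (tensor_incl (nw_br (At h p) (At h' q)) * v) = 0"
        using p unfolding mact.T_incl by (cases h; cases h') (simp_all add: lin_add[OF lext_lin] lin_zero[OF lext_lin])
      ultimately show ?thesis by (simp add: lin_zero[OF pr_lin])
    qed
    then show ?thesis unfolding sm_def by blast
  qed
  have "pr t \<in> {v. sm v}"
  proof (rule invariant_contains_range[OF sub])
    have "pr (gen (At h p) * pr 1) = 0" if "p \<ge> \<bar>m\<bar> + 1" for p h
    proof -
      have "At h p \<in> nw_sub m \<epsilon>" using that \<epsilon> by (cases h) (auto simp: nw_sub_def)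
      moreover have "nw_char cc dd (At h p) = 0" using that by (cases h) auto
      ultimately show ?thesis by (simp add: gen_one)
    qed
    then show "pr 1 \<in> {v. sm v}" unfolding sm_def by blast
    show "mact.C p v \<in> {v. sm v}" if "v \<in> {v. sm v}" for p v
      unfolding mact.C_def using that
      by (intro subspaceV_diff[OF sub] subspaceV_scale[OF sub]) (auto intro: step sm_pr)
  qed (auto simp: mact.A_def mact.B_def mact.D_def intro: step)
  then show ?thesis by (simp add: sm_def)
qed

sublocale mact: nw_hw m "\<lambda>t v. pr (t * v)" pr cc dd "pr 1"
proof
  show "pr (pr 1) = pr 1" using pr_mult[of 1 1] by simp
  show "\<exists>N. \<forall>p\<ge>N. mact.A p v = 0 \<and> mact.B p v = 0" for v
  proof -
    obtain N where N: "\<And>p h. p \<ge> N \<Longrightarrow> pr (gen (At h p) * pr v) = 0" using module_smooth by blast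
    then show ?thesis
      by (intro exI[of _ "N + \<bar>m\<bar>"]) (auto simp: mact.A_def mact.B_def pr_mult)
  qed
  show "pr (gen (At Hb p) * pr 1) = 0" if "p \<ge> m + 1" for p
    using that \<epsilon> by (subst gen_one) (auto simp: nw_sub_def)
qed (simp_all add: gen_one nw_sub_def)

lemma invariant_closed:
  assumes H: "left_ideal H" "L \<subseteq> H" and v: "v \<in> H"
  shows "pr v \<in> H" "mact.A p v \<in> H" "mact.B p v \<in> H" "mact.C p v \<in> H" "mact.D p v \<in> H"
proof -
  have sub: "subspaceV H" by (rule left_ideal_subspace[OF H(1)])
  have pr: "pr u \<in> H" if "u \<in> H" for u
    using subspaceV_diff[OF sub that, of "u - pr u"] pr_diff[of u] H(2) by auto
  show "pr v \<in> H" "mact.A p v \<in> H" "mact.B p v \<in> H" "mact.D p v \<in> H"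
    unfolding mact.A_def mact.B_def mact.D_def by (intro pr left_idealD(3)[OF H(1)] v)+
  show "mact.C p v \<in> H"
    unfolding mact.C_def by (intro subspaceV_diff[OF sub] subspaceV_scale[OF sub] pr left_idealD(3)[OF H(1)] v)
qed

lemma range_pr_S:
  assumes "hw_module mact.A mact.B mact.C mact.D pr (cc - of_int m) G" "pr 1 \<in> G"
  shows "pr t \<in> hw_module.S mact.A mact.B mact.C mact.D pr (cc - of_int m) G"
proof -
  interpret hw: hw_module mact.A mact.B mact.C mact.D pr "cc - of_int m" G by fact
  show ?thesis
    by (rule invariant_contains_range[OF hw.S_sub])
       (simp_all add: hw.S_A hw.S_B hw.S_C hw.S_D hw.S0_S hw.G_S0 assms(2))
qed

text \<open>Here the vacua form a line, so a left ideal strictly above \<open>L\<close> that meets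
  it contains the generator.\<close>

lemma irreducible_V:
  assumes "\<And>i. i \<in> letter_set \<Longrightarrow> wt (cc - of_int m) i = 0 \<Longrightarrow> mact.cre i (pr 1) = 0" and L: "1 \<notin> L"
  shows "\<And>H v. left_ideal H \<Longrightarrow> L \<subseteq> H \<Longrightarrow> v \<in> H \<Longrightarrow> v \<notin> L \<Longrightarrow> 1 \<in> H"
proof -
  fix H v assume H: "left_ideal H" "L \<subseteq> H" and v: "v \<in> H" "v \<notin> L"
  interpret hw: hw_module mact.A mact.B mact.C mact.D pr "cc - of_int m" "range (\<lambda>z. scaleV z (pr 1))"
    by (rule mact.hw_module_line[OF assms(1)])
  have sub: "subspaceV H" by (rule left_ideal_subspace[OF H(1)])
  have "pr 1 \<in> range (\<lambda>z. scaleV z (pr 1))" by (rule range_eqI[of _ _ 1]) simp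
  then have S: "pr v \<in> hw.S" by (rule range_pr_S[OF hw.hw_module_axioms])
  have "pr v \<noteq> 0" using v(2) by (simp add: pr_zero_iff)
  then obtain u where "u \<in> H" "u \<in> range (\<lambda>z. scaleV z (pr 1))" "u \<noteq> 0"
    using hw.submodule_meets_G[OF sub _ _ _ _ _ invariant_closed(1)[OF H v(1)] S] invariant_closed[OF H] by blast
  then obtain z where z: "scaleV z (pr 1) \<in> H" "z \<noteq> 0" by (auto simp: scaleV_eq_0_iff)
  have "scaleV (1 / z) (scaleV z (pr 1)) \<in> H" by (rule subspaceV_scale[OF sub z(1)])
  moreover have "scaleV (1 / z) (scaleV z (pr 1)) = pr 1" using z(2) by simp
  ultimately have "pr 1 \<in> H" by (simp only:)
  then show "1 \<in> H" using subspaceV_add[OF sub, of "1 - pr 1" "pr 1"] pr_diff[of 1] H(2) by auto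
qed

lemma powspan_singular:
  assumes i0: "i0 \<in> letter_set" "wt (cc - of_int m) i0 = 0"
    and uniq: "\<And>i. i \<in> letter_set \<Longrightarrow> wt (cc - of_int m) i = 0 \<Longrightarrow> i = i0"
    and Y: "\<And>k. (mact.cre i0 ^^ k) (pr 1) = pr (Y ^ k)" and x: "x \<in> nw_plus m"
  shows "gen x * Y ^ k \<in> L"
proof -
  interpret hw: hw_module mact.A mact.B mact.C mact.D pr "cc - of_int m" "mact.powspan (mact.cre i0)"
    by (rule mact.hw_module_powspan[OF i0 uniq])
  have v: "pr (Y ^ k) \<in> mact.powspan (mact.cre i0)"
  proof -
    have *: "pr (Y ^ k) = (\<Sum>j<Suc k. scaleV (if j = k then 1 else 0) ((mact.cre i0 ^^ j) (pr 1)))"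
      by (simp add: Y)
    show ?thesis unfolding * by (rule mact.powspanI)
  qed
  note killed = hw.G_killed[OF v, rule_format]
  have "pr (gen x * pr (Y ^ k)) = 0"
  proof (cases x)
    case (At h n)
    then show ?thesis
      using x killed(1)[of "n + m"] killed(2)[of "n - m"] killed(3)[of n] killed(4)[of n]
      by (cases h) (auto simp: nw_plus_def mact.A_def mact.B_def mact.C_def mact.D_def)
  qed (use x in \<open>simp add: nw_plus_def\<close>)
  then show ?thesis by (simp add: pr_mult pr_zero_iff)
qed

text \<open>Every vector of the module lies in \<open>S\<close>, so \<open>singular_in_G\<close>
  puts a singular one into the span of the powers. \<open>Y\<close> is a tensor that represents the
  degenerate creation operator on them.\<close>

lemma singular_classification:
  assumes i0: "i0 \<in> letter_set" "wt (cc - of_int m) i0 = 0"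
    and uniq: "\<And>i. i \<in> letter_set \<Longrightarrow> wt (cc - of_int m) i = 0 \<Longrightarrow> i = i0"
    and Y: "\<And>k. (mact.cre i0 ^^ k) (pr 1) = pr (Y ^ k)"
    and t: "\<And>x. x \<in> nw_plus m \<Longrightarrow> gen x * t \<in> L"
  shows "\<exists>N f. t - (\<Sum>k<N. scaleV (f k) (Y ^ k)) \<in> L"
proof -
  interpret hw: hw_module mact.A mact.B mact.C mact.D pr "cc - of_int m" "mact.powspan (mact.cre i0)"
    by (rule mact.hw_module_powspan[OF i0 uniq])
  have "pr 1 \<in> mact.powspan (mact.cre i0)"
    using mact.powspanI[of "\<lambda>k. 1" "mact.cre i0" 1] by simp
  then have S: "pr t \<in> hw.S" by (rule range_pr_S[OF hw.hw_module_axioms])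
  have z: "pr (gen x * pr t) = 0" if "x \<in> nw_plus m" for x
    using t[OF that] by (simp add: pr_mult pr_zero_iff)
  have "pr t \<in> mact.powspan (mact.cre i0)"
    by (rule hw.singular_in_G[OF S])
       (auto simp: mact.A_def mact.B_def mact.C_def mact.D_def nw_plus_def intro!: z)
  then obtain N f where "pr t = (\<Sum>k<N. scaleV (f k) ((mact.cre i0 ^^ k) (pr 1)))"
    unfolding mact.powspan_def by blast
  then have "pr t = pr (\<Sum>k<N. scaleV (f k) (Y ^ k))"
    by (simp add: Y lin_sum[OF pr_lin] lin_scale[OF pr_lin])
  then show ?thesis unfolding pr_eq_iff by blast
qed

lemma b_vertex_power: "(mact.cre (LB n) ^^ k) (pr 1) = pr (b_vertex m n ^ k)"
  using mact.T_b_vertex_power[of n k] by (simp add: mact.cre_def pr_mult)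

lemma a_vertex_power: "(mact.cre (LA n) ^^ k) (pr 1) = pr (a_vertex m n ^ k)"
  using mact.T_a_vertex_power[of n k] by (simp add: mact.cre_def pr_mult)

end

section \<open>Homogeneous vectors and the operators of the theorem\<close>

definition homog :: "int \<Rightarrow> int \<Rightarrow> (nw word \<Rightarrow>\<^sub>0 complex) set" where
  "homog m d = {t. \<forall>w\<in>Poly_Mapping.keys t. sum_list (map (nw_deg m) (letters w)) = d}"

lemma homog_sub: "subspaceV (homog m d)"
  unfolding subspaceV_def homog_def
  by (auto simp: in_keys_iff dest!: subsetD[OF Poly_Mapping.keys_add])

lemma homog_mult: "s \<in> homog m d \<Longrightarrow> t \<in> homog m d' \<Longrightarrow> s * t \<in> homog m (d + d')"
  unfolding homog_def using Poly_Mapping.keys_mult[of s t] by (fastforce simp: plus_word_def)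

lemma homog_power: "t \<in> homog m d \<Longrightarrow> t ^ k \<in> homog m (of_nat k * d)"
proof (induction k)
  case 0
  then show ?case by (simp add: homog_def zero_word_def)
next
  case (Suc k)
  then show ?case using homog_mult[of t m d "t ^ k" "of_nat k * d"] by (simp add: algebra_simps)
qed

lemma homog_word: "sum_list (map (nw_deg m) xs) = d \<Longrightarrow> Poly_Mapping.single (Word xs) z \<in> homog m d"
  by (auto simp: homog_def)

lemma homog_cword: "\<rho> \<in> Part r \<Longrightarrow> cword \<rho> \<in> homog m (int r)"
  unfolding cword_def
proof (rule homog_word)
  assume r: "\<rho> \<in> Part r"
  have "sum_list (map (nw_deg m) (map (\<lambda>k. At Hc (- int k)) ks)) = int (sum_list ks)" for ks
    by (induction ks) simp_all
  moreover have "sum_list (sorted_list_of_multiset \<rho>) = r"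
    using r unfolding Part_def by (metis (mono_tags, lifting) mem_Collect_eq mset_sorted_list_of_multiset sum_mset_sum_list)
  ultimately show "sum_list (map (nw_deg m) (map (\<lambda>k. At Hc (- int k)) (sorted_list_of_multiset \<rho>))) = int r"
    by simp
qed

lemma homog_cexp: "cexp \<tau> r \<in> homog m (int r)"
  unfolding cexp_def by (intro subspaceV_sum[OF homog_sub] subspaceV_scale[OF homog_sub] homog_cword)

lemma homog_b_vertex: "b_vertex m n \<in> homog m (int (n + 1))"
  unfolding b_vertex_def
proof (rule subspaceV_sum[OF homog_sub])
  fix p assume "p \<in> {..n}"
  then show "cexp 1 (n - p) * gen (At Hb (- int p + m)) \<in> homog m (int (n + 1))"
    using homog_mult[OF homog_cexp[of 1 "n - p" m] homog_word[of m "[At Hb (- int p + m)]" "int p + 1" 1]]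
    by (simp add: of_nat_diff algebra_simps)
qed

lemma homog_a_vertex: "n \<ge> 1 \<Longrightarrow> a_vertex m n \<in> homog m (int (n - 1))"
  unfolding a_vertex_def
proof (rule subspaceV_sum[OF homog_sub])
  fix p assume "n \<ge> 1" "p \<in> {1..n}"
  then show "cexp (- 1) (n - p) * gen (At Ha (- int p - m)) \<in> homog m (int (n - 1))"
    using homog_mult[OF homog_cexp[of "- 1" "n - p" m] homog_word[of m "[At Ha (- int p - m)]" "int p - 1" 1]]
    by (simp add: of_nat_diff algebra_simps)
qed

lemma nwu_mode_eq: "nwu_mode x n = nwu_class (gen (At x n))"
  by (simp add: nwu_mode_def nwu_lie_def tensor_incl_single)

lemma cprod_eq: "cprod \<rho> = nwu_class (cword \<rho>)"
proof -
  have "foldr (\<lambda>p x. nwu_mode Hc (- int p) \<otimes>\<^bsub>NWU\<^esub> x) ks \<one>\<^bsub>NWU\<^esub> =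
      nwu_class (Poly_Mapping.single (Word (map (\<lambda>k. At Hc (- int k)) ks)) 1)" for ks
  proof (induction ks)
    case Nil
    then show ?case by (simp add: single_Nil nwu_class_ops)
  next
    case (Cons k ks)
    then show ?case by (simp add: nwu_mode_eq nwu_class_ops(1) gen_times_word)
  qed
  then show ?thesis by (simp add: cprod_def cword_def)
qed

lemma nwu_term: "nwu_scalar z \<otimes>\<^bsub>NWU\<^esub> cprod \<rho> \<otimes>\<^bsub>NWU\<^esub> nwu_mode x n = nwu_class (scaleV z (cword \<rho> * gen (At x n)))"
  by (simp add: nwu_scalar_def cprod_eq nwu_mode_eq nwu_class_ops(1) scaleV_conv_mult mult.assoc)

text \<open>The terms with coefficients \<open>a\<close> form the part \<open>p = 0\<close> of the
  vertex; those with coefficients \<open>b\<close>, regrouped by the removed part, form the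
  rest.\<close>

lemma b_operator_eq:
  assumes a: "\<forall>\<mu>\<in>Part n. a \<mu> = \<beta> / zz \<mu>" and b: "\<forall>p\<in>{1..n}. \<forall>\<rho>\<in>Part (n - p). b \<rho> p = \<beta> / zz \<rho>"
  shows "b_operator m n a b = nwu_class (scaleV \<beta> (b_vertex m n))"
proof -
  have "b_operator m n a b = nwu_class (\<Sum>\<mu>\<in>Part n. scaleV (a \<mu>) (cword \<mu> * gen (At Hb m)) +
      (\<Sum>p\<in>set_mset \<mu>. scaleV (b (\<mu> - {#p#}) p) (cword (\<mu> - {#p#}) * gen (At Hb (- int p + m)))))"
    by (simp only: b_operator_def nwu_term nwu_class_finsum nwu_class_ops(2))
  also have "(\<Sum>\<mu>\<in>Part n. scaleV (a \<mu>) (cword \<mu> * gen (At Hb m)) +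
      (\<Sum>p\<in>set_mset \<mu>. scaleV (b (\<mu> - {#p#}) p) (cword (\<mu> - {#p#}) * gen (At Hb (- int p + m))))) =
      (\<Sum>\<mu>\<in>Part n. scaleV (a \<mu>) (cword \<mu> * gen (At Hb m))) +
      (\<Sum>p\<in>{1..n}. \<Sum>\<rho>\<in>Part (n - p). scaleV (b \<rho> p) (cword \<rho> * gen (At Hb (- int p + m))))"
    unfolding sum.distrib by (subst sum_Part_remove) simp
  also have "\<dots> = scaleV \<beta> (cexp 1 n * gen (At Hb m)) +
      (\<Sum>p\<in>{1..n}. scaleV \<beta> (cexp 1 (n - p) * gen (At Hb (- int p + m))))"
    using a b by (simp add: cexp_def sum_distrib_right scaleV_mult_left scaleV_sum_right)
  also have "\<dots> = scaleV \<beta> (b_vertex m n)"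
  proof -
    have "{..n} = insert 0 {1..n}" by auto
    then show ?thesis by (simp add: b_vertex_def scaleV_sum_right scaleV_add_right)
  qed
  finally show ?thesis .
qed

lemma a_operator_eq:
  assumes c: "\<forall>p\<in>{1..n}. \<forall>\<rho>\<in>Part (n - p). c \<rho> p = \<beta> * (- 1) ^ size \<rho> / zz \<rho>"
  shows "a_operator m n c = nwu_class (scaleV \<beta> (a_vertex m n))"
proof -
  have "a_operator m n c = nwu_class (\<Sum>\<mu>\<in>Part n.
      \<Sum>p\<in>set_mset \<mu>. scaleV (c (\<mu> - {#p#}) p) (cword (\<mu> - {#p#}) * gen (At Ha (- int p - m))))"
    by (simp only: a_operator_def nwu_term nwu_class_finsum)
  also have "(\<Sum>\<mu>\<in>Part n. \<Sum>p\<in>set_mset \<mu>. scaleV (c (\<mu> - {#p#}) p) (cword (\<mu> - {#p#}) * gen (At Ha (- int p - m)))) =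
      (\<Sum>p\<in>{1..n}. \<Sum>\<rho>\<in>Part (n - p). scaleV (c \<rho> p) (cword \<rho> * gen (At Ha (- int p - m))))"
    by (rule sum_Part_remove)
  also have "\<dots> = scaleV \<beta> (a_vertex m n)"
    using c by (simp add: a_vertex_def cexp_def sum_distrib_right scaleV_mult_left scaleV_sum_right)
  finally show ?thesis .
qed

context presentation
begin

lemma finsum_eq: "finite A \<Longrightarrow> (\<And>v. v \<in> A \<Longrightarrow> F v = ev (t v)) \<Longrightarrow> (\<Oplus>\<^bsub>M\<^esub>v\<in>A. F v) = ev (\<Sum>v\<in>A. t v)"
proof (induction A rule: finite_induct)
  case empty
  interpret abelian_group M by (rule abelian_group_M)
  show ?case by (simp add: ev_simps(3))
next
  case (insert x A)
  interpret abelian_group M by (rule abelian_group_M)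
  have "F \<in> insert x A \<rightarrow> carrier M" using insert by (auto simp: ev_simps(1))
  then show ?case using insert by (simp add: ev_simps(2) Pi_def)
qed

lemma scalar_ev: "nwu_scalar z \<odot>\<^bsub>M\<^esub> ev t = ev (scaleV z t)"
  by (simp add: nwu_scalar_def ev_simps(4) scaleV_conv_mult)

lemma lie_ev:
  assumes "\<And>x. x \<in> S \<Longrightarrow> gen x * t \<in> L" "Poly_Mapping.keys b \<subseteq> S"
  shows "nwu_lie b \<odot>\<^bsub>M\<^esub> ev t = \<zero>\<^bsub>M\<^esub>"
proof -
  have sub: "subspaceV L" by (rule left_ideal_subspace[OF L_left_ideal])
  have "tensor_incl b * t \<in> L"
    using assms(2)
  proof (induction b rule: vec_induct_on)
    case (single x)
    then show ?case using assms(1) by (simp add: tensor_incl_single)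
  qed (simp_all add: tensor_incl_eq_lext lin_zero[OF lext_lin] lin_add[OF lext_lin] lin_scale[OF lext_lin]
      distrib_right scaleV_mult_left subspaceV_zero[OF sub] subspaceV_add[OF sub] subspaceV_scale[OF sub])
  then show ?thesis by (simp add: nwu_lie_def ev_simps(4) ev_eq_zero)
qed

lemma lie_ev_D:
  assumes "\<And>b. Poly_Mapping.keys b \<subseteq> S \<Longrightarrow> nwu_lie b \<odot>\<^bsub>M\<^esub> ev t = \<zero>\<^bsub>M\<^esub>" "x \<in> S"
  shows "gen x * t \<in> L"
  using assms(1)[of "Poly_Mapping.single x 1"] assms(2)
  by (simp add: nwu_lie_def tensor_incl_single ev_simps(4) ev_eq_zero)

end

context nw_induced
begin

text \<open>By minimality of \<open>L\<close>, since the vacuum of the free field module satisfies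
  the highest weight conditions. For \<open>\<epsilon> = 1\<close> both values of the flag qualify,
  for \<open>\<epsilon> = 0\<close> the one that lets \<open>b(m)\<close> kill the vacuum.\<close>

lemma L_kern:
  assumes "\<epsilon> = 1 \<or> fl"
  shows "L \<subseteq> free_field_action.kern (cc - of_int m) dd fl m"
proof -
  interpret ff: free_field_action "cc - of_int m" dd fl m .
  show ?thesis
  proof (rule L_minimal[OF ff.kern_left_ideal ff.kern_ideal])
    fix x assume "x \<in> nw_sub m \<epsilon>"
    then show "gen x - Poly_Mapping.single 0 (nw_char cc dd x) \<in> ff.kern"
      using ff.kern_gen[of x \<epsilon>] \<epsilon> assms by auto
  qed
qed

lemma one_notin_L: "1 \<notin> L"
  using L_kern[of True] free_field_action.kern_one by blast

end

lemma nw_span_mono: "S \<subseteq> T \<Longrightarrow> nw_span M S \<subseteq> nw_span M T"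
  unfolding nw_span_def by blast

locale nw_induced1 = nw_induced m 1 cc dd for m :: int and cc dd :: complex
begin

lemma homogeneous_ev: "t \<in> homog m (int d) \<Longrightarrow> ev t \<in> nw_homogeneous cc dd m d"
  unfolding nw_homogeneous_def nwu_homogeneous_def vac_eq
  by (rule image_eqI[of _ _ "nwu_class t"]) (auto simp: ev_simps(4) homog_def)

lemma singular_iff:
  "nw_singular cc dd m (ev t) \<longleftrightarrow> (\<exists>d. ev t \<in> nw_homogeneous cc dd m d) \<and> (\<forall>x\<in>nw_plus m. gen x * t \<in> L)"
  unfolding nw_singular_def using lie_ev[of "nw_plus m" t] lie_ev_D[of "nw_plus m" t] by blast

lemma singular_basis:
  assumes i0: "i0 \<in> letter_set" "wt (cc - of_int m) i0 = 0"
    and uniq: "\<And>i. i \<in> letter_set \<Longrightarrow> wt (cc - of_int m) i = 0 \<Longrightarrow> i = i0"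
    and Y: "\<And>k. (mact.cre i0 ^^ k) (pr 1) = pr (Y ^ k)"
    and hom: "Y \<in> homog m (int d)" and \<beta>: "\<beta> \<noteq> 0"
    and indep: "\<And>A f k. finite A \<Longrightarrow> (\<Sum>k\<in>A. scaleV (f k) (Y ^ k)) \<in> L \<Longrightarrow> k \<in> A \<Longrightarrow> f k = 0"
  shows "nw_singular_basis cc dd m
    (\<lambda>k. (nwu_class (scaleV \<beta> Y) [^]\<^bsub>NWU\<^esub> k) \<odot>\<^bsub>V\<^esub> nw_vac cc dd m 1)"
proof -
  have pow: "scaleV \<beta> Y ^ k = scaleV (\<beta> ^ k) (Y ^ k)" for k
    by (induction k) (simp_all add: scaleV_mult_left scaleV_mult_right mult.commute)
  define E where "E k = ev (scaleV (\<beta> ^ k) (Y ^ k))" for k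
  have E: "(nwu_class (scaleV \<beta> Y) [^]\<^bsub>NWU\<^esub> k) \<odot>\<^bsub>V\<^esub> nw_vac cc dd m 1 = E k" for k
    by (simp add: nwu_class_pow vac_eq ev_simps(4) pow E_def)
  have sub: "subspaceV L" by (rule left_ideal_subspace[OF L_left_ideal])
  have sing: "nw_singular cc dd m (E k)" for k
    unfolding E_def singular_iff
  proof (intro conjI ballI)
    have "scaleV (\<beta> ^ k) (Y ^ k) \<in> homog m (int (k * d))"
      using homog_power[OF hom, of k] by (simp add: subspaceV_scale[OF homog_sub])
    then show "\<exists>d. ev (scaleV (\<beta> ^ k) (Y ^ k)) \<in> nw_homogeneous cc dd m d"
      using homogeneous_ev by blast
    fix x assume x: "x \<in> nw_plus m"
    show "gen x * scaleV (\<beta> ^ k) (Y ^ k) \<in> L"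
      unfolding scaleV_mult_right
      by (intro subspaceV_scale[OF sub] powspan_singular[OF i0 uniq Y x])
  qed
  have ind: "\<forall>k\<in>A. f k = 0" if "finite A" "(\<Oplus>\<^bsub>V\<^esub>k\<in>A. nwu_scalar (f k) \<odot>\<^bsub>V\<^esub> E k) = \<zero>\<^bsub>V\<^esub>" for A f
  proof -
    have "(\<Oplus>\<^bsub>V\<^esub>k\<in>A. nwu_scalar (f k) \<odot>\<^bsub>V\<^esub> E k) = ev (\<Sum>k\<in>A. scaleV (f k * \<beta> ^ k) (Y ^ k))"
      by (rule finsum_eq[OF that(1)]) (simp add: E_def scalar_ev)
    then have "(\<Sum>k\<in>A. scaleV (f k * \<beta> ^ k) (Y ^ k)) \<in> L"
      unfolding that(2) by (metis ev_eq_zero)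
    from indep[OF that(1) this] show ?thesis using \<beta> by auto
  qed
  \<comment> \<open>\<open>nw_span\<close> takes coefficients indexed by vectors, so coefficients
    indexed by exponents can be transferred only along an injective family.\<close>
  have inj: "inj E"
  proof (rule injI, rule ccontr)
    fix j k assume jk: "E j = E k" "j \<noteq> k"
    let ?f = "\<lambda>i. if i = j then \<beta> ^ j else - (\<beta> ^ k)"
    have "(\<Sum>i\<in>{j, k}. scaleV (?f i) (Y ^ i)) = scaleV (\<beta> ^ j) (Y ^ j) - scaleV (\<beta> ^ k) (Y ^ k)"
      using jk(2) by (simp add: scaleV_minus_left)
    moreover have "scaleV (\<beta> ^ j) (Y ^ j) - scaleV (\<beta> ^ k) (Y ^ k) \<in> L"
      using jk(1) unfolding E_def ev_simps(5) .
    ultimately have "(\<Sum>i\<in>{j, k}. scaleV (?f i) (Y ^ i)) \<in> L" by simp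
    from indep[OF _ this, of j] show False using \<beta> by simp
  qed
  have "nw_span V {v. nw_singular cc dd m v} \<subseteq> nw_span V (range E)"
  proof
    fix x assume "x \<in> nw_span V {v. nw_singular cc dd m v}"
    then obtain A f where A: "finite A" "A \<subseteq> {v. nw_singular cc dd m v}"
      and x: "x = (\<Oplus>\<^bsub>V\<^esub>v\<in>A. nwu_scalar (f v) \<odot>\<^bsub>V\<^esub> v)"
      unfolding nw_span_def by blast
    have "\<forall>v\<in>A. \<exists>t. v = ev t"
      using A(2) unfolding nw_singular_def nw_homogeneous_def nwu_homogeneous_def vac_eq
      by (force simp: ev_simps(4))
    then obtain t where t: "\<And>v. v \<in> A \<Longrightarrow> v = ev (t v)" by metis
    let ?t = "\<Sum>v\<in>A. scaleV (f v) (t v)"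
    have xt: "x = ev ?t" unfolding x
    proof (rule finsum_eq[OF A(1)])
      fix v assume v: "v \<in> A"
      show "nwu_scalar (f v) \<odot>\<^bsub>V\<^esub> v = ev (scaleV (f v) (t v))"
        unfolding scalar_ev[symmetric] by (rule arg_cong[OF t[OF v]])
    qed
    have ann: "gen y * ?t \<in> L" if y: "y \<in> nw_plus m" for y
      unfolding sum_distrib_left scaleV_mult_right
    proof (intro subspaceV_sum[OF sub] subspaceV_scale[OF sub])
      fix v assume v: "v \<in> A"
      then have "nw_singular cc dd m (ev (t v))" using A(2) t[OF v] by auto
      then show "gen y * t v \<in> L" using y singular_iff by blast
    qed
    have "\<exists>N g. ?t - (\<Sum>k<N. scaleV (g k) (Y ^ k)) \<in> L"
      using i0 uniq Y ann by (rule singular_classification)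
    then obtain N g where g: "?t - (\<Sum>k<N. scaleV (g k) (Y ^ k)) \<in> L" by (elim exE)
    define Ei where "Ei = inv_into UNIV E"
    have Ei: "Ei (E k) = k" for k unfolding Ei_def by (rule inv_f_f[OF inj])
    define h where "h v = g (Ei v) / \<beta> ^ Ei v" for v
    have "(\<Oplus>\<^bsub>V\<^esub>v\<in>E ` {..<N}. nwu_scalar (h v) \<odot>\<^bsub>V\<^esub> v) =
        ev (\<Sum>v\<in>E ` {..<N}. scaleV (h v) (scaleV (\<beta> ^ Ei v) (Y ^ Ei v)))"
    proof (rule finsum_eq)
      fix v assume "v \<in> E ` {..<N}"
      then obtain k where k: "v = E k" by blast
      show "nwu_scalar (h v) \<odot>\<^bsub>V\<^esub> v = ev (scaleV (h v) (scaleV (\<beta> ^ Ei v) (Y ^ Ei v)))"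
        unfolding k Ei
        by (rule trans[OF arg_cong[where f = "\<lambda>x. nwu_scalar (h (E k)) \<odot>\<^bsub>V\<^esub> x", OF E_def] scalar_ev])
    qed simp
    also have "(\<Sum>v\<in>E ` {..<N}. scaleV (h v) (scaleV (\<beta> ^ Ei v) (Y ^ Ei v))) = (\<Sum>k<N. scaleV (g k) (Y ^ k))"
      by (subst sum.reindex[OF inj_on_subset[OF inj subset_UNIV]]) (simp add: h_def Ei \<beta>)
    also have "ev \<dots> = x"
    proof -
      have "ev ?t = ev (\<Sum>k<N. scaleV (g k) (Y ^ k))" unfolding ev_simps(5) by (rule g)
      then show ?thesis by (rule trans[OF sym xt[symmetric]])
    qed
    finally have "x = (\<Oplus>\<^bsub>V\<^esub>v\<in>E ` {..<N}. nwu_scalar (h v) \<odot>\<^bsub>V\<^esub> v)" by (rule sym)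
    moreover have "finite (E ` {..<N})" "E ` {..<N} \<subseteq> range E" by auto
    ultimately show "x \<in> nw_span V (range E)" unfolding nw_span_def by blast
  qed
  moreover have "nw_span V (range E) \<subseteq> nw_span V {v. nw_singular cc dd m v}"
    by (rule nw_span_mono) (use sing in auto)
  ultimately show ?thesis
    unfolding nw_singular_basis_def nw_independent_def E using sing ind by (intro conjI allI impI) auto
qed

text \<open>With the flag off, the powers of \<open>Y\<close> applied to the free field vacuum are
  distinct monomials, while elements of \<open>L\<close> annihilate that vacuum.\<close>

lemma vertex_independent:
  assumes Y: "\<And>k. tact (free_field_action.nact (cc - of_int m) dd False m) (Y ^ k) free_field.vac =
      Poly_Mapping.single (replicate_mset k j) 1"
    and A: "finite A" "(\<Sum>k\<in>A. scaleV (f k) (Y ^ k)) \<in> L" "k \<in> A"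
  shows "f k = 0"
proof -
  interpret ff: free_field_action "cc - of_int m" dd False m .
  have "(\<Sum>k\<in>A. scaleV (f k) (Y ^ k)) \<in> ff.kern" using A(2) L_kern[of False] by blast
  then have "(\<Sum>k\<in>A. Poly_Mapping.single (replicate_mset k j) (f k)) = 0"
    by (simp add: ff.kern_def lin_sum[OF tact_lin_left] lin_scale[OF tact_lin_left] Y)
  then have "Poly_Mapping.lookup (\<Sum>k\<in>A. Poly_Mapping.single (replicate_mset k j) (f k)) (replicate_mset k j) = 0"
    by simp
  moreover have "replicate_mset k' j = replicate_mset k j \<longleftrightarrow> k' = k" for k'
    by (metis size_replicate_mset)
  ultimately show ?thesis using A by (simp add: lookup_sum lookup_single when_def)
qed

end

section \<open>Irreducibility and bases of singular vectors\<close>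

context nw_induced1
begin

text \<open>A letter of weight \<open>0\<close> would make \<open>cc\<close> an integer.\<close>

lemma irreducible_if_not_integer:
  assumes "cc \<notin> \<int>"
  shows "irreducible_module NWU V"
proof (rule irreducibleI[OF one_notin_L])
  have "wt (cc - of_int m) i \<noteq> 0" if "i \<in> letter_set" for i
  proof
    assume "wt (cc - of_int m) i = 0"
    then have "cc = of_int (m + (case i of LA p \<Rightarrow> int p | LB q \<Rightarrow> - int q | LC k \<Rightarrow> 0))"
      using that by (cases i) (auto simp: wt_def letter_set_def algebra_simps eq_neg_iff_add_eq_0)
    then show False using assms by (metis Ints_of_int)
  qed
  then show "1 \<in> H" if "left_ideal H" "L \<subseteq> H" "v \<in> H" "v \<notin> L" for H v
    using irreducible_V[OF _ one_notin_L that] by blast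
qed

text \<open>The vertex of the degenerate letter kills the vacuum with the flag on but not with the
  flag off. So it lies in \<open>zero.kern\<close>, a proper left ideal above \<open>L\<close>, but
  not in \<open>L\<close>, which is contained in \<open>free.kern\<close>.\<close>

lemma reducible_if_integer:
  assumes "cc \<in> \<int>"
  shows "\<not> irreducible_module NWU V"
proof -
  interpret zero: free_field_action "cc - of_int m" dd True m .
  interpret free: free_field_action "cc - of_int m" dd False m .
  obtain c where c: "cc = of_int c" using assms by (auto elim: Ints_cases)
  have nz: "Poly_Mapping.single k (1 :: complex) \<noteq> 0" for k :: "osc multiset"
    by (metis lookup_single_eq lookup_zero zero_neq_one)
  have "\<exists>x. x \<in> zero.kern \<and> x \<notin> free.kern"
  proof (cases "c \<le> m")
    case True
    define n where "n = nat (m - c)"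
    have "zero.w (int n) = 0" "free.w (int n) = 1"
      unfolding zero.w_def free.w_def using True by (simp_all add: c n_def)
    then show ?thesis
      using zero.b_vertex_power_vac[of n 1] free.b_vertex_power_vac[of n 1]
      by (intro exI[of _ "b_vertex m n"]) (simp add: zero.kern_def free.kern_def nz)
  next
    case False
    define n where "n = nat (c - m)"
    have "zero.w (- int n) = 0" "free.w (- int n) = 1" "n \<ge> 1"
      unfolding zero.w_def free.w_def using False by (simp_all add: c n_def)
    then show ?thesis
      using zero.a_vertex_power_vac[of n 1] free.a_vertex_power_vac[of n 1]
      by (intro exI[of _ "a_vertex m n"]) (simp add: zero.kern_def free.kern_def nz)
  qed
  then show ?thesis
    using not_irreducibleI[OF zero.kern_left_ideal L_kern[of True] zero.kern_one] L_kern[of False] by blast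
qed

lemma singular_b:
  assumes "cc = of_int m"
  shows "nw_singular cc dd m (ev (gen (At Hb m)))"
  unfolding singular_iff
proof (intro conjI ballI)
  have "gen (At Hb m) \<in> homog m (int 1)" by (rule homog_word) simp
  then show "\<exists>d. ev (gen (At Hb m)) \<in> nw_homogeneous cc dd m d" by (blast intro: homogeneous_ev)
  fix x assume x: "x \<in> nw_plus m"
  \<comment> \<open>For \<open>n = 0\<close> the exponential contributes its constant term
    only.\<close>
  have "b_vertex m 0 = gen (At Hb m)"
    by (simp add: single_Nil b_vertex_def cexp_def Part_0 cword_def)
  moreover have "gen x * b_vertex m 0 ^ 1 \<in> L"
    by (rule powspan_singular[of "LB 0", OF _ _ _ b_vertex_power x])
       (use assms in \<open>auto simp: letter_set_def wt_def split: letter.splits\<close>)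
  ultimately show "gen x * gen (At Hb m) \<in> L" by simp
qed

lemma singular_basis_b:
  assumes n: "n \<ge> 1" "cc + of_nat n = of_int m" and ab: "b_coefficients n a b"
  shows "nw_singular_basis cc dd m (\<lambda>k. (b_operator m n a b [^]\<^bsub>NWU\<^esub> k) \<odot>\<^bsub>V\<^esub> nw_vac cc dd m 1)"
proof -
  obtain \<beta> where \<beta>: "\<beta> \<noteq> 0" "\<forall>\<mu>\<in>Part n. a \<mu> = \<beta> / zz \<mu>"
    "\<forall>p\<in>{1..n}. \<forall>\<rho>\<in>Part (n - p). b \<rho> p = \<beta> / zz \<rho>"
    using b_coefficients_unique[OF n(1) ab] by blast
  have \<kappa>: "cc - of_int m = - of_nat n" using n(2) by (simp add: algebra_simps eq_neg_iff_add_eq_0)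
  interpret free: free_field_action "cc - of_int m" dd False m .
  show ?thesis unfolding b_operator_eq[OF \<beta>(2,3)]
  proof (rule singular_basis[of "LB n", OF _ _ _ b_vertex_power homog_b_vertex \<beta>(1)])
    show "i = LB n" if "i \<in> letter_set" "wt (cc - of_int m) i = 0" for i
      using that unfolding \<kappa> by (cases i) (auto simp: letter_set_def wt_def simp flip: of_nat_add)
    show "f k = 0" if "finite A" "(\<Sum>k\<in>A. scaleV (f k) (b_vertex m n ^ k)) \<in> L" "k \<in> A" for A f k
      by (rule vertex_independent[OF _ that]) (simp add: free.b_vertex_power_vac free.w_def)
  qed (simp_all add: letter_set_def wt_def \<kappa>)
qed

lemma singular_basis_a:
  assumes n: "n \<ge> 1" "cc = of_int m + of_nat n" and c: "a_coefficients n c"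
  shows "nw_singular_basis cc dd m (\<lambda>k. (a_operator m n c [^]\<^bsub>NWU\<^esub> k) \<odot>\<^bsub>V\<^esub> nw_vac cc dd m 1)"
proof -
  obtain \<beta> where \<beta>: "\<beta> \<noteq> 0" "\<forall>p\<in>{1..n}. \<forall>\<rho>\<in>Part (n - p). c \<rho> p = \<beta> * (- 1) ^ size \<rho> / zz \<rho>"
    using a_coefficients_unique[OF c] by blast
  have \<kappa>: "cc - of_int m = of_nat n" using n(2) by simp
  interpret free: free_field_action "cc - of_int m" dd False m .
  show ?thesis unfolding a_operator_eq[OF \<beta>(2)]
  proof (rule singular_basis[of "LA n", OF _ _ _ a_vertex_power homog_a_vertex[OF n(1)] \<beta>(1)])
    show "i = LA n" if "i \<in> letter_set" "wt (cc - of_int m) i = 0" for i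
      using that n(1) unfolding \<kappa> by (cases i) (auto simp: letter_set_def wt_def simp flip: of_nat_add)
    show "f k = 0" if "finite A" "(\<Sum>k\<in>A. scaleV (f k) (a_vertex m n ^ k)) \<in> L" "k \<in> A" for A f k
      by (rule vertex_independent[OF _ that]) (simp add: free.a_vertex_power_vac[OF n(1)] free.w_def)
  qed (use n(1) in \<open>simp_all add: letter_set_def wt_def \<kappa>\<close>)
qed

end

lemma quotient_by_b:
  fixes m :: int and cc dd :: complex
  assumes cc: "cc = of_int m"
  defines "V \<equiv> nw_verma cc dd m 1"
  defines "u \<equiv> nwu_mode Hb m \<odot>\<^bsub>V\<^esub> nw_vac cc dd m 1"
  defines "Q \<equiv> quotient_module V (cyclic_submodule NWU V u)"
  shows "nw_singular cc dd m u" "irreducible_module NWU Q" "module_isomorphic NWU Q (nw_verma cc dd m 0)"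
proof -
  interpret one: nw_induced1 m cc dd by standard simp
  interpret zero: nw_induced m 0 cc dd by standard (simp add: cc)
  have u: "u = one.ev (gen (At Hb m))"
    by (simp add: u_def V_def nwu_mode_eq one.vac_eq one.ev_simps(4))
  show "nw_singular cc dd m u" unfolding u by (rule one.singular_b[OF cc])
  have sub: "subspaceV one.L" by (rule left_ideal_subspace[OF one.L_left_ideal])
  have b: "gen (At Hb m) \<in> zero.L" using zero.gen_L[of "At Hb m"] by (simp add: nw_sub_def)
  have mono: "nw_sub m 1 \<subseteq> nw_sub m 0" by (auto simp: nw_sub_def)
  have sub01: "one.L \<subseteq> zero.L"
    by (rule one.L_minimal[OF zero.L_left_ideal]) (use zero.ideal_L zero.gen_L mono in blast)+
  \<comment> \<open>The sum of \<open>one.L\<close> and the left ideal generated by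
    \<open>b(m)\<close>. It contains the generators of \<open>zero.L\<close>, hence
    \<open>zero.L\<close> itself by minimality, so the quotient has the presentation of the module
    with \<open>\<epsilon> = 0\<close>.\<close>
  let ?L' = "{t. \<exists>s. t - s * gen (At Hb m) \<in> one.L}"
  have "zero.L \<subseteq> ?L'"
  proof (rule zero.L_minimal)
    show "left_ideal ?L'"
      unfolding left_ideal_def
    proof (intro conjI ballI allI)
      show "0 \<in> ?L'" using subspaceV_zero[OF sub] by (auto intro: exI[of _ 0])
      show "t + t' \<in> ?L'" if "t \<in> ?L'" "t' \<in> ?L'" for t t'
      proof -
        obtain s s' where "t - s * gen (At Hb m) \<in> one.L" "t' - s' * gen (At Hb m) \<in> one.L" using \<open>t \<in> ?L'\<close> \<open>t' \<in> ?L'\<close> by blast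
        from subspaceV_add[OF sub this] have "t + t' - (s + s') * gen (At Hb m) \<in> one.L"
          by (simp add: distrib_right algebra_simps)
        then show ?thesis by blast
      qed
      show "r * t \<in> ?L'" if "t \<in> ?L'" for r t
      proof -
        obtain s where "t - s * gen (At Hb m) \<in> one.L" using \<open>t \<in> ?L'\<close> by blast
        from left_idealD(3)[OF one.L_left_ideal this, of r] have "r * t - (r * s) * gen (At Hb m) \<in> one.L"
          by (simp add: right_diff_distrib mult.assoc)
        then show ?thesis by blast
      qed
    qed
    show "uea_ideal nw_br UNIV \<subseteq> ?L'" using one.ideal_L by (auto intro!: exI[of _ 0])
    fix x assume x: "x \<in> nw_sub m 0"
    show "gen x - Poly_Mapping.single 0 (nw_char cc dd x) \<in> ?L'"
    proof (cases "x = At Hb m")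
      case True
      then show ?thesis using subspaceV_zero[OF sub] by (auto intro!: exI[of _ 1])
    next
      case False
      then have "x \<in> nw_sub m 1" using x by (auto simp: nw_sub_def)
      then show ?thesis using one.gen_L by (auto intro!: exI[of _ 0])
    qed
  qed
  then have pres: "presents Q (\<lambda>t. cyclic_submodule NWU V u +>\<^bsub>V\<^esub> one.ev t) zero.L"
    unfolding Q_def u V_def by (intro one.quotient_presents[OF b zero.L_left_ideal sub01]) blast
  show "module_isomorphic NWU Q (nw_verma cc dd m 0)"
    by (rule presents_isomorphic[OF pres zero.V_presents])
  interpret Q: presentation Q "\<lambda>t. cyclic_submodule NWU V u +>\<^bsub>V\<^esub> one.ev t" zero.L
    by standard (rule pres)
  \<comment> \<open>\<open>LB 0\<close> is the only letter of weight \<open>0\<close>, and it kills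
    the generator because \<open>b(m)\<close> lies in the subalgebra. The vacua thus form a line and
    irreducibility follows as in the nonintegral case.\<close>
  have "zero.mact.cre i (zero.pr 1) = 0" if "i \<in> letter_set" "wt (cc - of_int m) i = 0" for i
  proof -
    have "i = LB 0" using that by (cases i) (auto simp: cc letter_set_def wt_def)
    moreover have "zero.mact.Bh 0 (zero.pr 1) = 0"
    proof (rule zero.mact.Bh_zero)
      show "zero.mact.B q (zero.pr 1) = 0" if "q \<ge> 0" for q
        using that by (simp add: zero.mact.B_def zero.gen_one nw_sub_def)
    qed
    ultimately show ?thesis by (simp add: zero.mact.cre_def)
  qed
  then show "irreducible_module NWU Q"
    by (intro Q.irreducibleI[OF zero.one_notin_L] zero.irreducible_V[OF _ zero.one_notin_L])
qed

theorem theorem3p3: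
  fixes m :: int and cc dd :: complex
  assumes "cc \<noteq> 0 \<or> dd \<noteq> 0"
  shows "(irreducible_module NWU (nw_verma cc dd m 1) \<longleftrightarrow> cc \<notin> \<int>) \<and>
    (cc = of_int m \<longrightarrow>
       (let V = nw_verma cc dd m 1;
            u = nwu_mode Hb m \<odot>\<^bsub>V\<^esub> nw_vac cc dd m 1;
            Q = quotient_module V (cyclic_submodule NWU V u)
        in nw_singular cc dd m u \<and> irreducible_module NWU Q \<and>
           module_isomorphic NWU Q (nw_verma cc dd m 0))) \<and>
    (\<forall>n::nat. n \<ge> 1 \<and> cc + of_nat n = of_int m \<longrightarrow>
       (\<exists>a b. b_coefficients n a b) \<and>
       (\<forall>a b. b_coefficients n a b \<longrightarrow>
          nw_singular_basis cc dd m
            (\<lambda>k. (b_operator m n a b [^]\<^bsub>NWU\<^esub> k) \<odot>\<^bsub>nw_verma cc dd m 1\<^esub> nw_vac cc dd m 1))) \<and>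
    (\<forall>n::nat. n \<ge> 1 \<and> cc = of_int m + of_nat n \<longrightarrow>
       (\<exists>c. a_coefficients n c) \<and>
       (\<forall>c. a_coefficients n c \<longrightarrow>
          nw_singular_basis cc dd m
            (\<lambda>k. (a_operator m n c [^]\<^bsub>NWU\<^esub> k) \<odot>\<^bsub>nw_verma cc dd m 1\<^esub> nw_vac cc dd m 1)))"
proof -
  interpret nw_induced1 m cc dd by standard simp
  show ?thesis
    unfolding Let_def
  proof (intro conjI allI impI)
    show "irreducible_module NWU (nw_verma cc dd m 1) \<longleftrightarrow> cc \<notin> \<int>"
      using irreducible_if_not_integer reducible_if_integer by blast
  qed ((elim conjE)?, ((intro exI)?,
      rule quotient_by_b b_coefficients_exist a_coefficients_exist singular_basis_b singular_basis_a, assumption+)[1])+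
qed

end
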